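(* Let $X$ be a locally compact metrisable space, let $(X,\Phi)$ be a dynamical system with $\Phi=\{\phi_{\mathbf n}:\mathbf n\in\mathbb{Z}_+^d\}$, and let $\mathcal{A}=C_0(X)\times_\phi\mathbb{Z}_+^d$ be the associated analytic crossed product. Then the Jacobson radical $\mathrm{Rad}\,\mathcal{A}$ is the closed ideal of $\mathcal{A}$ generated by all monomials $U_{\mathbf n}f$ with $\mathbf n\in\mathbb{Z}_+^d$, $\mathbf n\neq\mathbf 0$, and $f\in C_0(X)$ vanishing on the set $X_{Jr}$ of $J$-recurrent points, where $J=\{j: n_j\ne0\}$ is the support of $\mathbf n$. Moreover, $\mathrm{PRad}\,\mathcal{A}=\mathrm{Rad}\,\mathcal{A}$ if and only if $\mathrm{PRad}\,\mathcal{A}$ is closed.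
   Context: Let $d\ge1$ and $\mathbb{Z}_+=\{0,1,2,\dots\}$. Dynamical system: $X$ is a locally compact metrisable space and $\Phi=\{\phi_{\mathbf n}:\mathbf n=(n_1,\dots,n_d)\in\mathbb{Z}_+^d\}$ is a semigroup (under composition) of continuous proper surjections $X\to X$, isomorphic as a semigroup to $\mathbb{Z}_+^d$ via $\mathbf n\mapsto\phi_{\mathbf n}$ (so $\phi_{\mathbf n+\mathbf m}=\phi_{\mathbf n}\circ\phi_{\mathbf m}$, $\phi_{\mathbf 0}=\mathrm{id}$). For $J\subseteq\{1,\dots,d\}$, a point $x\in X$ is $J$-recurrent if there is a sequence $(\mathbf n_k)$ in $\mathbb{Z}_+^d$ that is strictly increasing in the directions of $J$ (for every $j\in J$ and every $k$, the $j$-th entry of $\mathbf n_{k+1}$ is greater than that of $\mathbf n_k$; entries outside $J$ are arbitrary) such that $\lim_k\phi_{\mathbf n_k}(x)=x$. $X_{Jr}$ is the set of $J$-recurrent points. Analytic crossed product: write elements of the Banach space $\ell^1(\mathbb{Z}_+^d,C_0(X))$ as formal series $\sum_{\mathbf n}U_{\mathbf n}f_{\mathbf n}$ with norm $\sum_{\mathbf n}\|f_{\mathbf n}\|_\infty$. Put $\alpha_{\mathbf n}(f)=f\circ\phi_{\mathbf n}$. The multiplication determined by $(U_{\mathbf n}f)(U_{\mathbf m}g)=U_{\mathbf n+\mathbf m}(\alpha_{\mathbf m}(f)g)$, extended by linearity and continuity, makes it a Banach algebra. Let $C_0(X)$ be represented faithfully (by a $*$-representation) on a Hilbert space $H_o$,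 and define a faithful contractive representation $\pi$ of $\ell^1(\mathbb{Z}_+^d,C_0(X))$ on $\mathcal{H}=H_o\otimes\ell^2(\mathbb{Z}_+^d)$ by $\pi(U_{\mathbf n}f)(\xi\otimes e_{\mathbf k})=\alpha_{\mathbf k}(f)\xi\otimes e_{\mathbf k+\mathbf n}$. The analytic crossed product $\mathcal{A}=C_0(X)\times_\phi\mathbb{Z}_+^d$ is the norm closure of the image of $\pi$ in $\mathcal{B}(\mathcal{H})$ (independent, up to isometric isomorphism, of the faithful representation of $C_0(X)$); $U_{\mathbf n}f$ is identified with its image $\pi(U_{\mathbf n}f)$ and is called a monomial. Ideals are two-sided. $\mathrm{Rad}\,\mathcal{A}$ is the intersection of all primitive ideals of $\mathcal{A}$ (kernels of algebraically irreducible representations). An ideal $\mathcal{J}$ is prime if, whenever $\mathcal{J}_1,\mathcal{J}_2$ are ideals with $\mathcal{J}_1\mathcal{J}_2\subseteq\mathcal{J}$, then $\mathcal{J}_1\subseteq\mathcal{J}$ or $\mathcal{J}_2\subseteq\mathcal{J}$. $\mathrm{PRad}\,\mathcal{A}$, the prime radical, is the intersection of all prime ideals of $\mathcal{A}$ (it need not be closed). *)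

theory Defs
  imports "HOL-Analysis.Analysis"
begin

subsection \<open>Complex vector spaces and complex Hilbert spaces\<close>

class complex_vector = real_vector +
  fixes scaleC :: "complex \<Rightarrow> 'a \<Rightarrow> 'a"  (infixr \<open>*\<^sub>C\<close> 75)
  assumes scaleR_scaleC: "r *\<^sub>R x = complex_of_real r *\<^sub>C x"
    and scaleC_add_right: "c *\<^sub>C (x + y) = c *\<^sub>C x + c *\<^sub>C y"
    and scaleC_add_left: "(c + e) *\<^sub>C x = c *\<^sub>C x + e *\<^sub>C x"
    and scaleC_scaleC: "c *\<^sub>C e *\<^sub>C x = (c * e) *\<^sub>C x"
    and scaleC_one: "1 *\<^sub>C x = x"

interpretation cvec: vector_space "scaleC :: complex \<Rightarrow> 'a \<Rightarrow> 'a::complex_vector"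
  by standard (simp_all add: scaleC_add_right scaleC_add_left scaleC_scaleC scaleC_one)

class complex_normed_vector = complex_vector + real_normed_vector +
  assumes norm_scaleC: "norm (c *\<^sub>C x) = cmod c * norm x"

text \<open>The inner product is linear in its first argument.\<close>

class chilbert_space = complex_normed_vector + complete_space +
  fixes cinner :: "'a \<Rightarrow> 'a \<Rightarrow> complex"
  assumes cinner_commute: "cinner x y = cnj (cinner y x)"
    and cinner_add_left: "cinner (x + y) z = cinner x z + cinner y z"
    and cinner_scaleC_left: "cinner (c *\<^sub>C x) y = c * cinner x y"
    and cinner_self: "cinner x x = complex_of_real ((norm x)\<^sup>2)"
begin
subclass banach ..
end

instantiation complex :: chilbert_space
begin

definition scaleC_complex :: "complex \<Rightarrow> complex \<Rightarrow> complex" where "scaleC_complex c z = c * z"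
definition cinner_complex :: "complex \<Rightarrow> complex \<Rightarrow> complex" where "cinner_complex w z = w * cnj z"

instance
  by standard (auto simp: scaleC_complex_def cinner_complex_def algebra_simps scaleR_conv_of_real
      norm_mult complex_norm_square simp del: of_real_power)

end

lemma cinner_add_right: "cinner x (y + z) = cinner x y + cinner x (z::'a::chilbert_space)"
  by (metis cinner_add_left cinner_commute complex_cnj_add)

lemma cinner_scaleC_right: "cinner x (c *\<^sub>C y) = cnj c * cinner x (y::'a::chilbert_space)"
  by (metis cinner_commute cinner_scaleC_left complex_cnj_mult)

lemma cinner_zero [simp]: "cinner 0 (y::'a::chilbert_space) = 0" "cinner y 0 = 0"
  using cinner_add_left[of 0 0 y] cinner_add_right[of y 0 0] by simp_all

lemma cinner_minus_left: "cinner (x - y) z = cinner x z - cinner y (z::'a::chilbert_space)"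
  by (metis add_diff_cancel cinner_add_left diff_add_cancel)

lemma cinner_minus_right: "cinner x (y - z) = cinner x y - cinner x (z::'a::chilbert_space)"
  by (metis add_diff_cancel cinner_add_right diff_add_cancel)

lemma cmod_cinner_le: "2 * cmod (cinner x y) \<le> (norm x)\<^sup>2 + (norm (y::'a::chilbert_space))\<^sup>2"
proof -
  define s where "s = (if cinner x y = 0 then 1 else cnj (cinner x y) / cmod (cinner x y))"
  have s: "cmod s = 1" "s * cinner x y = complex_of_real (cmod (cinner x y))"
    by (auto simp: s_def norm_divide complex_norm_square[symmetric] power2_eq_square
        mult.commute[of "cnj _"] divide_simps simp flip: of_real_mult)
  have ss: "s * cnj s = 1"
    using s(1) by (metis complex_norm_square of_real_1 power_one)
  have s2: "cnj s * cinner y x = complex_of_real (cmod (cinner x y))"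
    by (metis cinner_commute complex_cnj_complex_of_real complex_cnj_mult s(2))
  have "cinner (s *\<^sub>C x - y) (s *\<^sub>C x - y) = (s * cnj s) * cinner x x + cinner y y
      - s * cinner x y - cnj s * cinner y x"
    by (simp add: cinner_minus_left cinner_minus_right cinner_scaleC_left cinner_scaleC_right
        algebra_simps)
  also have "\<dots> = complex_of_real ((norm x)\<^sup>2 + (norm y)\<^sup>2 - 2 * cmod (cinner x y))"
    by (simp add: ss s(2) s2 cinner_self)
  finally have "(norm (s *\<^sub>C x - y))\<^sup>2 = (norm x)\<^sup>2 + (norm y)\<^sup>2 - 2 * cmod (cinner x y)"
    unfolding cinner_self of_real_eq_iff .
  then show ?thesis
    using zero_le_power2[of "norm (s *\<^sub>C x - y)"] by linarith
qed


subsection \<open>Bounded operators\<close>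

instantiation blinfun :: (real_normed_vector, complex_normed_vector) complex_normed_vector
begin

lift_definition scaleC_blinfun :: "complex \<Rightarrow> 'a \<Rightarrow>\<^sub>L 'b \<Rightarrow> 'a \<Rightarrow>\<^sub>L 'b" is "\<lambda>c T x. c *\<^sub>C T x"
proof -
  fix c :: complex and T :: "'a \<Rightarrow> 'b"
  assume "bounded_linear T"
  then interpret T: bounded_linear T .
  obtain K where "\<And>x. norm (T x) \<le> norm x * K"
    using T.bounded by blast
  then have "norm (c *\<^sub>C T x) \<le> norm x * (K * cmod c)" for x
    using mult_left_mono[of "norm (T x)" "norm x * K" "cmod c"] by (simp add: norm_scaleC ac_simps)
  then show "bounded_linear (\<lambda>x. c *\<^sub>C T x)"
    by (intro bounded_linear_intro[of _ "K * cmod c"])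
      (simp_all add: T.add T.scaleR scaleC_add_right scaleR_scaleC scaleC_scaleC mult.commute)
qed

instance
proof
  fix c e :: complex and r :: real and x y :: "'a \<Rightarrow>\<^sub>L 'b"
  show "r *\<^sub>R x = complex_of_real r *\<^sub>C x"
    by (transfer, simp add: scaleR_scaleC)
  show "c *\<^sub>C (x + y) = c *\<^sub>C x + c *\<^sub>C y"
    by (transfer, simp add: scaleC_add_right)
  show "(c + e) *\<^sub>C x = c *\<^sub>C x + e *\<^sub>C x"
    by (transfer, simp add: scaleC_add_left)
  show "c *\<^sub>C e *\<^sub>C x = (c * e) *\<^sub>C x"
    by (transfer, simp add: scaleC_scaleC)
  show one: "1 *\<^sub>C x = x" for x :: "'a \<Rightarrow>\<^sub>L 'b"
    by (transfer, simp add: scaleC_one)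
  have le: "norm (c *\<^sub>C x) \<le> cmod c * norm x" for c and x :: "'a \<Rightarrow>\<^sub>L 'b"
    by (intro norm_blinfun_bound)
      (auto simp: scaleC_blinfun.rep_eq norm_scaleC mult.assoc intro!: mult_left_mono norm_blinfun)
  show "norm (c *\<^sub>C x) = cmod c * norm x"
  proof (cases "c = 0")
    case True
    then show ?thesis using le[of 0 x] by simp
  next
    case False
    have cc: "inverse c *\<^sub>C c *\<^sub>C x = x"
      using False one by (transfer, simp add: scaleC_scaleC)
    have "norm x \<le> inverse (cmod c) * norm (c *\<^sub>C x)"
      using le[of "inverse c" "c *\<^sub>C x"] by (simp add: cc norm_inverse)
    then have "cmod c * norm x \<le> norm (c *\<^sub>C x)"
      using False by (simp add: field_simps)
    with le[of c x] show ?thesis by simp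
  qed
qed

end

text \<open>
  The type \<^typ>\<open>'h \<Rightarrow>\<^sub>L 'h\<close> consists of the bounded real-linear operators.  The algebra of bounded
  complex-linear operators is the closed subset of those satisfying the following predicate.
\<close>

definition complex_linear :: "('a::complex_normed_vector \<Rightarrow>\<^sub>L 'b::complex_normed_vector) \<Rightarrow> bool" where
  "complex_linear T \<longleftrightarrow> (\<forall>c x. T (c *\<^sub>C x) = c *\<^sub>C T x)"


subsection \<open>The Hilbert space of square summable families\<close>

text \<open>
  \<open>('i, 'h) ell2\<close> is the space of square summable families \<^typ>\<open>'i \<Rightarrow> 'h\<close>, which is the Hilbert space
  tensor product of \<^typ>\<open>'h\<close> with the scalar sequence space over \<^typ>\<open>'i\<close>: the elementary tensor
  of \<open>\<xi>\<close> with the basis vector at \<open>k\<close> is \<open>ell2_single k \<xi>\<close> below.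
\<close>

typedef (overloaded) ('i, 'h::real_normed_vector) ell2 =
  "{f :: 'i \<Rightarrow> 'h. (\<lambda>i. (norm (f i))\<^sup>2) summable_on UNIV}"
  by (rule exI[of _ "\<lambda>_. 0"]) simp

setup_lifting type_definition_ell2

lemma square_summable_iff:
  fixes f :: "'i \<Rightarrow> 'h::real_normed_vector"
  shows "(\<lambda>i. (norm (f i))\<^sup>2) summable_on UNIV \<longleftrightarrow> (\<exists>C. \<forall>F. finite F \<longrightarrow> L2_set (\<lambda>i. norm (f i)) F \<le> C)"
    (is "?L \<longleftrightarrow> ?R")
proof
  assume ?L
  then have "(\<Sum>i\<in>F. (norm (f i))\<^sup>2) \<le> (\<Sum>\<^sub>\<infinity>i. (norm (f i))\<^sup>2)" if "finite F" for F
    using that by (intro finite_sum_le_infsum) auto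
  then show ?R
    unfolding L2_set_def by (intro exI[of _ "sqrt (\<Sum>\<^sub>\<infinity>i. (norm (f i))\<^sup>2)"]) (auto intro: real_sqrt_le_mono)
next
  assume ?R
  then obtain C where C: "\<And>F. finite F \<Longrightarrow> L2_set (\<lambda>i. norm (f i)) F \<le> C" by blast
  have "(\<Sum>i\<in>F. (norm (f i))\<^sup>2) \<le> C\<^sup>2" if "finite F" for F
    using C[OF that] unfolding L2_set_def
    by (metis sqrt_le_D)
  then show ?L
    by (intro nonneg_bdd_above_summable_on bdd_aboveI[where M="C\<^sup>2"]) auto
qed

lemma L2_set_le_sqrt_infsum:
  fixes f :: "'i \<Rightarrow> 'h::real_normed_vector"
  assumes "(\<lambda>i. (norm (f i))\<^sup>2) summable_on UNIV" "finite F"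
  shows "L2_set (\<lambda>i. norm (f i)) F \<le> sqrt (\<Sum>\<^sub>\<infinity>i. (norm (f i))\<^sup>2)"
  unfolding L2_set_def
  by (intro real_sqrt_le_mono finite_sum_le_infsum assms) auto

lemma sqrt_infsum_leI:
  fixes f :: "'i \<Rightarrow> 'h::real_normed_vector"
  assumes "\<And>F. finite F \<Longrightarrow> L2_set (\<lambda>i. norm (f i)) F \<le> C"
  shows "sqrt (\<Sum>\<^sub>\<infinity>i. (norm (f i))\<^sup>2) \<le> C"
proof -
  have C: "0 \<le> C" using assms[of "{}"] by simp
  have s: "(\<lambda>i. (norm (f i))\<^sup>2) summable_on UNIV"
    unfolding square_summable_iff using assms by blast
  have "(\<Sum>i\<in>F. (norm (f i))\<^sup>2) \<le> C\<^sup>2" if "finite F" for F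
    using assms[OF that] unfolding L2_set_def by (metis sqrt_le_D)
  then have "(\<Sum>\<^sub>\<infinity>i. (norm (f i))\<^sup>2) \<le> C\<^sup>2"
    by (intro infsum_le_finite_sums s) auto
  then show ?thesis
    using C by (simp add: real_le_lsqrt)
qed

lemma square_summable_add:
  fixes f g :: "'i \<Rightarrow> 'h::real_normed_vector"
  assumes "(\<lambda>i. (norm (f i))\<^sup>2) summable_on UNIV" "(\<lambda>i. (norm (g i))\<^sup>2) summable_on UNIV"
  shows "(\<lambda>i. (norm (f i + g i))\<^sup>2) summable_on UNIV" (is ?S)
    and "sqrt (\<Sum>\<^sub>\<infinity>i. (norm (f i + g i))\<^sup>2)
      \<le> sqrt (\<Sum>\<^sub>\<infinity>i. (norm (f i))\<^sup>2) + sqrt (\<Sum>\<^sub>\<infinity>i. (norm (g i))\<^sup>2)" (is ?T)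
proof -
  have *: "L2_set (\<lambda>i. norm (f i + g i)) F
      \<le> sqrt (\<Sum>\<^sub>\<infinity>i. (norm (f i))\<^sup>2) + sqrt (\<Sum>\<^sub>\<infinity>i. (norm (g i))\<^sup>2)" if "finite F" for F
  proof -
    have "L2_set (\<lambda>i. norm (f i + g i)) F \<le> L2_set (\<lambda>i. norm (f i) + norm (g i)) F"
      by (intro L2_set_mono norm_triangle_ineq) auto
    also have "\<dots> \<le> L2_set (\<lambda>i. norm (f i)) F + L2_set (\<lambda>i. norm (g i)) F"
      by (rule L2_set_triangle_ineq)
    also have "\<dots> \<le> sqrt (\<Sum>\<^sub>\<infinity>i. (norm (f i))\<^sup>2) + sqrt (\<Sum>\<^sub>\<infinity>i. (norm (g i))\<^sup>2)"
      by (intro add_mono L2_set_le_sqrt_infsum assms that)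
    finally show ?thesis .
  qed
  show ?S unfolding square_summable_iff using * by blast
  show ?T by (rule sqrt_infsum_leI) (rule *)
qed

instantiation ell2 :: (type, complex_normed_vector) complex_normed_vector
begin

lift_definition zero_ell2 :: "('a, 'b) ell2" is "\<lambda>_. 0" by simp
lift_definition plus_ell2 :: "('a, 'b) ell2 \<Rightarrow> ('a, 'b) ell2 \<Rightarrow> ('a, 'b) ell2" is "\<lambda>f g i. f i + g i"
  by (rule square_summable_add)
lift_definition uminus_ell2 :: "('a, 'b) ell2 \<Rightarrow> ('a, 'b) ell2" is "\<lambda>f i. - f i" by simp
lift_definition minus_ell2 :: "('a, 'b) ell2 \<Rightarrow> ('a, 'b) ell2 \<Rightarrow> ('a, 'b) ell2" is "\<lambda>f g i. f i - g i"
  using square_summable_add(1)[of _ "\<lambda>i. - _ i"] by fastforce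
lift_definition scaleC_ell2 :: "complex \<Rightarrow> ('a, 'b) ell2 \<Rightarrow> ('a, 'b) ell2" is "\<lambda>c f i. c *\<^sub>C f i"
  by (simp add: norm_scaleC power_mult_distrib summable_on_cmult_right)
lift_definition scaleR_ell2 :: "real \<Rightarrow> ('a, 'b) ell2 \<Rightarrow> ('a, 'b) ell2" is "\<lambda>r f i. r *\<^sub>R f i"
  by (simp add: power_mult_distrib summable_on_cmult_right)
lift_definition norm_ell2 :: "('a, 'b) ell2 \<Rightarrow> real" is "\<lambda>f. sqrt (\<Sum>\<^sub>\<infinity>i. (norm (f i))\<^sup>2)" .
definition dist_ell2 :: "('a, 'b) ell2 \<Rightarrow> ('a, 'b) ell2 \<Rightarrow> real" where
  "dist_ell2 x y = norm (x - y)"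
definition sgn_ell2 :: "('a, 'b) ell2 \<Rightarrow> ('a, 'b) ell2" where
  "sgn_ell2 x = inverse (norm x) *\<^sub>R x"
definition uniformity_ell2 :: "(('a, 'b) ell2 \<times> ('a, 'b) ell2) filter" where
  "uniformity_ell2 = (INF e\<in>{0<..}. principal {(x, y). dist x y < e})"
definition open_ell2 :: "('a, 'b) ell2 set \<Rightarrow> bool" where
  "open_ell2 U \<longleftrightarrow> (\<forall>x\<in>U. \<forall>\<^sub>F (x', y) in uniformity. x' = x \<longrightarrow> y \<in> U)"

instance
proof
  fix x y z :: "('a, 'b) ell2" and r s :: real and c e :: complex
  show "x + y + z = x + (y + z)" by (transfer, simp add: add.assoc)
  show "x + y = y + x" by (transfer, simp add: add.commute)
  show "0 + x = x" by (transfer, simp)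
  show "- x + x = 0" by (transfer, simp)
  show "x - y = x + - y" by (transfer, simp)
  show "r *\<^sub>R (x + y) = r *\<^sub>R x + r *\<^sub>R y" by (transfer, simp add: scaleR_add_right)
  show "(r + s) *\<^sub>R x = r *\<^sub>R x + s *\<^sub>R x" by (transfer, simp add: scaleR_add_left)
  show "r *\<^sub>R s *\<^sub>R x = (r * s) *\<^sub>R x" by (transfer, simp)
  show "1 *\<^sub>R x = x" by (transfer, simp)
  show "r *\<^sub>R x = complex_of_real r *\<^sub>C x" by (transfer, simp add: scaleR_scaleC)
  show "c *\<^sub>C (x + y) = c *\<^sub>C x + c *\<^sub>C y" by (transfer, simp add: scaleC_add_right)
  show "(c + e) *\<^sub>C x = c *\<^sub>C x + e *\<^sub>C x" by (transfer, simp add: scaleC_add_left)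
  show "c *\<^sub>C e *\<^sub>C x = (c * e) *\<^sub>C x" by (transfer, simp add: scaleC_scaleC)
  show "1 *\<^sub>C x = x" by (transfer, simp add: scaleC_one)
  show "dist x y = norm (x - y)" by (rule dist_ell2_def)
  show "sgn x = inverse (norm x) *\<^sub>R x" by (rule sgn_ell2_def)
  show "uniformity = (INF e\<in>{0<..}. principal {(x, y). dist x (y::('a, 'b) ell2) < e})"
    by (rule uniformity_ell2_def)
  show "open U \<longleftrightarrow> (\<forall>x\<in>U. \<forall>\<^sub>F (x', y) in uniformity. x' = x \<longrightarrow> y \<in> U)" for U :: "('a, 'b) ell2 set"
    by (rule open_ell2_def)
  show "norm x = 0 \<longleftrightarrow> x = 0"
    by transfer (auto simp: fun_eq_iff dest!: nonneg_infsum_le_0D[OF eq_refl])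
  show "norm (x + y) \<le> norm x + norm y" by transfer (rule square_summable_add)
  show "norm (r *\<^sub>R x) = \<bar>r\<bar> * norm x"
    by transfer (simp add: power_mult_distrib infsum_cmult_right real_sqrt_mult)
  show "norm (c *\<^sub>C x) = cmod c * norm x"
    by transfer (simp add: norm_scaleC power_mult_distrib infsum_cmult_right real_sqrt_mult)
qed

end

lemma norm_ell2_sq: "(norm x)\<^sup>2 = (\<Sum>\<^sub>\<infinity>i. (norm (Rep_ell2 x i))\<^sup>2)"
  for x :: "('i, 'h::complex_normed_vector) ell2"
  by (simp add: norm_ell2.rep_eq infsum_nonneg)

lemma norm_Rep_ell2_le: "norm (Rep_ell2 x i) \<le> norm x"
  for x :: "('i, 'h::complex_normed_vector) ell2"
  using L2_set_le_sqrt_infsum[of "Rep_ell2 x" "{i}"] Rep_ell2[of x]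
  by (simp add: norm_ell2.rep_eq)

lemma Rep_ell2_L2_set_le: "finite F \<Longrightarrow> L2_set (\<lambda>i. norm (Rep_ell2 x i)) F \<le> norm x"
  for x :: "('i, 'h::complex_normed_vector) ell2"
  using L2_set_le_sqrt_infsum[of "Rep_ell2 x" F] Rep_ell2[of x]
  by (simp add: norm_ell2.rep_eq)

lemma cinner_abs_summable:
  fixes f g :: "'i \<Rightarrow> 'h::chilbert_space"
  assumes "(\<lambda>i. (norm (f i))\<^sup>2) summable_on UNIV" "(\<lambda>i. (norm (g i))\<^sup>2) summable_on UNIV"
  shows "(\<lambda>i. cinner (f i) (g i)) summable_on UNIV"
proof -
  have "(\<lambda>i. (norm (f i))\<^sup>2 + (norm (g i))\<^sup>2) summable_on UNIV"
    using assms by (rule summable_on_add)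
  then have "(\<lambda>i. norm (cinner (f i) (g i))) summable_on UNIV"
  proof (rule summable_on_comparison_test)
    fix i
    show "cmod (cinner (f i) (g i)) \<le> (norm (f i))\<^sup>2 + (norm (g i))\<^sup>2"
      using cmod_cinner_le[of "f i" "g i"] norm_ge_zero[of "cinner (f i) (g i)"] by linarith
  qed auto
  then show ?thesis by (rule abs_summable_summable)
qed

instantiation ell2 :: (type, chilbert_space) chilbert_space
begin

lift_definition cinner_ell2 :: "('a, 'b) ell2 \<Rightarrow> ('a, 'b) ell2 \<Rightarrow> complex" is
  "\<lambda>f g. \<Sum>\<^sub>\<infinity>i. cinner (f i) (g i)" .

instance
proof
  fix x y z :: "('a, 'b) ell2" and c :: complex
  show "cinner x y = cnj (cinner y x)"
    by transfer (metis (no_types, lifting) cinner_commute infsum_cnj infsum_cong)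
  show "cinner (x + y) z = cinner x z + cinner y z"
    by transfer (simp add: cinner_add_left infsum_add cinner_abs_summable)
  show "cinner (c *\<^sub>C x) y = c * cinner x y"
    by transfer (simp add: cinner_scaleC_left infsum_cmult_right cinner_abs_summable)
  show "cinner x x = complex_of_real ((norm x)\<^sup>2)"
  proof -
    have "((\<lambda>i. (norm (Rep_ell2 x i))\<^sup>2) has_sum (norm x)\<^sup>2) UNIV"
      unfolding norm_ell2_sq using Rep_ell2[of x] by (intro has_sum_infsum) simp
    then have "((\<lambda>i. complex_of_real ((norm (Rep_ell2 x i))\<^sup>2)) has_sum complex_of_real ((norm x)\<^sup>2)) UNIV"
      by (simp only: has_sum_of_real_iff)
    then show ?thesis
      by (simp add: cinner_ell2.rep_eq cinner_self infsumI)
  qed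
next
  fix X :: "nat \<Rightarrow> ('a, 'b) ell2"
  assume X: "Cauchy X"
  have "Cauchy (\<lambda>n. Rep_ell2 (X n) i)" for i
  proof (rule metric_CauchyI)
    fix e :: real assume "e > 0"
    then obtain M where M: "\<And>m n. m \<ge> M \<Longrightarrow> n \<ge> M \<Longrightarrow> norm (X m - X n) < e"
      using X unfolding Cauchy_def dist_norm by blast
    have "norm (Rep_ell2 (X m) i - Rep_ell2 (X n) i) < e" if "m \<ge> M" "n \<ge> M" for m n
      using norm_Rep_ell2_le[of "X m - X n" i] M[OF that] by (simp add: minus_ell2.rep_eq)
    then show "\<exists>M. \<forall>m\<ge>M. \<forall>n\<ge>M. dist (Rep_ell2 (X m) i) (Rep_ell2 (X n) i) < e"
      unfolding dist_norm by blast
  qed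
  then have "\<exists>l. (\<lambda>n. Rep_ell2 (X n) i) \<longlonglongrightarrow> l" for i
    using Cauchy_convergent convergent_def by blast
  then obtain g where g: "\<And>i. (\<lambda>n. Rep_ell2 (X n) i) \<longlonglongrightarrow> g i" by metis
  have close: "\<exists>M. \<forall>m\<ge>M. \<forall>F. finite F \<longrightarrow> L2_set (\<lambda>i. norm (Rep_ell2 (X m) i - g i)) F \<le> e"
    if "e > 0" for e
  proof -
    obtain M where M: "\<And>m n. m \<ge> M \<Longrightarrow> n \<ge> M \<Longrightarrow> norm (X m - X n) < e"
      using X \<open>e > 0\<close> unfolding Cauchy_def dist_norm by blast
    have "L2_set (\<lambda>i. norm (Rep_ell2 (X m) i - g i)) F \<le> e" if "m \<ge> M" "finite F" for m F
    proof (rule tendsto_upperbound)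
      show "(\<lambda>n. L2_set (\<lambda>i. norm (Rep_ell2 (X m) i - Rep_ell2 (X n) i)) F)
          \<longlonglongrightarrow> L2_set (\<lambda>i. norm (Rep_ell2 (X m) i - g i)) F"
        unfolding L2_set_def by (intro tendsto_intros g)
      have "L2_set (\<lambda>i. norm (Rep_ell2 (X m) i - Rep_ell2 (X n) i)) F \<le> e" if "n \<ge> M" for n
        using Rep_ell2_L2_set_le[OF \<open>finite F\<close>, of "X m - X n"] M[OF \<open>m \<ge> M\<close> that]
        by (simp add: minus_ell2.rep_eq)
      then show "\<forall>\<^sub>F n in sequentially. L2_set (\<lambda>i. norm (Rep_ell2 (X m) i - Rep_ell2 (X n) i)) F \<le> e"
        unfolding eventually_sequentially by blast
    qed auto
    then show ?thesis by blast
  qed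
  obtain M0 where M0: "\<And>m F. m \<ge> M0 \<Longrightarrow> finite F \<Longrightarrow> L2_set (\<lambda>i. norm (Rep_ell2 (X m) i - g i)) F \<le> 1"
    using close[of 1] by auto
  have d: "(\<lambda>i. (norm (Rep_ell2 (X M0) i - g i))\<^sup>2) summable_on UNIV"
    unfolding square_summable_iff using M0 by blast
  have "(\<lambda>i. (norm (Rep_ell2 (X M0) i + - (Rep_ell2 (X M0) i - g i)))\<^sup>2) summable_on UNIV"
    by (rule square_summable_add) (use d Rep_ell2[of "X M0"] in \<open>auto simp: norm_minus_commute\<close>)
  then have "(\<lambda>i. (norm (g i))\<^sup>2) summable_on UNIV" by simp
  then have R: "Rep_ell2 (Abs_ell2 g) = g"
    by (simp add: Abs_ell2_inverse)
  have "X \<longlonglongrightarrow> Abs_ell2 g"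
  proof (rule metric_LIMSEQ_I)
    fix e :: real assume "e > 0"
    then obtain M where "\<And>m F. m \<ge> M \<Longrightarrow> finite F \<Longrightarrow> L2_set (\<lambda>i. norm (Rep_ell2 (X m) i - g i)) F \<le> e / 2"
      using close[of "e / 2"] by auto
    then have "norm (X m - Abs_ell2 g) \<le> e / 2" if "m \<ge> M" for m
      unfolding norm_ell2.rep_eq using that
      by (intro sqrt_infsum_leI) (simp add: minus_ell2.rep_eq R)
    then show "\<exists>M. \<forall>n\<ge>M. dist (X n) (Abs_ell2 g) < e"
      using \<open>e > 0\<close> by (intro exI[of _ M]) (force simp: dist_norm)
  qed
  then show "convergent X" by (rule convergentI)
qed

end

lift_definition ell2_single :: "'i \<Rightarrow> 'h::real_normed_vector \<Rightarrow> ('i, 'h) ell2" is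
  "\<lambda>k \<xi> i. if i = k then \<xi> else 0"
proof -
  fix k :: 'i and \<xi> :: 'h
  have "(\<lambda>i. (norm (if i = k then \<xi> else 0))\<^sup>2) summable_on {k}" by simp
  then show "(\<lambda>i. (norm (if i = k then \<xi> else 0))\<^sup>2) summable_on UNIV"
    by (rule summable_on_cong_neutral[THEN iffD1, rotated -1]) auto
qed


subsection \<open>Functions vanishing at infinity\<close>

definition C0 :: "('x::metric_space \<Rightarrow> complex) set" where
  "C0 = {f. continuous_on UNIV f \<and> (\<forall>e>0. \<exists>K. compact K \<and> (\<forall>x. x \<notin> K \<longrightarrow> cmod (f x) < e))}"

definition sup_norm :: "('x \<Rightarrow> complex) \<Rightarrow> real" where
  "sup_norm f = (SUP x. cmod (f x))"

text \<open>Faithful star representations on a Hilbert space; nondegeneracy is not required.\<close>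

definition faithful_star_rep ::
    "(('x::metric_space \<Rightarrow> complex) \<Rightarrow> 'h::chilbert_space \<Rightarrow>\<^sub>L 'h) \<Rightarrow> bool" where
  "faithful_star_rep \<rho> \<longleftrightarrow>
     (\<forall>f\<in>C0. complex_linear (\<rho> f)) \<and>
     (\<forall>f\<in>C0. \<forall>g\<in>C0. \<rho> (\<lambda>x. f x + g x) = \<rho> f + \<rho> g) \<and>
     (\<forall>c. \<forall>f\<in>C0. \<rho> (\<lambda>x. c * f x) = c *\<^sub>C \<rho> f) \<and>
     (\<forall>f\<in>C0. \<forall>g\<in>C0. \<rho> (\<lambda>x. f x * g x) = \<rho> f o\<^sub>L \<rho> g) \<and>
     (\<forall>f\<in>C0. \<forall>\<xi> \<eta>. cinner (\<rho> f \<xi>) \<eta> = cinner \<xi> (\<rho> (\<lambda>x. cnj (f x)) \<eta>)) \<and>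
     inj_on \<rho> C0"


subsection \<open>Dynamical systems and recurrence\<close>

definition dynamical_system :: "(nat ^ 'd \<Rightarrow> 'x::metric_space \<Rightarrow> 'x) \<Rightarrow> bool" where
  "dynamical_system \<phi> \<longleftrightarrow>
     (\<forall>n. continuous_on UNIV (\<phi> n) \<and> surj (\<phi> n) \<and> (\<forall>K. compact K \<longrightarrow> compact (\<phi> n -` K))) \<and>
     \<phi> 0 = id \<and> (\<forall>n m. \<phi> (n + m) = \<phi> n \<circ> \<phi> m) \<and> inj \<phi>"

definition recurrent :: "(nat ^ 'd \<Rightarrow> 'x::metric_space \<Rightarrow> 'x) \<Rightarrow> 'd set \<Rightarrow> 'x set" where
  "recurrent \<phi> J = {x. \<exists>s :: nat \<Rightarrow> nat ^ 'd.
     (\<forall>j\<in>J. \<forall>k. s k $ j < s (Suc k) $ j) \<and> (\<lambda>k. \<phi> (s k) x) \<longlonglongrightarrow> x}"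


subsection \<open>The analytic crossed product\<close>

text \<open>
  \<open>monomial \<phi> \<rho> n f\<close> is the operator on square summable families that maps the elementary tensor of
  \<open>\<xi>\<close> and \<open>k\<close> to that of \<open>\<rho> (f \<circ> \<phi> k) \<xi>\<close> and \<open>k + n\<close>; see \<open>monomial_single\<close> below.
\<close>

definition monomial :: "(nat ^ 'd \<Rightarrow> 'x::metric_space \<Rightarrow> 'x) \<Rightarrow>
    (('x \<Rightarrow> complex) \<Rightarrow> 'h::chilbert_space \<Rightarrow>\<^sub>L 'h) \<Rightarrow> nat ^ 'd \<Rightarrow> ('x \<Rightarrow> complex) \<Rightarrow>
    (nat ^ 'd, 'h) ell2 \<Rightarrow>\<^sub>L (nat ^ 'd, 'h) ell2" where
  "monomial \<phi> \<rho> n f = Blinfun (\<lambda>\<xi>. Abs_ell2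
     (\<lambda>m. if n \<le> m then \<rho> (f \<circ> \<phi> (m - n)) (Rep_ell2 \<xi> (m - n)) else 0))"

definition l1_C0 :: "('i \<Rightarrow> 'x::metric_space \<Rightarrow> complex) set" where
  "l1_C0 = {F. (\<forall>n. F n \<in> C0) \<and> (\<lambda>n. sup_norm (F n)) summable_on UNIV}"

definition l1_rep :: "(nat ^ 'd \<Rightarrow> 'x::metric_space \<Rightarrow> 'x) \<Rightarrow>
    (('x \<Rightarrow> complex) \<Rightarrow> 'h::chilbert_space \<Rightarrow>\<^sub>L 'h) \<Rightarrow> (nat ^ 'd \<Rightarrow> 'x \<Rightarrow> complex) \<Rightarrow>
    (nat ^ 'd, 'h) ell2 \<Rightarrow>\<^sub>L (nat ^ 'd, 'h) ell2" where
  "l1_rep \<phi> \<rho> F = (\<Sum>\<^sub>\<infinity>n. monomial \<phi> \<rho> n (F n))"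

definition crossed_product :: "(nat ^ 'd \<Rightarrow> 'x::metric_space \<Rightarrow> 'x) \<Rightarrow>
    (('x \<Rightarrow> complex) \<Rightarrow> 'h::chilbert_space \<Rightarrow>\<^sub>L 'h) \<Rightarrow>
    ((nat ^ 'd, 'h) ell2 \<Rightarrow>\<^sub>L (nat ^ 'd, 'h) ell2) set" where
  "crossed_product \<phi> \<rho> = closure (l1_rep \<phi> \<rho> ` l1_C0)"


subsection \<open>The infinite sum and the operators above are well defined\<close>

lemma C0_bounded: "f \<in> C0 \<Longrightarrow> bdd_above (range (\<lambda>x. cmod (f x)))"
proof -
  assume f: "f \<in> C0"
  then obtain K where K: "compact K" "\<And>x. x \<notin> K \<Longrightarrow> cmod (f x) < 1"
    unfolding C0_def using zero_less_one by blast
  have "continuous_on K f"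
    using f unfolding C0_def by (auto intro: continuous_on_subset)
  then have "bounded (f ` K)"
    using K(1) by (intro compact_imp_bounded compact_continuous_image)
  then obtain B where B: "\<And>x. x \<in> K \<Longrightarrow> cmod (f x) \<le> B"
    unfolding bounded_iff by auto
  show ?thesis
  proof (rule bdd_aboveI2)
    show "cmod (f x) \<le> max B 1" for x
      using K(2)[of x] B[of x] by (cases "x \<in> K") auto
  qed
qed

lemma cmod_le_sup_norm: "f \<in> C0 \<Longrightarrow> cmod (f x) \<le> sup_norm f"
  unfolding sup_norm_def by (rule cSUP_upper[OF UNIV_I C0_bounded])

lemma C0_norm_leI:
  assumes f: "f \<in> C0" and g: "continuous_on UNIV g" and c: "\<And>x. cmod (g x) \<le> c * cmod (f x)"
  shows "g \<in> C0"
proof -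
  have "\<exists>K. compact K \<and> (\<forall>x. x \<notin> K \<longrightarrow> cmod (g x) < e)" if e: "e > 0" for e
  proof -
    have "e / (\<bar>c\<bar> + 1) > 0" using e by (simp add: add_nonneg_pos)
    then obtain K where K: "compact K" "\<And>x. x \<notin> K \<Longrightarrow> cmod (f x) < e / (\<bar>c\<bar> + 1)"
      using f unfolding C0_def by blast
    have "cmod (g x) < e" if "x \<notin> K" for x
    proof -
      have "cmod (g x) \<le> (\<bar>c\<bar> + 1) * cmod (f x)"
        using c[of x] by (rule order_trans) (intro mult_right_mono, auto)
      also have "\<dots> < e"
        using K(2)[OF that] by (simp add: field_simps add_nonneg_pos pos_less_divide_eq)
      finally show ?thesis .
    qed
    with K(1) show ?thesis by blast
  qed
  with g show ?thesis unfolding C0_def by blast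
qed

lemma faithful_star_rep_bound:
  fixes \<rho> :: "('x::metric_space \<Rightarrow> complex) \<Rightarrow> 'h::chilbert_space \<Rightarrow>\<^sub>L 'h"
  assumes \<rho>: "faithful_star_rep \<rho>" and f: "f \<in> C0" and c: "\<And>x. cmod (f x) \<le> c" "c > 0"
  shows "norm (\<rho> f \<xi>) \<le> c * norm \<xi>"
proof -
  have fc: "continuous_on UNIV f" using f by (simp add: C0_def)
  define t where "t x = (cmod (f x))\<^sup>2 / c\<^sup>2" for x
  define g where "g x = complex_of_real (1 - sqrt (1 - t x))" for x
  have t: "0 \<le> t x" "t x \<le> 1" "t x \<le> cmod (f x) / c" for x
  proof -
    have "cmod (f x) / c \<le> 1" "0 \<le> cmod (f x) / c" using c(1)[of x] c(2) by auto
    moreover have "t x = cmod (f x) / c * (cmod (f x) / c)"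
      by (simp add: t_def power2_eq_square)
    ultimately show "0 \<le> t x" "t x \<le> 1" "t x \<le> cmod (f x) / c"
      by (metis mult_nonneg_nonneg, metis mult_le_one, metis mult_left_le)
  qed
  have "sqrt (1 - t x) \<ge> 1 - t x" for x
    using t[of x] by (intro real_le_rsqrt) (auto simp: power2_eq_square intro: mult_left_le)
  moreover have "sqrt (1 - t x) \<le> 1" for x using t[of x] by auto
  ultimately have gt: "cmod (g x) \<le> t x" for x
    unfolding g_def norm_of_real by (smt (verit))
  have "cmod (g x) \<le> (1 / c) * cmod (f x)" for x
    using gt[of x] t(3)[of x] by simp
  moreover have "continuous_on UNIV g"
    unfolding g_def t_def using c(2) by (intro continuous_intros fc) auto
  ultimately have g: "g \<in> C0" using C0_norm_leI[OF f] by blast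
  have gg: "(\<lambda>x. g x * g x) \<in> C0"
  proof (rule C0_norm_leI[OF g, of _ 1])
    show "continuous_on UNIV (\<lambda>x. g x * g x)"
      using g by (auto simp: C0_def intro: continuous_intros)
    show "cmod (g x * g x) \<le> 1 * cmod (g x)" for x
      using gt[of x] t(2)[of x] by (simp add: norm_mult mult_left_le)
  qed
  have cf: "(\<lambda>x. cnj (f x)) \<in> C0"
    by (rule C0_norm_leI[OF f, of _ 1]) (auto intro!: continuous_intros fc)
  have gc: "continuous_on UNIV g" using g by (simp add: C0_def)
  have gm: "(\<lambda>x. (- 1) * (g x * g x)) \<in> C0" "(\<lambda>x. 2 * g x) \<in> C0"
  proof -
    show "(\<lambda>x. (- 1) * (g x * g x)) \<in> C0"
      by (rule C0_norm_leI[OF gg, of _ 1]) (intro continuous_intros gc, simp)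
    show "(\<lambda>x. 2 * g x) \<in> C0"
      by (rule C0_norm_leI[OF g, of _ 2]) (intro continuous_intros gc, simp add: norm_mult)
  qed
  have ff: "(\<lambda>x. cnj (f x) * f x) \<in> C0"
    by (rule C0_norm_leI[OF f, of _ c])
      (use c in \<open>auto intro!: continuous_intros fc mult_right_mono simp: norm_mult\<close>)
  have "complex_of_real (1 / c\<^sup>2) * (cnj (f x) * f x) = 2 * g x + (- 1) * (g x * g x)" for x
  proof -
    have "2 * g x + (- 1) * (g x * g x) = complex_of_real (1 - (sqrt (1 - t x))\<^sup>2)"
      by (simp only: g_def of_real_diff of_real_power of_real_1)
        (simp add: algebra_simps power2_eq_square del: real_sqrt_mult_self flip: of_real_mult)
    also have "\<dots> = complex_of_real (t x)" using t[of x] by simp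
    also have "\<dots> = complex_of_real (1 / c\<^sup>2) * (cnj (f x) * f x)"
      by (simp add: t_def mult.commute[of "cnj _"] complex_norm_square[symmetric])
    finally show ?thesis by simp
  qed
  then have eq: "\<rho> (\<lambda>x. complex_of_real (1 / c\<^sup>2) * (cnj (f x) * f x))
      = \<rho> (\<lambda>x. 2 * g x + (- 1) * (g x * g x))"
    by (simp only:)
  have sc: "\<rho> (\<lambda>x. a * h x) = a *\<^sub>C \<rho> h" if "h \<in> C0" for a h
    using \<rho> that unfolding faithful_star_rep_def by blast
  have mu: "\<rho> (\<lambda>x. h x * k x) = \<rho> h o\<^sub>L \<rho> k" if "h \<in> C0" "k \<in> C0" for h k
    using \<rho> that unfolding faithful_star_rep_def by blast
  have ad: "\<rho> (\<lambda>x. h x + k x) = \<rho> h + \<rho> k" if "h \<in> C0" "k \<in> C0" for h k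
    using \<rho> that unfolding faithful_star_rep_def by blast
  have adj: "cinner (\<rho> h \<xi>) \<eta> = cinner \<xi> (\<rho> (\<lambda>x. cnj (h x)) \<eta>)" if "h \<in> C0" for h \<xi> \<eta>
    using \<rho> that unfolding faithful_star_rep_def by blast
  have eq': "complex_of_real (1 / c\<^sup>2) *\<^sub>C (\<rho> (\<lambda>x. cnj (f x)) o\<^sub>L \<rho> f)
      = 2 *\<^sub>C \<rho> g + (- 1) *\<^sub>C (\<rho> g o\<^sub>L \<rho> g)"
    using eq unfolding sc[OF ff] mu[OF cf f] ad[OF gm(2,1)] sc[OF g] sc[OF gg] mu[OF g g] .
  have gs: "cinner (\<rho> g u) v = cinner u (\<rho> g v)" for u v
  proof -
    have "(\<lambda>x. cnj (g x)) = g" by (simp add: g_def fun_eq_iff)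
    then show ?thesis using adj[OF g, of u v] by simp
  qed
  have "cinner \<xi> ((complex_of_real (1 / c\<^sup>2) *\<^sub>C (\<rho> (\<lambda>x. cnj (f x)) o\<^sub>L \<rho> f)) \<xi>)
      = complex_of_real (1 / c\<^sup>2) * cinner (\<rho> f \<xi>) (\<rho> f \<xi>)"
    by (simp add: scaleC_blinfun.rep_eq cinner_scaleC_right adj[OF f])
  then have "complex_of_real (1 / c\<^sup>2) * cinner (\<rho> f \<xi>) (\<rho> f \<xi>)
      = 2 * cinner \<xi> (\<rho> g \<xi>) - cinner (\<rho> g \<xi>) (\<rho> g \<xi>)"
    unfolding eq'
    by (simp add: scaleC_blinfun.rep_eq cinner_scaleC_right blinfun.add_left cinner_add_right
        blinfun.diff_left cinner_minus_right gs)
  moreover have "cinner (\<xi> - \<rho> g \<xi>) (\<xi> - \<rho> g \<xi>)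
      = cinner \<xi> \<xi> - (2 * cinner \<xi> (\<rho> g \<xi>) - cinner (\<rho> g \<xi>) (\<rho> g \<xi>))"
    by (simp add: cinner_minus_left cinner_minus_right gs)
  ultimately have "complex_of_real ((norm (\<xi> - \<rho> g \<xi>))\<^sup>2)
      = complex_of_real ((norm \<xi>)\<^sup>2 - 1 / c\<^sup>2 * (norm (\<rho> f \<xi>))\<^sup>2)"
    unfolding cinner_self by simp
  then have "0 \<le> (norm \<xi>)\<^sup>2 - 1 / c\<^sup>2 * (norm (\<rho> f \<xi>))\<^sup>2"
    unfolding of_real_eq_iff by (metis zero_le_power2)
  then have "(norm (\<rho> f \<xi>))\<^sup>2 \<le> (c * norm \<xi>)\<^sup>2"
    using c(2) by (simp add: field_simps power_mult_distrib)
  then show ?thesis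
    using c(2) by (simp add: power2_le_iff_abs_le)
qed

lemma C0_compose:
  assumes "dynamical_system \<phi>" "f \<in> C0"
  shows "f \<circ> \<phi> k \<in> C0"
proof -
  have c: "continuous_on UNIV (f \<circ> \<phi> k)"
    using assms unfolding dynamical_system_def C0_def
    by (intro continuous_on_compose) (auto intro: continuous_on_subset)
  have "\<exists>K. compact K \<and> (\<forall>x. x \<notin> K \<longrightarrow> cmod ((f \<circ> \<phi> k) x) < e)" if "e > 0" for e
  proof -
    obtain K where K: "compact K" "\<And>x. x \<notin> K \<Longrightarrow> cmod (f x) < e"
      using assms(2) \<open>e > 0\<close> unfolding C0_def by blast
    then show ?thesis
      using assms(1) unfolding dynamical_system_def by (intro exI[of _ "\<phi> k -` K"]) auto
  qed
  with c show ?thesis unfolding C0_def by blast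
qed

lemma
  fixes \<phi> :: "nat ^ 'd \<Rightarrow> 'x::metric_space \<Rightarrow> 'x"
    and \<rho> :: "('x \<Rightarrow> complex) \<Rightarrow> 'h::chilbert_space \<Rightarrow>\<^sub>L 'h"
  assumes \<phi>: "dynamical_system \<phi>" and \<rho>: "faithful_star_rep \<rho>" and f: "f \<in> C0"
  shows Rep_monomial: "Rep_ell2 (monomial \<phi> \<rho> n f \<xi>)
      = (\<lambda>m. if n \<le> m then \<rho> (f \<circ> \<phi> (m - n)) (Rep_ell2 \<xi> (m - n)) else 0)"
    and norm_monomial_le: "norm (monomial \<phi> \<rho> n f) \<le> sup_norm f"
    and complex_linear_monomial: "complex_linear (monomial \<phi> \<rho> n f)"
proof -
  define T where "T \<xi> = (\<lambda>m. if n \<le> m then \<rho> (f \<circ> \<phi> (m - n)) (Rep_ell2 \<xi> (m - n)) else 0)"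
    for \<xi> :: "(nat ^ 'd, 'h) ell2"
  have sup0: "0 \<le> sup_norm f"
    using norm_ge_zero cmod_le_sup_norm[OF f] by (rule order_trans)
  have T1: "norm (T \<xi> m) \<le> c * norm (Rep_ell2 \<xi> (m - n))" if "c > sup_norm f" for c \<xi> m
  proof -
    have "cmod ((f \<circ> \<phi> (m - n)) x) \<le> c" for x
      using cmod_le_sup_norm[OF f, of "\<phi> (m - n) x"] that by simp
    then have "norm (\<rho> (f \<circ> \<phi> (m - n)) (Rep_ell2 \<xi> (m - n))) \<le> c * norm (Rep_ell2 \<xi> (m - n))"
      using that sup0 by (intro faithful_star_rep_bound[OF \<rho> C0_compose[OF \<phi> f]]) auto
    then show ?thesis using that sup0 by (auto simp: T_def)
  qed
  have T2: "L2_set (\<lambda>m. norm (T \<xi> m)) F \<le> c * norm \<xi>" if c: "c > sup_norm f" and F: "finite F" for c \<xi> F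
  proof -
    define G where "G = {m\<in>F. n \<le> m}"
    have inj: "inj_on (\<lambda>m. m - n) G"
    proof (rule inj_onI)
      fix a b assume ab: "a \<in> G" "b \<in> G" "a - n = b - n"
      have "a $ i = b $ i" for i
      proof -
        have "n $ i \<le> a $ i" "n $ i \<le> b $ i" using ab by (auto simp: G_def less_eq_vec_def)
        moreover have "(a - n) $ i = (b - n) $ i" using ab by simp
        ultimately show ?thesis by simp
      qed
      then show "a = b" by (simp add: vec_eq_iff)
    qed
    have G: "finite G" "G \<subseteq> F" using F by (auto simp: G_def)
    have "L2_set (\<lambda>m. norm (T \<xi> m)) F = L2_set (\<lambda>m. norm (T \<xi> m)) G"
      unfolding L2_set_def using F
      by (intro arg_cong[where f=sqrt] sum.mono_neutral_right) (auto simp: G_def T_def)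
    also have "\<dots> \<le> L2_set (\<lambda>m. c * norm (Rep_ell2 \<xi> (m - n))) G"
      by (intro L2_set_mono T1 c) auto
    also have "\<dots> = c * L2_set (\<lambda>m. norm (Rep_ell2 \<xi> (m - n))) G"
      using c sup0 by (intro L2_set_right_distrib[symmetric]) auto
    also have "L2_set (\<lambda>m. norm (Rep_ell2 \<xi> (m - n))) G
        = L2_set (\<lambda>m. norm (Rep_ell2 \<xi> m)) ((\<lambda>m. m - n) ` G)"
      unfolding L2_set_def by (simp add: sum.reindex[OF inj])
    also have "c * \<dots> \<le> c * norm \<xi>"
      using c sup0 G by (intro mult_left_mono Rep_ell2_L2_set_le) auto
    finally show ?thesis .
  qed
  have T_mem: "(\<lambda>m. (norm (T \<xi> m))\<^sup>2) summable_on UNIV" for \<xi>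
    unfolding square_summable_iff using T2[of "sup_norm f + 1" _ \<xi>] by auto
  then have R: "Rep_ell2 (Abs_ell2 (T \<xi>)) = T \<xi>" for \<xi>
    by (simp add: Abs_ell2_inverse)
  have nle: "norm (Abs_ell2 (T \<xi>)) \<le> sup_norm f * norm \<xi>" for \<xi>
  proof (rule field_le_epsilon)
    fix e :: real assume e: "e > 0"
    define c where "c = sup_norm f + e / (norm \<xi> + 1)"
    have "norm (Abs_ell2 (T \<xi>)) \<le> c * norm \<xi>"
      unfolding norm_ell2.rep_eq[of "Abs_ell2 (T \<xi>)"] R
      by (intro sqrt_infsum_leI T2) (use e in \<open>auto simp: c_def add_nonneg_pos\<close>)
    also have "e / (norm \<xi> + 1) * norm \<xi> \<le> e"
      using e by (simp add: divide_le_eq add_nonneg_pos)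
    then have "c * norm \<xi> \<le> sup_norm f * norm \<xi> + e"
      by (simp add: c_def distrib_right)
    finally show "norm (Abs_ell2 (T \<xi>)) \<le> sup_norm f * norm \<xi> + e" .
  qed
  have lin: "\<rho> (f \<circ> \<phi> k) (c *\<^sub>C v) = c *\<^sub>C \<rho> (f \<circ> \<phi> k) v" for k c v
    using \<rho> C0_compose[OF \<phi> f] unfolding faithful_star_rep_def complex_linear_def by blast
  have "bounded_linear (\<lambda>\<xi>. Abs_ell2 (T \<xi>))"
  proof (rule bounded_linear_intro[of _ "sup_norm f"])
    show "Abs_ell2 (T (x + y)) = Abs_ell2 (T x) + Abs_ell2 (T y)" for x y
      by (rule Rep_ell2_inject[THEN iffD1])
        (simp add: R plus_ell2.rep_eq, simp add: T_def plus_ell2.rep_eq blinfun.add_right fun_eq_iff)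
    show "Abs_ell2 (T (r *\<^sub>R x)) = r *\<^sub>R Abs_ell2 (T x)" for r x
      by (rule Rep_ell2_inject[THEN iffD1])
        (simp add: R scaleR_ell2.rep_eq, simp add: T_def scaleR_ell2.rep_eq blinfun.scaleR_right fun_eq_iff)
    show "norm (Abs_ell2 (T x)) \<le> norm x * sup_norm f" for x
      using nle[of x] by (simp add: mult.commute)
  qed
  then have M: "monomial \<phi> \<rho> n f \<xi> = Abs_ell2 (T \<xi>)" for \<xi>
    unfolding monomial_def T_def by (simp add: bounded_linear_Blinfun_apply)
  show "Rep_ell2 (monomial \<phi> \<rho> n f \<xi>)
      = (\<lambda>m. if n \<le> m then \<rho> (f \<circ> \<phi> (m - n)) (Rep_ell2 \<xi> (m - n)) else 0)"
    unfolding M R by (simp add: T_def)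
  show "norm (monomial \<phi> \<rho> n f) \<le> sup_norm f"
    by (intro norm_blinfun_bound sup0) (simp add: M nle)
  show "complex_linear (monomial \<phi> \<rho> n f)"
    unfolding complex_linear_def M
    by (intro allI Rep_ell2_inject[THEN iffD1])
      (simp add: R scaleC_ell2.rep_eq, simp add: T_def scaleC_ell2.rep_eq fun_eq_iff lin)
qed

lemma monomial_single:
  fixes \<phi> :: "nat ^ 'd \<Rightarrow> 'x::metric_space \<Rightarrow> 'x"
    and \<rho> :: "('x \<Rightarrow> complex) \<Rightarrow> 'h::chilbert_space \<Rightarrow>\<^sub>L 'h"
  assumes "dynamical_system \<phi>" "faithful_star_rep \<rho>" "f \<in> C0"
  shows "monomial \<phi> \<rho> n f (ell2_single k \<xi>) = ell2_single (k + n) (\<rho> (f \<circ> \<phi> k) \<xi>)"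
proof -
  have "n \<le> m \<and> m - n = k \<longleftrightarrow> m = k + n" for m :: "nat ^ 'd"
  proof -
    have "(n $ i \<le> m $ i \<and> m $ i - n $ i = k $ i) = (m $ i = k $ i + n $ i)" for i
      by auto
    then show ?thesis
      unfolding less_eq_vec_def vec_eq_iff vector_minus_component vector_add_component by metis
  qed
  then have "Rep_ell2 (monomial \<phi> \<rho> n f (ell2_single k \<xi>)) m
      = Rep_ell2 (ell2_single (k + n) (\<rho> (f \<circ> \<phi> k) \<xi>)) m" for m
    unfolding Rep_monomial[OF assms] ell2_single.rep_eq
    by (cases "n \<le> m"; cases "m - n = k") (auto simp: blinfun.zero_right)
  then show ?thesis
    by (intro Rep_ell2_inject[THEN iffD1]) (rule ext)
qed

lemma monomials_summable:
  assumes "dynamical_system \<phi>" "faithful_star_rep \<rho>" "F \<in> l1_C0"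
  shows "(\<lambda>n. monomial \<phi> \<rho> n (F n)) summable_on UNIV"
proof -
  have "(\<lambda>n. norm (monomial \<phi> \<rho> n (F n))) summable_on UNIV"
    by (rule summable_on_comparison_test[of "\<lambda>n. sup_norm (F n)"])
      (use assms in \<open>auto simp: l1_C0_def intro: norm_monomial_le\<close>)
  then show ?thesis by (rule abs_summable_summable)
qed


subsection \<open>Ideals and radicals of operator algebras\<close>

definition ideal :: "('k::complex_normed_vector \<Rightarrow>\<^sub>L 'k) set \<Rightarrow> ('k \<Rightarrow>\<^sub>L 'k) set \<Rightarrow> bool" where
  "ideal A I \<longleftrightarrow> cvec.subspace I \<and> I \<subseteq> A \<and> (\<forall>a\<in>A. \<forall>x\<in>I. a o\<^sub>L x \<in> I \<and> x o\<^sub>L a \<in> I)"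

definition closed_ideal_generated ::
    "('k::complex_normed_vector \<Rightarrow>\<^sub>L 'k) set \<Rightarrow> ('k \<Rightarrow>\<^sub>L 'k) set \<Rightarrow> ('k \<Rightarrow>\<^sub>L 'k) set" where
  "closed_ideal_generated A S = (\<lambda>I. ideal A I \<and> closed I) hull S"

definition ideal_product ::
    "('k::complex_normed_vector \<Rightarrow>\<^sub>L 'k) set \<Rightarrow> ('k \<Rightarrow>\<^sub>L 'k) set \<Rightarrow> ('k \<Rightarrow>\<^sub>L 'k) set" where
  "ideal_product I J = cvec.span {x o\<^sub>L y | x y. x \<in> I \<and> y \<in> J}"

definition prime_ideal :: "('k::complex_normed_vector \<Rightarrow>\<^sub>L 'k) set \<Rightarrow> ('k \<Rightarrow>\<^sub>L 'k) set \<Rightarrow> bool" where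
  "prime_ideal A P \<longleftrightarrow> ideal A P \<and>
     (\<forall>I J. ideal A I \<and> ideal A J \<and> ideal_product I J \<subseteq> P \<longrightarrow> I \<subseteq> P \<or> J \<subseteq> P)"

definition prime_radical :: "('k::complex_normed_vector \<Rightarrow>\<^sub>L 'k) set \<Rightarrow> ('k \<Rightarrow>\<^sub>L 'k) set" where
  "prime_radical A = {a\<in>A. \<forall>P. prime_ideal A P \<longrightarrow> a \<in> P}"

text \<open>
  A representation of \<open>A\<close> by linear maps on the vector space \<open>V\<close>, a linear subspace of a complex
  vector space; no norm on \<open>V\<close> is involved.
\<close>

definition algebra_rep :: "('k::complex_normed_vector \<Rightarrow>\<^sub>L 'k) set \<Rightarrow> 'v::complex_vector set \<Rightarrow>
    (('k \<Rightarrow>\<^sub>L 'k) \<Rightarrow> 'v \<Rightarrow> 'v) \<Rightarrow> bool" where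
  "algebra_rep A V \<sigma> \<longleftrightarrow> cvec.subspace V \<and>
     (\<forall>a\<in>A. \<forall>v\<in>V. \<sigma> a v \<in> V) \<and>
     (\<forall>a\<in>A. \<forall>v\<in>V. \<forall>w\<in>V. \<sigma> a (v + w) = \<sigma> a v + \<sigma> a w) \<and>
     (\<forall>c. \<forall>a\<in>A. \<forall>v\<in>V. \<sigma> a (c *\<^sub>C v) = c *\<^sub>C \<sigma> a v) \<and>
     (\<forall>a\<in>A. \<forall>b\<in>A. \<forall>v\<in>V. \<sigma> (a + b) v = \<sigma> a v + \<sigma> b v) \<and>
     (\<forall>c. \<forall>a\<in>A. \<forall>v\<in>V. \<sigma> (c *\<^sub>C a) v = c *\<^sub>C \<sigma> a v) \<and>
     (\<forall>a\<in>A. \<forall>b\<in>A. \<forall>v\<in>V. \<sigma> (a o\<^sub>L b) v = \<sigma> a (\<sigma> b v))"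

definition irreducible_rep :: "('k::complex_normed_vector \<Rightarrow>\<^sub>L 'k) set \<Rightarrow> 'v::complex_vector set \<Rightarrow>
    (('k \<Rightarrow>\<^sub>L 'k) \<Rightarrow> 'v \<Rightarrow> 'v) \<Rightarrow> bool" where
  "irreducible_rep A V \<sigma> \<longleftrightarrow> algebra_rep A V \<sigma> \<and>
     (\<exists>a\<in>A. \<exists>v\<in>V. \<sigma> a v \<noteq> 0) \<and>
     (\<forall>W. cvec.subspace W \<and> W \<subseteq> V \<and> (\<forall>a\<in>A. \<forall>w\<in>W. \<sigma> a w \<in> W) \<longrightarrow> W = {0} \<or> W = V)"

definition rep_kernel :: "('k::complex_normed_vector \<Rightarrow>\<^sub>L 'k) set \<Rightarrow> 'v::complex_vector set \<Rightarrow>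
    (('k \<Rightarrow>\<^sub>L 'k) \<Rightarrow> 'v \<Rightarrow> 'v) \<Rightarrow> ('k \<Rightarrow>\<^sub>L 'k) set" where
  "rep_kernel A V \<sigma> = {a\<in>A. \<forall>v\<in>V. \<sigma> a v = 0}"

text \<open>
  A definition cannot quantify over all types, so the representation spaces are taken to be linear
  subspaces of the operator space containing \<open>A\<close>.  Up to equivalence these are all irreducible
  representations of \<open>A\<close>; \<open>primitive_ideal_rep_kernel\<close> below is the resulting statement for kernels
  of irreducible representations on arbitrary spaces.
\<close>

definition primitive_ideal :: "('k::complex_normed_vector \<Rightarrow>\<^sub>L 'k) set \<Rightarrow> ('k \<Rightarrow>\<^sub>L 'k) set \<Rightarrow> bool" where
  "primitive_ideal A P \<longleftrightarrow>
     (\<exists>(V :: ('k \<Rightarrow>\<^sub>L 'k) set) \<sigma>. irreducible_rep A V \<sigma> \<and> P = rep_kernel A V \<sigma>)"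

definition jacobson_radical :: "('k::complex_normed_vector \<Rightarrow>\<^sub>L 'k) set \<Rightarrow> ('k \<Rightarrow>\<^sub>L 'k) set" where
  "jacobson_radical A = {a\<in>A. \<forall>P. primitive_ideal A P \<longrightarrow> a \<in> P}"

lemma primitive_ideal_rep_kernel:
  fixes A :: "('k::complex_normed_vector \<Rightarrow>\<^sub>L 'k) set" and V :: "'v::complex_vector set"
  assumes A: "cvec.subspace A" "\<And>a b. a \<in> A \<Longrightarrow> b \<in> A \<Longrightarrow> a o\<^sub>L b \<in> A"
    and irr: "irreducible_rep A V \<sigma>"
  shows "primitive_ideal A (rep_kernel A V \<sigma>)"
proof -
  interpret VA: vector_space_pair "scaleC :: complex \<Rightarrow> 'v \<Rightarrow> 'v"
    "scaleC :: complex \<Rightarrow> ('k \<Rightarrow>\<^sub>L 'k) \<Rightarrow> ('k \<Rightarrow>\<^sub>L 'k)" ..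
  note rep = irr[unfolded irreducible_rep_def algebra_rep_def]
  have V: "cvec.subspace V" using rep by blast
  have sV: "\<sigma> a v \<in> V" if "a \<in> A" "v \<in> V" for a v using rep that by blast
  have sadd: "\<sigma> a (v + w) = \<sigma> a v + \<sigma> a w" if "a \<in> A" "v \<in> V" "w \<in> V" for a v w
    using rep that by blast
  have ssc: "\<sigma> a (c *\<^sub>C v) = c *\<^sub>C \<sigma> a v" if "a \<in> A" "v \<in> V" for a c v
    using rep that by blast
  have addl: "\<sigma> (a + b) v = \<sigma> a v + \<sigma> b v" if "a \<in> A" "b \<in> A" "v \<in> V" for a b v
    using rep that by blast
  have scl: "\<sigma> (c *\<^sub>C a) v = c *\<^sub>C \<sigma> a v" if "a \<in> A" "v \<in> V" for a c v
    using rep that by blast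
  have mul: "\<sigma> (a o\<^sub>L b) v = \<sigma> a (\<sigma> b v)" if "a \<in> A" "b \<in> A" "v \<in> V" for a b v
    using rep that by blast
  have irred: "W = {0} \<or> W = V"
    if "cvec.subspace W" "W \<subseteq> V" "\<And>a w. a \<in> A \<Longrightarrow> w \<in> W \<Longrightarrow> \<sigma> a w \<in> W" for W
    using conjunct2[OF conjunct2[OF rep]] that by simp
  obtain a0 v where a0: "a0 \<in> A" "v \<in> V" "\<sigma> a0 v \<noteq> 0" using rep by blast
  have zl: "\<sigma> 0 v = 0"
    using scl[OF a0(1,2), of 0] by simp
  define W where "W = (\<lambda>a. \<sigma> a v) ` A"
  have "cvec.subspace W"
  proof (rule cvec.subspaceI)
    show "0 \<in> W" unfolding W_def using zl A(1) by (metis cvec.subspace_0 image_eqI)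
    show "x + y \<in> W" if "x \<in> W" "y \<in> W" for x y
    proof -
      obtain a b where "a \<in> A" "b \<in> A" "x = \<sigma> a v" "y = \<sigma> b v"
        using \<open>x \<in> W\<close> \<open>y \<in> W\<close> unfolding W_def image_iff by metis
      then show ?thesis
        unfolding W_def using A(1) a0(2) by (metis addl cvec.subspace_add image_eqI)
    qed
    show "c *\<^sub>C x \<in> W" if "x \<in> W" for c x
    proof -
      obtain a where "a \<in> A" "x = \<sigma> a v" using \<open>x \<in> W\<close> unfolding W_def by blast
      then show ?thesis
        unfolding W_def using A(1) a0(2) by (metis scl cvec.subspace_scale image_eqI)
    qed
  qed
  moreover have "W \<subseteq> V" unfolding W_def using sV a0(2) by blast
  moreover have "\<sigma> a w \<in> W" if "a \<in> A" "w \<in> W" for a w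
  proof -
    obtain b where "b \<in> A" "w = \<sigma> b v" using \<open>w \<in> W\<close> unfolding W_def by blast
    then show ?thesis
      unfolding W_def using that(1) a0(2) A(2) by (metis mul image_eqI)
  qed
  ultimately have "W = {0} \<or> W = V" by (rule irred)
  moreover have "\<sigma> a0 v \<in> W" using a0 unfolding W_def by blast
  ultimately have WV: "W = V" using a0(3) by auto
  obtain B where B: "B \<subseteq> V" "cvec.independent B" "V \<subseteq> cvec.span B"
    using cvec.maximal_independent_subset[of V] by metis
  have "\<exists>a\<in>A. \<sigma> a v = b" if "b \<in> B" for b
    using that B(1) WV unfolding W_def by blast
  then obtain g0 where g0: "\<And>b. b \<in> B \<Longrightarrow> g0 b \<in> A \<and> \<sigma> (g0 b) v = b" by metis
  obtain g where g: "Vector_Spaces.linear scaleC scaleC g" "\<And>b. b \<in> B \<Longrightarrow> g b = g0 b"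
    using VA.linear_independent_extend[OF B(2), of g0] by blast
  interpret g: Vector_Spaces.linear "scaleC :: complex \<Rightarrow> 'v \<Rightarrow> 'v"
    "scaleC :: complex \<Rightarrow> ('k \<Rightarrow>\<^sub>L 'k) \<Rightarrow> ('k \<Rightarrow>\<^sub>L 'k)" g by (rule g(1))
  have gV: "g w \<in> A \<and> \<sigma> (g w) v = w" if "w \<in> V" for w
  proof -
    have "w \<in> cvec.span B" using that B(3) by blast
    then show ?thesis
    proof (induction rule: cvec.span_induct_alt)
      case base
      then show ?case using zl A(1) by (simp add: g.zero cvec.subspace_0)
    next
      case (step c x y)
      then have "g x \<in> A" "\<sigma> (g x) v = x" using g0 g(2) by auto
      then show ?case
        using step A(1) a0(2)
        by (simp add: g.add g.scale addl scl cvec.subspace_add cvec.subspace_scale)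
    qed
  qed
  define U where "U = g ` V"
  define \<tau> where "\<tau> a u = g (\<sigma> a (\<sigma> u v))" for a u
  have UA: "u \<in> A" "\<sigma> u v \<in> V" "g (\<sigma> u v) = u" if "u \<in> U" for u
    using that gV unfolding U_def by auto
  have U: "cvec.subspace U"
    unfolding U_def by (rule g.subspace_image[OF V])
  have "algebra_rep A U \<tau>"
    unfolding algebra_rep_def
  proof (intro conjI ballI allI)
    show "cvec.subspace U" by (rule U)
    fix a u assume a: "a \<in> A" and u: "u \<in> U"
    show "\<tau> a u \<in> U" unfolding \<tau>_def U_def using sV a UA(2)[OF u] by blast
    show "\<tau> a (u + w) = \<tau> a u + \<tau> a w" if "w \<in> U" for w
      unfolding \<tau>_def using UA[OF u] UA[OF that] a a0(2) by (simp add: addl sadd g.add)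
    show "\<tau> a (c *\<^sub>C u) = c *\<^sub>C \<tau> a u" for c
      unfolding \<tau>_def using UA[OF u] a a0(2) by (simp add: scl ssc g.scale)
    show "\<tau> (c *\<^sub>C a) u = c *\<^sub>C \<tau> a u" for c
      unfolding \<tau>_def using UA[OF u] a a0(2) by (simp add: scl ssc g.scale)
    show "\<tau> (a + b) u = \<tau> a u + \<tau> b u" if "b \<in> A" for b
      unfolding \<tau>_def using UA[OF u] a that by (simp add: addl g.add)
    show "\<tau> (a o\<^sub>L b) u = \<tau> a (\<tau> b u)" if "b \<in> A" for b
      unfolding \<tau>_def using UA[OF u] a that by (simp add: mul gV sV)
  qed
  moreover have "\<tau> a0 (g v) \<noteq> 0"
  proof
    assume "\<tau> a0 (g v) = 0"
    then have "g (\<sigma> a0 v) = 0" unfolding \<tau>_def using gV a0(2) by simp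
    then have "\<sigma> a0 v = 0" using gV[OF sV[OF a0(1,2)]] zl by metis
    with a0(3) show False by blast
  qed
  then have "\<exists>a\<in>A. \<exists>u\<in>U. \<tau> a u \<noteq> 0" using a0 unfolding U_def by blast
  moreover have "S = {0} \<or> S = U"
    if S: "cvec.subspace S" "S \<subseteq> U" "\<forall>a\<in>A. \<forall>s\<in>S. \<tau> a s \<in> S" for S
  proof -
    define R where "R = {w\<in>V. g w \<in> S}"
    have SR: "S = g ` R" using S(2) unfolding R_def U_def by blast
    have "cvec.subspace R"
      unfolding R_def
      by (rule cvec.subspaceI)
        (use V S(1) in \<open>auto simp: g.zero g.add g.scale cvec.subspace_0 cvec.subspace_add cvec.subspace_scale\<close>)
    moreover have "R \<subseteq> V" by (auto simp: R_def)
    moreover have "\<sigma> a w \<in> R" if "a \<in> A" "w \<in> R" for a w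
    proof -
      have "\<tau> a (g w) \<in> S" "w \<in> V" using that S(3) unfolding R_def by auto
      then show ?thesis using gV sV that(1) unfolding R_def \<tau>_def by simp
    qed
    ultimately have "R = {0} \<or> R = V" by (rule irred)
    then show ?thesis unfolding SR U_def by (auto simp: g.zero)
  qed
  ultimately have "irreducible_rep A U \<tau>"
    unfolding irreducible_rep_def by blast
  moreover have "rep_kernel A V \<sigma> = rep_kernel A U \<tau>"
  proof -
    have "(\<forall>w\<in>V. \<sigma> a w = 0) \<longleftrightarrow> (\<forall>u\<in>U. \<tau> a u = 0)" if a: "a \<in> A" for a
    proof -
      have "\<tau> a (g w) = 0 \<longleftrightarrow> \<sigma> a w = 0" if "w \<in> V" for w
        using gV[OF that] gV[OF sV[OF a that]] zl g.zero unfolding \<tau>_def by metis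
      then show ?thesis unfolding U_def by blast
    qed
    then show ?thesis unfolding rep_kernel_def by blast
  qed
  ultimately show ?thesis unfolding primitive_ideal_def by blast
qed

end

theory Submission
  imports Defs
begin

text \<open>
  An element \<open>a\<close> of the crossed product is a formal series with coefficients in \<open>C0\<close>, bounded by
  \<open>norm a\<close>.  The radical is closed and invariant under the gauge action of the torus, so averaging
  over roots of unity shows that it contains the monomials \<open>U n (coeff a n)\<close> of its elements \<open>a\<close>,
  and Fejer means recover \<open>a\<close> from them.  It remains to decide which monomials are in the radical.

  If \<open>U n f\<close> is in the radical but \<open>f\<close> does not vanish at some recurrent \<open>x\<close>, then the radical
  contains a series \<open>z = \<Sum>k. 2\<^sup>-\<^sup>k U (N k) h\<close> with \<open>h \<ge> 0\<close> and \<open>h x > 0\<close>, and a large positive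
  multiple of \<open>z\<close> has a quasi-inverse.  The latter has nonnegative coefficients, and the orbit of
  \<open>x\<close> along the words \<open>W (k + 1) = W k @ [N k] @ W k\<close>, for return times \<open>N k\<close> chosen so that it stays
  near \<open>x\<close>, makes them unbounded.

  Conversely, every closed semiprime ideal contains \<open>U n f\<close> if \<open>f\<close> vanishes on the recurrent points:
  over a wandering piece of the zero set attached to the ideal, monomials would generate nilpotent
  ideals modulo it, so recurrent points are dense in that zero set.  This applies to the
  Jacobson radical, and to the prime radical as soon as it is closed.
\<close>

section \<open>Ideals of operator algebras\<close>

text \<open>Powers of a single monomial \<open>U n f\<close> may well vanish: the orbit of
  \<open>x\<close> under \<open>\<phi> n\<close> alone need not come back near \<open>x\<close>,
  only certain longer times do. Hence \<open>U n f\<close> is padded by factors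
  \<open>U (m k) g\<close>, chosen so that \<open>m k + n + s k\<close> is a return time when
  \<open>s k\<close> is the degree of the word built so far. Padding needs return times that
  dominate a prescribed degree coordinatewise, and recurrence in the directions of \<open>J\<close>
  says nothing about the other coordinates; this is why the supports of the return times are
  stabilised beforehand. All functions involved are made nonnegative, so that one path through an
  iterated product bounds a coefficient of the quasi-inverse from below.

  Finite groups of roots of unity take the place of the torus because averages over them are finite
  sums, which remain in a gauge invariant subspace and involve no operator-valued integral. The
  price is aliasing between degrees, which disappears on each fixed monomial when the order of the
  roots is large.\<close>

interpretation comp: bounded_bilinear "(o\<^sub>L)"
  by (rule bounded_bilinear_blinfun_compose)

lemma blinfun_compose_assoc: "(a o\<^sub>L b) o\<^sub>L c = a o\<^sub>L (b o\<^sub>L c)"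
  by (rule blinfun_eqI) simp

lemma scaleC_compose: "(c *\<^sub>C a) o\<^sub>L b = c *\<^sub>C (a o\<^sub>L b)"
  by (rule blinfun_eqI) (simp add: scaleC_blinfun.rep_eq)

lemma idealI:
  assumes "I \<subseteq> A" "0 \<in> I"
    and "\<And>x y. x \<in> I \<Longrightarrow> y \<in> I \<Longrightarrow> x + y \<in> I"
    and "\<And>c x. x \<in> I \<Longrightarrow> c *\<^sub>C x \<in> I"
    and "\<And>a x. a \<in> A \<Longrightarrow> x \<in> I \<Longrightarrow> a o\<^sub>L x \<in> I"
    and "\<And>a x. a \<in> A \<Longrightarrow> x \<in> I \<Longrightarrow> x o\<^sub>L a \<in> I"
  shows "ideal A I"
  unfolding ideal_def by (intro conjI ballI cvec.subspaceI) (simp_all add: assms)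

lemma
  assumes "ideal A I"
  shows ideal_subset: "I \<subseteq> A"
    and ideal_subspace: "cvec.subspace I"
    and ideal_left: "a \<in> A \<Longrightarrow> x \<in> I \<Longrightarrow> a o\<^sub>L x \<in> I"
    and ideal_right: "a \<in> A \<Longrightarrow> x \<in> I \<Longrightarrow> x o\<^sub>L a \<in> I"
  using assms unfolding ideal_def by blast+

text \<open>
  The elements of the algebra must commute with complex scalars, since the type of operators only
  records real linearity.
\<close>

locale operator_algebra =
  fixes A :: "('k::complex_normed_vector \<Rightarrow>\<^sub>L 'k) set"
  assumes subspace: "cvec.subspace A"
    and mult_closed: "a \<in> A \<Longrightarrow> b \<in> A \<Longrightarrow> a o\<^sub>L b \<in> A"
    and compose_scaleC: "a \<in> A \<Longrightarrow> a o\<^sub>L (c *\<^sub>C (b :: 'k \<Rightarrow>\<^sub>L 'k)) = c *\<^sub>C (a o\<^sub>L b)"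
begin

lemma zero_mem: "0 \<in> A"
  by (rule cvec.subspace_0[OF subspace])

lemma add_closed: "a \<in> A \<Longrightarrow> b \<in> A \<Longrightarrow> a + b \<in> A"
  by (rule cvec.subspace_add[OF subspace])

lemma scaleC_closed: "a \<in> A \<Longrightarrow> c *\<^sub>C a \<in> A"
  by (rule cvec.subspace_scale[OF subspace])

lemma ideal_inter:
  assumes "\<And>I. I \<in> \<I> \<Longrightarrow> ideal A I"
  shows "ideal A {a\<in>A. \<forall>I\<in>\<I>. a \<in> I}"
proof (rule idealI)
  note sub = ideal_subspace[OF assms]
  show "0 \<in> {a\<in>A. \<forall>I\<in>\<I>. a \<in> I}"
    by (simp add: zero_mem cvec.subspace_0[OF sub])
  show "x + y \<in> {a\<in>A. \<forall>I\<in>\<I>. a \<in> I}"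
    if "x \<in> {a\<in>A. \<forall>I\<in>\<I>. a \<in> I}" "y \<in> {a\<in>A. \<forall>I\<in>\<I>. a \<in> I}" for x y
    using that by (simp add: add_closed cvec.subspace_add[OF sub])
  show "c *\<^sub>C x \<in> {a\<in>A. \<forall>I\<in>\<I>. a \<in> I}" if "x \<in> {a\<in>A. \<forall>I\<in>\<I>. a \<in> I}" for c x
    using that by (simp add: scaleC_closed cvec.subspace_scale[OF sub])
  show "a o\<^sub>L x \<in> {a\<in>A. \<forall>I\<in>\<I>. a \<in> I}" "x o\<^sub>L a \<in> {a\<in>A. \<forall>I\<in>\<I>. a \<in> I}"
    if "a \<in> A" "x \<in> {a\<in>A. \<forall>I\<in>\<I>. a \<in> I}" for a x
    using that by (simp_all add: mult_closed ideal_left[OF assms] ideal_right[OF assms])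
qed blast

lemma span_compose_left:
  fixes x :: "'k \<Rightarrow>\<^sub>L 'k"
  assumes "cvec.subspace P" "a \<in> A" "x \<in> cvec.span S" "\<And>s. s \<in> S \<Longrightarrow> a o\<^sub>L s \<in> P"
  shows "a o\<^sub>L x \<in> P"
proof -
  have "cvec.span S \<subseteq> {x. a o\<^sub>L x \<in> P}"
  proof (rule cvec.span_minimal)
    show "cvec.subspace {x. a o\<^sub>L x \<in> P}"
      by (rule cvec.subspaceI) (simp_all add: comp.zero_right comp.add_right compose_scaleC[OF assms(2)] assms(1)
          cvec.subspace_0 cvec.subspace_add cvec.subspace_scale)
  qed (use assms(4) in blast)
  with assms(3) show ?thesis by blast
qed

lemma span_compose_right:
  fixes x a :: "'k \<Rightarrow>\<^sub>L 'k"
  assumes "cvec.subspace P" "x \<in> cvec.span S" "\<And>s. s \<in> S \<Longrightarrow> s o\<^sub>L a \<in> P"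
  shows "x o\<^sub>L a \<in> P"
proof -
  have "cvec.span S \<subseteq> {x. x o\<^sub>L a \<in> P}"
  proof (rule cvec.span_minimal)
    show "cvec.subspace {x. x o\<^sub>L a \<in> P}"
      by (rule cvec.subspaceI) (simp_all add: comp.zero_left comp.add_left scaleC_compose assms(1)
          cvec.subspace_0 cvec.subspace_add cvec.subspace_scale)
  qed (use assms(3) in blast)
  with assms(2) show ?thesis by blast
qed

lemma ideal_span:
  assumes "S \<subseteq> A" "\<And>a s. a \<in> A \<Longrightarrow> s \<in> S \<Longrightarrow> a o\<^sub>L s \<in> S" "\<And>a s. a \<in> A \<Longrightarrow> s \<in> S \<Longrightarrow> s o\<^sub>L a \<in> S"
  shows "ideal A (cvec.span S)"
proof (rule idealI)
  show "cvec.span S \<subseteq> A" by (rule cvec.span_minimal[OF assms(1) subspace])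
  show "a o\<^sub>L x \<in> cvec.span S" if "a \<in> A" "x \<in> cvec.span S" for a x
    by (rule span_compose_left[OF _ that]) (simp_all add: cvec.span_base assms(2) that(1))
  show "x o\<^sub>L a \<in> cvec.span S" if "a \<in> A" "x \<in> cvec.span S" for a x
    by (rule span_compose_right[OF _ that(2)]) (simp_all add: cvec.span_base assms(3) that(1))
qed (auto intro: cvec.span_zero cvec.span_add cvec.span_scale)

text \<open>
  Since the algebra need not be unital, the proof passes through the ideal generated by \<open>A a A\<close>
  and the ideal of all \<open>b\<close> with \<open>A b A\<close> contained in the prime ideal.
\<close>

lemma prime_ideal_semiprime:
  assumes P: "prime_ideal A P" and a: "a \<in> A" and aa: "\<And>b. b \<in> A \<Longrightarrow> a o\<^sub>L (b o\<^sub>L a) \<in> P"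
  shows "a \<in> P"
proof -
  have iP: "ideal A P"
    and pr: "\<And>I J. ideal A I \<Longrightarrow> ideal A J \<Longrightarrow> ideal_product I J \<subseteq> P \<Longrightarrow> I \<subseteq> P \<or> J \<subseteq> P"
    using P unfolding prime_ideal_def by auto
  note sP = ideal_subspace[OF iP] and lP = ideal_left[OF iP] and rP = ideal_right[OF iP]
  have prod: "ideal_product I J \<subseteq> P" if "\<And>x y. x \<in> I \<Longrightarrow> y \<in> J \<Longrightarrow> x o\<^sub>L y \<in> P" for I J
    unfolding ideal_product_def using that by (intro cvec.span_minimal sP) blast
  define S where "S = {x o\<^sub>L (a o\<^sub>L y) | x y. x \<in> A \<and> y \<in> A}"
  have SI: "x o\<^sub>L (a o\<^sub>L y) \<in> S" if "x \<in> A" "y \<in> A" for x y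
    unfolding S_def using that by blast
  have SE: "\<exists>x y. s = x o\<^sub>L (a o\<^sub>L y) \<and> x \<in> A \<and> y \<in> A" if "s \<in> S" for s
    using that unfolding S_def by blast
  have SA: "S \<subseteq> A" using SE mult_closed a by blast
  have iK: "ideal A (cvec.span S)"
  proof (rule ideal_span[OF SA])
    fix b s assume b: "b \<in> A" and s: "s \<in> S"
    obtain u v where uv: "s = u o\<^sub>L (a o\<^sub>L v)" "u \<in> A" "v \<in> A" using SE[OF s] by blast
    have "b o\<^sub>L s = (b o\<^sub>L u) o\<^sub>L (a o\<^sub>L v)" "s o\<^sub>L b = u o\<^sub>L (a o\<^sub>L (v o\<^sub>L b))"
      by (simp_all add: uv(1) blinfun_compose_assoc)
    then show "b o\<^sub>L s \<in> S" "s o\<^sub>L b \<in> S"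
      using SI mult_closed b uv by metis+
  qed
  have SSP: "x o\<^sub>L y \<in> P" if x: "x \<in> S" and y: "y \<in> S" for x y
  proof -
    obtain u v where uv: "x = u o\<^sub>L (a o\<^sub>L v)" "u \<in> A" "v \<in> A" using SE[OF x] by blast
    obtain r s where rs: "y = r o\<^sub>L (a o\<^sub>L s)" "r \<in> A" "s \<in> A" using SE[OF y] by blast
    have "x o\<^sub>L y = u o\<^sub>L ((a o\<^sub>L ((v o\<^sub>L r) o\<^sub>L a)) o\<^sub>L s)"
      unfolding uv rs by (simp add: blinfun_compose_assoc)
    then show ?thesis
      using lP[OF uv(2) rP[OF rs(3) aa[OF mult_closed[OF uv(3) rs(2)]]]] by simp
  qed
  have "x o\<^sub>L y \<in> P" if "x \<in> cvec.span S" "y \<in> cvec.span S" for x y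
  proof (rule span_compose_right[OF sP that(1)])
    fix s assume s: "s \<in> S"
    then show "s o\<^sub>L y \<in> P"
      using span_compose_left[OF sP _ that(2)] SSP SA by blast
  qed
  then have "ideal_product (cvec.span S) (cvec.span S) \<subseteq> P" by (rule prod)
  then have KP: "cvec.span S \<subseteq> P" using pr[OF iK iK] by auto
  define L where "L = {b\<in>A. \<forall>x\<in>A. \<forall>y\<in>A. x o\<^sub>L (b o\<^sub>L y) \<in> P}"
  have LA: "L \<subseteq> A" by (auto simp: L_def)
  have LD: "x o\<^sub>L (b o\<^sub>L y) \<in> P" if "b \<in> L" "x \<in> A" "y \<in> A" for b x y
    using that unfolding L_def by blast
  have LI: "b \<in> L" if "b \<in> A" "\<And>x y. x \<in> A \<Longrightarrow> y \<in> A \<Longrightarrow> x o\<^sub>L (b o\<^sub>L y) \<in> P" for b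
    using that unfolding L_def by blast
  have iL: "ideal A L"
  proof (rule idealI[OF LA])
    show "0 \<in> L"
      using zero_mem cvec.subspace_0[OF sP] by (simp add: L_def comp.zero_left comp.zero_right)
    show "u + v \<in> L" if "u \<in> L" "v \<in> L" for u v
      using that add_closed cvec.subspace_add[OF sP]
      by (simp add: L_def comp.add_left comp.add_right)
    show "c *\<^sub>C u \<in> L" if "u \<in> L" for c u
      using that scaleC_closed cvec.subspace_scale[OF sP]
      by (simp add: L_def scaleC_compose compose_scaleC)
    fix b l assume b: "b \<in> A" and l: "l \<in> L"
    show "b o\<^sub>L l \<in> L"
    proof (rule LI)
      fix x y assume x: "x \<in> A" and y: "y \<in> A"
      show "x o\<^sub>L ((b o\<^sub>L l) o\<^sub>L y) \<in> P"
        using LD[OF l mult_closed[OF x b] y] by (simp add: blinfun_compose_assoc)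
    qed (use b l LA mult_closed in blast)
    show "l o\<^sub>L b \<in> L"
    proof (rule LI)
      fix x y assume x: "x \<in> A" and y: "y \<in> A"
      show "x o\<^sub>L ((l o\<^sub>L b) o\<^sub>L y) \<in> P"
        using LD[OF l x mult_closed[OF b y]] by (simp add: blinfun_compose_assoc)
    qed (use b l LA mult_closed in blast)
  qed
  \<comment> \<open>\<open>T\<close> spans the square of \<open>L\<close>. By definition of
    \<open>L\<close> the triple product of \<open>L\<close> lies in \<open>P\<close>, so primeness
    gives \<open>L \<subseteq> P\<close> or puts the square of \<open>L\<close> in \<open>P\<close>;
    in the second case primeness is applied once more.\<close>
  define T where "T = {x o\<^sub>L y | x y. x \<in> L \<and> y \<in> L}"
  have TI: "x o\<^sub>L y \<in> T" if "x \<in> L" "y \<in> L" for x y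
    unfolding T_def using that by blast
  have TE: "\<exists>x y. s = x o\<^sub>L y \<and> x \<in> L \<and> y \<in> L" if "s \<in> T" for s
    using that unfolding T_def by blast
  have iT: "ideal A (cvec.span T)"
  proof (rule ideal_span)
    show "T \<subseteq> A" using TE mult_closed LA by blast
    fix b s assume b: "b \<in> A" and s: "s \<in> T"
    obtain u v where uv: "s = u o\<^sub>L v" "u \<in> L" "v \<in> L" using TE[OF s] by blast
    show "b o\<^sub>L s \<in> T"
      using TI[OF ideal_left[OF iL b uv(2)] uv(3)] by (simp add: uv(1) blinfun_compose_assoc)
    show "s o\<^sub>L b \<in> T"
      using TI[OF uv(2) ideal_right[OF iL b uv(3)]] by (simp add: uv(1) blinfun_compose_assoc)
  qed
  have "x o\<^sub>L y \<in> P" if x: "x \<in> L" and y: "y \<in> cvec.span T" for x y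
  proof (rule span_compose_left[OF sP _ y])
    fix s assume "s \<in> T"
    then obtain u v where uv: "s = u o\<^sub>L v" "u \<in> L" "v \<in> L" using TE by blast
    show "x o\<^sub>L s \<in> P" unfolding uv(1) using LD uv x LA by blast
  qed (use x LA in blast)
  then have "ideal_product L (cvec.span T) \<subseteq> P" by (rule prod)
  then have "L \<subseteq> P \<or> cvec.span T \<subseteq> P" by (rule pr[OF iL iT])
  then have "L \<subseteq> P"
  proof
    assume "cvec.span T \<subseteq> P"
    then have "ideal_product L L \<subseteq> P" by (simp add: T_def ideal_product_def)
    then show ?thesis using pr[OF iL iL] by auto
  qed
  moreover have "a \<in> L"
    using a KP SI cvec.span_base by (intro LI) blast+
  ultimately show ?thesis by auto
qed


section \<open>The Jacobson radical\<close>

lemma rep_kernel_ideal: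
  assumes "algebra_rep A V \<sigma>"
  shows "ideal A (rep_kernel A V \<sigma>)"
proof -
  note rep = assms[unfolded algebra_rep_def]
  have V: "cvec.subspace V" using rep by blast
  have sadd: "\<sigma> a (v + w) = \<sigma> a v + \<sigma> a w" if "a \<in> A" "v \<in> V" "w \<in> V" for a v w
    using rep that by blast
  have scl: "\<sigma> (c *\<^sub>C a) v = c *\<^sub>C \<sigma> a v" if "a \<in> A" "v \<in> V" for a c v
    using rep that by blast
  have zr: "\<sigma> a 0 = 0" if "a \<in> A" for a
    using sadd[OF that, of 0 0] V by (simp add: cvec.subspace_0)
  have zl: "\<sigma> 0 v = 0" if "v \<in> V" for v
    using scl[OF zero_mem that, of 0] by simp
  show ?thesis
    unfolding ideal_def
  proof (intro conjI ballI)
    show "cvec.subspace (rep_kernel A V \<sigma>)"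
    proof (rule cvec.subspaceI)
      show "0 \<in> rep_kernel A V \<sigma>" using zl zero_mem by (auto simp: rep_kernel_def)
      show "a + b \<in> rep_kernel A V \<sigma>" if "a \<in> rep_kernel A V \<sigma>" "b \<in> rep_kernel A V \<sigma>" for a b
        using that add_closed rep by (auto simp: rep_kernel_def)
      show "c *\<^sub>C a \<in> rep_kernel A V \<sigma>" if "a \<in> rep_kernel A V \<sigma>" for a c
        using that scl scaleC_closed by (auto simp: rep_kernel_def)
    qed
    show "rep_kernel A V \<sigma> \<subseteq> A" by (auto simp: rep_kernel_def)
    fix a x assume a: "a \<in> A" and "x \<in> rep_kernel A V \<sigma>"
    then have x: "x \<in> A" "\<And>v. v \<in> V \<Longrightarrow> \<sigma> x v = 0" by (auto simp: rep_kernel_def)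
    have "\<sigma> (a o\<^sub>L x) v = \<sigma> a (\<sigma> x v)" "\<sigma> (x o\<^sub>L a) v = \<sigma> x (\<sigma> a v)" "\<sigma> a v \<in> V" if "v \<in> V" for v
      using rep a x(1) that by blast+
    then show "a o\<^sub>L x \<in> rep_kernel A V \<sigma>" "x o\<^sub>L a \<in> rep_kernel A V \<sigma>"
      using x a mult_closed zr by (auto simp: rep_kernel_def)
  qed
qed

lemma primitive_ideal_ideal: "primitive_ideal A P \<Longrightarrow> ideal A P"
  unfolding primitive_ideal_def irreducible_rep_def using rep_kernel_ideal by blast

text \<open>\<open>J v\<close> is invariant because \<open>J\<close> is a left ideal, and it is not
  zero, so irreducibility makes it all of \<open>V\<close>. This gives primeness of primitive ideals
  and, with \<open>J\<close> the closure of a primitive ideal, their closedness.\<close>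

lemma irreducible_rep_cyclic:
  assumes irr: "irreducible_rep A V \<sigma>" and J: "ideal A J" and v: "v \<in> V" and j: "j \<in> J" "\<sigma> j v \<noteq> 0"
    and w: "w \<in> V"
  obtains k where "k \<in> J" "\<sigma> k v = w"
proof -
  note rep = irr[unfolded irreducible_rep_def algebra_rep_def]
  have JA: "J \<subseteq> A" and Js: "cvec.subspace J" and Jl: "\<And>a x. a \<in> A \<Longrightarrow> x \<in> J \<Longrightarrow> a o\<^sub>L x \<in> J"
    using J unfolding ideal_def by auto
  have sV: "\<sigma> a v \<in> V" if "a \<in> A" "v \<in> V" for a v using rep that by blast
  have addl: "\<sigma> (a + b) v = \<sigma> a v + \<sigma> b v" if "a \<in> A" "b \<in> A" "v \<in> V" for a b v
    using rep that by blast
  have scl: "\<sigma> (c *\<^sub>C a) v = c *\<^sub>C \<sigma> a v" if "a \<in> A" "v \<in> V" for a c v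
    using rep that by blast
  have mul: "\<sigma> (a o\<^sub>L b) v = \<sigma> a (\<sigma> b v)" if "a \<in> A" "b \<in> A" "v \<in> V" for a b v
    using rep that by blast
  have irred: "W = {0} \<or> W = V"
    if "cvec.subspace W" "W \<subseteq> V" "\<And>a w. a \<in> A \<Longrightarrow> w \<in> W \<Longrightarrow> \<sigma> a w \<in> W" for W
    using conjunct2[OF conjunct2[OF rep]] that by simp
  define W where "W = (\<lambda>a. \<sigma> a v) ` J"
  have "cvec.subspace W"
  proof (rule cvec.subspaceI)
    have "\<sigma> 0 v = 0" using scl[OF zero_mem v, of 0] by simp
    then show "0 \<in> W" unfolding W_def using Js by (metis cvec.subspace_0 image_eqI)
    show "x + y \<in> W" if xy: "x \<in> W" "y \<in> W" for x y
    proof -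
      obtain a b where "a \<in> J" "b \<in> J" "x = \<sigma> a v" "y = \<sigma> b v"
        using xy unfolding W_def image_iff by metis
      moreover from this have "\<sigma> (a + b) v = x + y" using addl JA v by blast
      ultimately show ?thesis
        unfolding W_def using Js by (metis cvec.subspace_add image_eqI)
    qed
    show "c *\<^sub>C x \<in> W" if x: "x \<in> W" for c x
    proof -
      obtain a where "a \<in> J" "x = \<sigma> a v" using x unfolding W_def by blast
      moreover from this have "\<sigma> (c *\<^sub>C a) v = c *\<^sub>C x" using scl JA v by blast
      ultimately show ?thesis
        unfolding W_def using Js by (metis cvec.subspace_scale image_eqI)
    qed
  qed
  moreover have "W \<subseteq> V" unfolding W_def using sV v JA by blast
  moreover have "\<sigma> a u \<in> W" if a: "a \<in> A" and u: "u \<in> W" for a u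
  proof -
    obtain b where b: "b \<in> J" "u = \<sigma> b v" using u unfolding W_def by blast
    have "\<sigma> (a o\<^sub>L b) v = \<sigma> a u" using mul[OF a _ v, of b] JA b by auto
    then show ?thesis
      unfolding W_def using Jl[OF a b(1)] by (metis image_eqI)
  qed
  ultimately have "W = {0} \<or> W = V" by (rule irred)
  moreover have "\<sigma> j v \<in> W" using j unfolding W_def by blast
  ultimately have "w \<in> W" using j w by auto
  then show ?thesis using that unfolding W_def by blast
qed

text \<open>If some element of \<open>J\<close> moves \<open>v\<close> to a nonzero vector, every
  \<open>w\<close> has the form \<open>\<sigma> k v\<close> with \<open>k \<in> J\<close>, and
  \<open>I\<close> kills \<open>w\<close> because products from \<open>I\<close> and
  \<open>J\<close> kill \<open>v\<close>.\<close>

lemma primitive_ideal_prime: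
  assumes "primitive_ideal A P"
  shows "prime_ideal A P"
  unfolding prime_ideal_def
proof (intro conjI allI impI)
  show "ideal A P" using assms by (rule primitive_ideal_ideal)
  fix I J assume IJ: "ideal A I \<and> ideal A J \<and> ideal_product I J \<subseteq> P"
  obtain V :: "('k \<Rightarrow>\<^sub>L 'k) set" and \<sigma> where irr: "irreducible_rep A V \<sigma>" and P: "P = rep_kernel A V \<sigma>"
    using assms unfolding primitive_ideal_def by blast
  have IA: "I \<subseteq> A" "J \<subseteq> A" using IJ by (auto simp: ideal_def)
  show "I \<subseteq> P \<or> J \<subseteq> P"
  proof (rule disjCI)
    assume "\<not> J \<subseteq> P"
    then obtain j v where j: "j \<in> J" "v \<in> V" "\<sigma> j v \<noteq> 0"
      using IA unfolding P rep_kernel_def by auto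
    show "I \<subseteq> P"
      unfolding P rep_kernel_def
    proof (intro subsetI CollectI conjI ballI)
      fix i w assume i: "i \<in> I" and w: "w \<in> V"
      obtain k where k: "k \<in> J" "\<sigma> k v = w"
        by (rule irreducible_rep_cyclic[OF irr _ j(2,1,3) w]) (use IJ in blast)
      have "i o\<^sub>L k \<in> ideal_product I J"
        unfolding ideal_product_def using i k(1) by (intro cvec.span_base) blast
      then have "i o\<^sub>L k \<in> P" using IJ by blast
      then have "\<sigma> (i o\<^sub>L k) v = 0" using j(2) unfolding P rep_kernel_def by blast
      moreover have "\<sigma> (i o\<^sub>L k) v = \<sigma> i (\<sigma> k v)"
        using irr i k IA j(2) unfolding irreducible_rep_def algebra_rep_def by blast
      ultimately show "\<sigma> i w = 0" using k by simp
    next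
      show "i \<in> A" if "i \<in> I" for i using that IA by blast
    qed
  qed
qed

lemma prime_radical_subset_jacobson_radical: "prime_radical A \<subseteq> jacobson_radical A"
  unfolding prime_radical_def jacobson_radical_def using primitive_ideal_prime by blast

lemma ideal_prime_radical: "ideal A (prime_radical A)"
proof -
  have "ideal A {a\<in>A. \<forall>P\<in>{P. prime_ideal A P}. a \<in> P}"
    by (rule ideal_inter) (auto simp: prime_ideal_def)
  then show ?thesis by (simp add: prime_radical_def)
qed

lemma ideal_jacobson_radical: "ideal A (jacobson_radical A)"
proof -
  have "ideal A {a\<in>A. \<forall>P\<in>{P. primitive_ideal A P}. a \<in> P}"
    by (rule ideal_inter) (auto intro: primitive_ideal_ideal)
  then show ?thesis by (simp add: jacobson_radical_def)
qed

lemma prime_radical_semiprime: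
  assumes "a \<in> A" "\<And>b. b \<in> A \<Longrightarrow> a o\<^sub>L (b o\<^sub>L a) \<in> prime_radical A"
  shows "a \<in> prime_radical A"
  using assms prime_ideal_semiprime unfolding prime_radical_def by blast

text \<open>Primitive ideals are prime, prime ideals are semiprime, and semiprimeness survives
  intersections.\<close>

lemma jacobson_radical_semiprime:
  assumes "a \<in> A" "\<And>b. b \<in> A \<Longrightarrow> a o\<^sub>L (b o\<^sub>L a) \<in> jacobson_radical A"
  shows "a \<in> jacobson_radical A"
  using assms prime_ideal_semiprime primitive_ideal_prime unfolding jacobson_radical_def by blast

end


section \<open>Quasi-regularity and closedness of the radical\<close>

text \<open>If \<open>z\<close> had no left quasi-inverse, the left ideal \<open>L\<close> of all
  \<open>y - y z\<close> would miss \<open>z\<close>. Since \<open>z\<close> is a right unit modulo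
  \<open>L\<close>, a left ideal \<open>M\<close> maximal among those that contain \<open>L\<close>
  and miss \<open>z\<close> is a maximal left ideal. In the irreducible representation on
  \<open>A / M\<close> the class of \<open>z\<close> is nonzero and fixed by \<open>z\<close>, so
  \<open>z\<close> is outside a primitive ideal.\<close>

lemma (in operator_algebra) quasi_regular:
  assumes z: "z \<in> jacobson_radical A"
  obtains y where "y \<in> A" "y = z + (y o\<^sub>L z)"
proof -
  interpret AA: vector_space_pair "scaleC :: complex \<Rightarrow> ('k \<Rightarrow>\<^sub>L 'k) \<Rightarrow> ('k \<Rightarrow>\<^sub>L 'k)"
    "scaleC :: complex \<Rightarrow> ('k \<Rightarrow>\<^sub>L 'k) \<Rightarrow> ('k \<Rightarrow>\<^sub>L 'k)" ..
  have zA: "z \<in> A" using z by (simp add: jacobson_radical_def)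
  define L where "L = (\<lambda>y. y - (y o\<^sub>L z)) ` A"
  have LI: "y - (y o\<^sub>L z) \<in> L" if "y \<in> A" for y using that by (simp add: L_def)
  have diff_mem: "a - b \<in> A" if "a \<in> A" "b \<in> A" for a b
    using cvec.subspace_diff[OF subspace that] .
  define left_ideal where
    "left_ideal M \<longleftrightarrow> cvec.subspace M \<and> M \<subseteq> A \<and> (\<forall>a\<in>A. \<forall>x\<in>M. a o\<^sub>L x \<in> M)" for M
  have L: "left_ideal L"
    unfolding left_ideal_def
  proof (intro conjI ballI cvec.subspaceI)
    show "0 \<in> L" using LI[OF zero_mem] by (simp add: comp.zero_left)
    show "u + v \<in> L" if uv: "u \<in> L" "v \<in> L" for u v
    proof -
      obtain r s where "r \<in> A" "s \<in> A" "u = r - (r o\<^sub>L z)" "v = s - (s o\<^sub>L z)"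
        using uv unfolding L_def by blast
      then show ?thesis using LI[OF add_closed[of r s]] by (simp add: comp.add_left add_diff_add)
    qed
    show "c *\<^sub>C u \<in> L" if u: "u \<in> L" for c u
    proof -
      obtain r where "r \<in> A" "u = r - (r o\<^sub>L z)"
        using u unfolding L_def by blast
      then show ?thesis
        using LI[OF scaleC_closed[of r c]] by (simp add: scaleC_compose cvec.scale_right_diff_distrib)
    qed
    show "L \<subseteq> A" unfolding L_def by (intro image_subsetI diff_mem mult_closed zA)
    show "a o\<^sub>L u \<in> L" if a: "a \<in> A" and u: "u \<in> L" for a u
    proof -
      obtain r where "r \<in> A" "u = r - (r o\<^sub>L z)"
        using u unfolding L_def by blast
      then show ?thesis
        using LI[OF mult_closed[OF a, of r]] by (simp add: comp.diff_right blinfun_compose_assoc)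
    qed
  qed
  have "z \<in> L"
  proof (rule ccontr)
    assume zL: "z \<notin> L"
    define F where "F = {M. left_ideal M \<and> L \<subseteq> M \<and> z \<notin> M}"
    have "\<exists>M\<in>F. \<forall>N\<in>F. M \<subseteq> N \<longrightarrow> N = M"
    proof (rule subset_Zorn_nonempty)
      show "F \<noteq> {}" using L zL by (auto simp: F_def)
      fix C assume C: "C \<noteq> {}" "subset.chain F C"
      have CF: "M \<in> F" if "M \<in> C" for M using C(2) that by (auto simp: subset_chain_def)
      have CC: "M \<subseteq> N \<or> N \<subseteq> M" if "M \<in> C" "N \<in> C" for M N
        using C(2) that by (auto simp: subset_chain_def)
      have sub: "cvec.subspace M" "M \<subseteq> A" "\<And>a x. a \<in> A \<Longrightarrow> x \<in> M \<Longrightarrow> a o\<^sub>L x \<in> M" "L \<subseteq> M" "z \<notin> M"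
        if "M \<in> C" for M
        using CF[OF that] by (simp_all add: F_def left_ideal_def)
      have "left_ideal (\<Union>C)"
        unfolding left_ideal_def
      proof (intro conjI ballI cvec.subspaceI)
        show "0 \<in> \<Union>C" using C(1) cvec.subspace_0[OF sub(1)] by blast
        show "u + v \<in> \<Union>C" if uv: "u \<in> \<Union>C" "v \<in> \<Union>C" for u v
        proof -
          obtain M N where MN: "M \<in> C" "N \<in> C" "u \<in> M" "v \<in> N" using uv by blast
          then show ?thesis
            using CC[OF MN(1,2)] cvec.subspace_add[OF sub(1)] by blast
        qed
        show "c *\<^sub>C u \<in> \<Union>C" if u: "u \<in> \<Union>C" for c u
        proof -
          obtain M where M: "M \<in> C" "u \<in> M" using u by blast
          then show ?thesis using cvec.subspace_scale[OF sub(1)[OF M(1)] M(2)] by blast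
        qed
        show "\<Union>C \<subseteq> A" using sub(2) by blast
        show "a o\<^sub>L u \<in> \<Union>C" if a: "a \<in> A" and u: "u \<in> \<Union>C" for a u
        proof -
          obtain M where M: "M \<in> C" "u \<in> M" using u by blast
          then show ?thesis using sub(3)[OF M(1) a M(2)] by blast
        qed
      qed
      then show "\<Union>C \<in> F" using C(1) sub(4,5) by (auto simp: F_def)
    qed
    then obtain M where M: "M \<in> F" and max: "\<And>N. N \<in> F \<Longrightarrow> M \<subseteq> N \<Longrightarrow> N = M" by blast
    have Ms: "cvec.subspace M" and MA: "M \<subseteq> A" and Ml: "\<And>a x. a \<in> A \<Longrightarrow> x \<in> M \<Longrightarrow> a o\<^sub>L x \<in> M"
      and LM: "L \<subseteq> M" and zM: "z \<notin> M"
      using M by (simp_all add: F_def left_ideal_def)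
    have maxA: "N = A" if N: "left_ideal N" "M \<subseteq> N" "N \<noteq> M" for N
    proof -
      have Ns: "cvec.subspace N" and NA: "N \<subseteq> A" and Nl: "\<And>a x. a \<in> A \<Longrightarrow> x \<in> N \<Longrightarrow> a o\<^sub>L x \<in> N"
        using N(1) by (simp_all add: left_ideal_def)
      have zN: "z \<in> N" using N max LM by (force simp: F_def)
      have "y \<in> N" if y: "y \<in> A" for y
      proof -
        have "y - (y o\<^sub>L z) \<in> N" using LI[OF y] LM N(2) by blast
        then have "(y - (y o\<^sub>L z)) + (y o\<^sub>L z) \<in> N"
          by (rule cvec.subspace_add[OF Ns _ Nl[OF y zN]])
        then show ?thesis by (simp only: diff_add_cancel)
      qed
      then show ?thesis using NA by blast
    qed
    \<comment> \<open>\<open>A / M\<close> is realised on a linear complement of \<open>M\<close> in \<open>A\<close>, the range of a projection \<open>p\<close>.\<close>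
    obtain B where B: "B \<subseteq> M" "cvec.independent B" "M \<subseteq> cvec.span B"
      using cvec.maximal_independent_subset[of M] by metis
    obtain D where D: "B \<subseteq> D" "D \<subseteq> A" "cvec.independent D" "A \<subseteq> cvec.span D"
      using cvec.maximal_independent_subset_extend[of B A] B(1,2) MA by (metis order_trans)
    obtain p where p: "Vector_Spaces.linear scaleC scaleC p"
      "\<And>b. b \<in> D \<Longrightarrow> p b = (if b \<in> B then 0 else b)"
      using AA.linear_independent_extend[OF D(3), of "\<lambda>b. if b \<in> B then 0 else b"] by blast
    interpret p: Vector_Spaces.linear "scaleC :: complex \<Rightarrow> ('k \<Rightarrow>\<^sub>L 'k) \<Rightarrow> ('k \<Rightarrow>\<^sub>L 'k)"
      "scaleC :: complex \<Rightarrow> ('k \<Rightarrow>\<^sub>L 'k) \<Rightarrow> ('k \<Rightarrow>\<^sub>L 'k)" p by (rule p(1))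
    have pA: "p x \<in> A \<and> p x - x \<in> M" if "x \<in> A" for x
    proof -
      have "x \<in> cvec.span D" using that D(4) by blast
      then show ?thesis
      proof (induction rule: cvec.span_induct_alt)
        case base
        then show ?case by (simp add: p.zero zero_mem cvec.subspace_0[OF Ms])
      next
        case (step c u v)
        have "p u \<in> A" "p u - u \<in> M"
          using p(2)[OF step(1)] step(1) B(1) D(2) zero_mem cvec.subspace_0[OF Ms] cvec.subspace_neg[OF Ms]
          by auto
        then have "p (c *\<^sub>C u + v) \<in> A" "c *\<^sub>C (p u - u) + (p v - v) \<in> M"
          using step by (simp_all add: p.add p.scale add_closed scaleC_closed
              cvec.subspace_add[OF Ms] cvec.subspace_scale[OF Ms])
        moreover have "p (c *\<^sub>C u + v) - (c *\<^sub>C u + v) = c *\<^sub>C (p u - u) + (p v - v)"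
          by (simp add: p.add p.scale cvec.scale_right_diff_distrib add_diff_add)
        ultimately show ?case by (simp only: simp_thms)
      qed
    qed
    have pM: "p x = 0" if "x \<in> M" for x
    proof -
      have "x \<in> cvec.span B" using that B(3) by blast
      then show ?thesis
      proof (induction rule: cvec.span_induct_alt)
        case (step c u v)
        then show ?case using p(2)[of u] D(1) by (auto simp: p.add p.scale)
      qed (simp add: p.zero)
    qed
    have pcong: "p x = p y" if "x - y \<in> M" for x y
      using pM[OF that] by (simp add: p.diff)
    have pM': "x \<in> M" if "x \<in> A" "p x = 0" for x
      using conjunct2[OF pA[OF that(1)]] that(2) cvec.subspace_neg[OF Ms, of "- x"] by simp
    have pp: "p (p x) = p x" if "x \<in> A" for x
      by (rule pcong) (use pA[OF that] in blast)
    define V where "V = p ` A"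
    define \<sigma> :: "('k \<Rightarrow>\<^sub>L 'k) \<Rightarrow> ('k \<Rightarrow>\<^sub>L 'k) \<Rightarrow> 'k \<Rightarrow>\<^sub>L 'k" where "\<sigma> a v = p (a o\<^sub>L v)" for a v
    have VA: "v \<in> A" "p v = v" if v: "v \<in> V" for v
      using v pA pp unfolding V_def by auto
    have pV: "p x \<in> V" if "x \<in> A" for x using that by (simp add: V_def)
    have ap: "p (a o\<^sub>L p v) = p (a o\<^sub>L v)" if "a \<in> A" "v \<in> A" for a v
    proof (rule pcong)
      show "(a o\<^sub>L p v) - (a o\<^sub>L v) \<in> M"
        using Ml[OF that(1)] pA[OF that(2)] by (simp flip: comp.diff_right)
    qed
    have "algebra_rep A V \<sigma>"
      unfolding algebra_rep_def
    proof (intro conjI ballI allI)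
      show "cvec.subspace V" unfolding V_def by (rule p.subspace_image[OF subspace])
      fix a v assume a: "a \<in> A" and v: "v \<in> V"
      show "\<sigma> a v \<in> V" unfolding \<sigma>_def by (intro pV mult_closed a VA[OF v])
      show "\<sigma> a (v + w) = \<sigma> a v + \<sigma> a w" for w by (simp add: \<sigma>_def comp.add_right p.add)
      show "\<sigma> a (c *\<^sub>C v) = c *\<^sub>C \<sigma> a v" for c by (simp add: \<sigma>_def compose_scaleC[OF a] p.scale)
      show "\<sigma> (c *\<^sub>C a) v = c *\<^sub>C \<sigma> a v" for c by (simp add: \<sigma>_def scaleC_compose p.scale)
      show "\<sigma> (a + b) v = \<sigma> a v + \<sigma> b v" for b by (simp add: \<sigma>_def comp.add_left p.add)
      show "\<sigma> (a o\<^sub>L b) v = \<sigma> a (\<sigma> b v)" if "b \<in> A" for b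
        using ap[OF a mult_closed[OF that VA(1)[OF v]]] by (simp add: \<sigma>_def blinfun_compose_assoc)
    qed
    moreover have nz: "\<sigma> z (p z) \<noteq> 0" "p z \<in> V"
    proof -
      have "z - (z o\<^sub>L z) \<in> M" using LI[OF zA] LM by blast
      then have "p (z o\<^sub>L z) = p z" using pcong by metis
      then show "\<sigma> z (p z) \<noteq> 0" using ap[OF zA zA] pM'[OF zA] zM by (auto simp: \<sigma>_def)
      show "p z \<in> V" by (rule pV[OF zA])
    qed
    moreover have "W = {0} \<or> W = V"
      if W: "cvec.subspace W" "W \<subseteq> V" "\<forall>a\<in>A. \<forall>w\<in>W. \<sigma> a w \<in> W" for W
    proof -
      \<comment> \<open>Invariant subspaces of the quotient correspond to left ideals between
        \<open>M\<close> and \<open>A\<close>; \<open>N\<close> is the one belonging to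
        \<open>W\<close>.\<close>
      define N where "N = {x\<in>A. p x \<in> W}"
      have N: "left_ideal N"
        unfolding left_ideal_def
      proof (intro conjI ballI cvec.subspaceI)
        show "0 \<in> N" by (simp add: N_def zero_mem p.zero cvec.subspace_0[OF W(1)])
        show "u + v \<in> N" if "u \<in> N" "v \<in> N" for u v
          using that by (simp add: N_def add_closed p.add cvec.subspace_add[OF W(1)])
        show "c *\<^sub>C u \<in> N" if "u \<in> N" for c u
          using that by (simp add: N_def scaleC_closed p.scale cvec.subspace_scale[OF W(1)])
        show "N \<subseteq> A" by (auto simp: N_def)
        show "a o\<^sub>L u \<in> N" if "a \<in> A" "u \<in> N" for a u
        proof -
          have "u \<in> A" "p (a o\<^sub>L p u) \<in> W"
            using that W(3) by (simp_all add: N_def \<sigma>_def)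
          then show ?thesis using that(1) ap[OF that(1)] by (simp add: N_def mult_closed)
        qed
      qed
      have MN: "M \<subseteq> N" using MA pM cvec.subspace_0[OF W(1)] by (auto simp: N_def)
      have WN: "w \<in> N" if "w \<in> W" for w
        using that W(2) VA[of w] by (auto simp: N_def)
      show ?thesis
      proof (cases "N = M")
        case True
        then have "w = 0" if "w \<in> W" for w
          using WN[OF that] pM VA(2)[of w] that W(2) by auto
        then show ?thesis using cvec.subspace_0[OF W(1)] by blast
      next
        case False
        then have "N = A" by (rule maxA[OF N MN])
        then show ?thesis using W(2) unfolding V_def N_def by blast
      qed
    qed
    ultimately have "irreducible_rep A V \<sigma>"
      unfolding irreducible_rep_def using zA by blast
    then have "z \<in> rep_kernel A V \<sigma>"
      using z unfolding jacobson_radical_def primitive_ideal_def by blast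
    then show False using nz unfolding rep_kernel_def by blast
  qed
  then obtain y where "y \<in> A" "z = y - (y o\<^sub>L z)" unfolding L_def by blast
  then show ?thesis using that[of y] by (simp add: algebra_simps)
qed

text \<open>The Neumann series without its constant term, as \<open>A\<close> may lack a unit:
  \<open>c\<close> is the sum of all positive powers of \<open>b\<close>, and it stays in
  \<open>A\<close> because \<open>A\<close> is closed.\<close>

lemma small_quasi_regular:
  fixes b :: "'k::{complex_normed_vector,banach} \<Rightarrow>\<^sub>L 'k"
  assumes "operator_algebra A" "closed A" "b \<in> A" "norm b < 1"
  obtains c where "c \<in> A" "c = b + (c o\<^sub>L b)"
proof -
  interpret operator_algebra A by fact
  define s where "s n = ((\<lambda>x. x o\<^sub>L b) ^^ n) b" for n
  have sA: "s n \<in> A" for n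
    by (induction n) (simp_all add: s_def assms(3) mult_closed)
  have "norm (s n) \<le> norm b ^ n * norm b" for n
  proof (induction n)
    case (Suc n)
    have "norm (s (Suc n)) \<le> norm (s n) * norm b" by (simp add: s_def norm_blinfun_compose)
    also have "\<dots> \<le> norm b ^ n * norm b * norm b" by (intro mult_right_mono Suc) auto
    finally show ?case by (simp add: mult_ac)
  qed (simp add: s_def)
  then have sum: "summable s"
    using assms(4) by (intro summable_comparison_test[OF _ summable_mult2[OF summable_geometric[of "norm b"]]]) auto
  have "(\<Sum>i<n. s i) \<in> A" for n
    by (induction n) (simp_all add: zero_mem add_closed sA)
  then have "suminf s \<in> A"
    by (rule closed_sequentially[OF assms(2) _ summable_LIMSEQ[OF sum]])
  moreover have "suminf s = b + (suminf s o\<^sub>L b)"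
  proof -
    have "suminf s o\<^sub>L b = (\<Sum>n. s n o\<^sub>L b)"
      by (rule bounded_linear.suminf[OF comp.bounded_linear_left sum])
    also have "\<dots> = (\<Sum>n. s (Suc n))" by (simp add: s_def)
    also have "\<dots> = suminf s - b" using suminf_split_head[OF sum] by (simp add: s_def)
    finally show ?thesis by simp
  qed
  ultimately show ?thesis by (rule that)
qed

lemma bounded_linear_scaleC: "bounded_linear (\<lambda>x :: 'a::complex_normed_vector. c *\<^sub>C x)"
  by (rule bounded_linear_intro[of _ "cmod c"])
    (simp_all add: scaleC_add_right norm_scaleC scaleR_scaleC scaleC_scaleC mult.commute)

lemma bounded_linear_closure_mem:
  assumes "bounded_linear f" "\<And>y. y \<in> S \<Longrightarrow> f y \<in> T" "x \<in> closure S"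
  shows "f x \<in> closure T"
proof -
  obtain u where "\<And>n. u n \<in> S" "u \<longlonglongrightarrow> x"
    using assms(3) unfolding closure_sequential by blast
  then show ?thesis
    unfolding closure_sequential using assms(2) bounded_linear.tendsto[OF assms(1)]
    by (intro exI[of _ "\<lambda>n. f (u n)"]) simp
qed

lemma subspace_closure:
  fixes S :: "'a::complex_normed_vector set"
  assumes S: "cvec.subspace S"
  shows "cvec.subspace (closure S)"
proof (rule cvec.subspaceI)
  show "0 \<in> closure S" using cvec.subspace_0[OF S] closure_subset by blast
  show "x + y \<in> closure S" if xy: "x \<in> closure S" "y \<in> closure S" for x y
  proof -
    obtain u v where "\<And>n. u n \<in> S" "u \<longlonglongrightarrow> x" "\<And>n. v n \<in> S" "v \<longlonglongrightarrow> y"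
      using xy unfolding closure_sequential by metis
    then show ?thesis
      unfolding closure_sequential
      by (intro exI[of _ "\<lambda>n. u n + v n"]) (simp add: tendsto_add cvec.subspace_add[OF S])
  qed
  show "c *\<^sub>C x \<in> closure S" if "x \<in> closure S" for c x
    by (rule bounded_linear_closure_mem[OF bounded_linear_scaleC _ that]) (rule cvec.subspace_scale[OF S])
qed

lemma ideal_closure:
  assumes "closed A" "ideal A I"
  shows "ideal A (closure I)"
  unfolding ideal_def
proof (intro conjI ballI)
  show "cvec.subspace (closure I)" by (rule subspace_closure[OF ideal_subspace[OF assms(2)]])
  show "closure I \<subseteq> A" by (rule closure_minimal[OF ideal_subset[OF assms(2)] assms(1)])
  show "a o\<^sub>L x \<in> closure I" if "a \<in> A" "x \<in> closure I" for a x
    by (rule bounded_linear_closure_mem[OF comp.bounded_linear_right ideal_left[OF assms(2) that(1)] that(2)])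
  show "x o\<^sub>L a \<in> closure I" if "a \<in> A" "x \<in> closure I" for a x
    by (rule bounded_linear_closure_mem[OF comp.bounded_linear_left ideal_right[OF assms(2) that(1)] that(2)])
qed

text \<open>The representation space carries no norm, so continuity of \<open>\<sigma>\<close>
  cannot be invoked. Instead, if the closure of \<open>P\<close> acted nontrivially, some
  \<open>k\<close> in it would fix a vector \<open>v \<noteq> 0\<close>. Subtracting a nearby
  \<open>q \<in> P\<close>, which kills \<open>v\<close>, leaves an element of norm below 1 that
  still fixes \<open>v\<close>; this contradicts quasi-regularity.\<close>

lemma primitive_ideal_closed:
  fixes A :: "('k::{complex_normed_vector,banach} \<Rightarrow>\<^sub>L 'k) set"
  assumes A: "operator_algebra A" "closed A" and P: "primitive_ideal A P"
  shows "closed P"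
proof -
  interpret operator_algebra A by fact
  obtain V :: "('k \<Rightarrow>\<^sub>L 'k) set" and \<sigma> where irr: "irreducible_rep A V \<sigma>" and PV: "P = rep_kernel A V \<sigma>"
    using P unfolding primitive_ideal_def by blast
  note rep = irr[unfolded irreducible_rep_def algebra_rep_def]
  have sV: "\<sigma> a v \<in> V" if "a \<in> A" "v \<in> V" for a v using rep that by blast
  have addl: "\<sigma> (a + b) v = \<sigma> a v + \<sigma> b v" if "a \<in> A" "b \<in> A" "v \<in> V" for a b v
    using rep that by blast
  have mul: "\<sigma> (a o\<^sub>L b) v = \<sigma> a (\<sigma> b v)" if "a \<in> A" "b \<in> A" "v \<in> V" for a b v
    using rep that by blast
  have id: "ideal A (closure P)"
    by (rule ideal_closure[OF A(2) primitive_ideal_ideal[OF P]])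
  have "closure P \<subseteq> P"
  proof (rule ccontr)
    assume "\<not> closure P \<subseteq> P"
    then obtain j v where j: "j \<in> closure P" "v \<in> V" "\<sigma> j v \<noteq> 0"
      using ideal_subset[OF id] unfolding PV rep_kernel_def by auto
    define w where "w = \<sigma> j v"
    have w: "w \<in> V" "w \<noteq> 0"
      using j ideal_subset[OF id] sV by (auto simp: w_def)
    obtain k where k: "k \<in> closure P" "\<sigma> k v = v"
      by (rule irreducible_rep_cyclic[OF irr id j(2,1,3) j(2)])
    have v0: "v \<noteq> 0"
    proof
      assume "v = 0"
      have "\<sigma> j (v + v) = \<sigma> j v + \<sigma> j v" using rep j ideal_subset[OF id] by blast
      then show False using j(3) \<open>v = 0\<close> by simp
    qed
    obtain q where q: "q \<in> P" "dist q k < 1"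
      using k(1) unfolding closure_approachable by (metis zero_less_one)
    define b where "b = k - q"
    have qA: "q \<in> A" "\<sigma> q v = 0" using q(1) j(2) by (auto simp: PV rep_kernel_def)
    have kA: "k \<in> A" using k ideal_subset[OF id] by blast
    have bA: "b \<in> A" unfolding b_def by (rule cvec.subspace_diff[OF subspace kA qA(1)])
    have "norm b < 1" using q(2) by (simp add: b_def dist_norm norm_minus_commute)
    then obtain c where c: "c \<in> A" "c = b + (c o\<^sub>L b)"
      using small_quasi_regular[OF A bA] by blast
    have bv: "\<sigma> b v = v"
      using addl[OF bA qA(1) j(2)] qA(2) k(2) by (simp add: b_def)
    \<comment> \<open>Since \<open>b\<close> fixes \<open>v\<close>, the equation for
      \<open>c\<close> applied to \<open>v\<close> reads \<open>c v = v + c v\<close>.\<close>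
    have "\<sigma> c v = \<sigma> b v + \<sigma> (c o\<^sub>L b) v"
      using arg_cong[OF c(2), of "\<lambda>x. \<sigma> x v"] addl[OF bA mult_closed[OF c(1) bA] j(2)]
      by (rule trans)
    then have "v = 0" using mul[OF c(1) bA j(2)] bv by simp
    with v0 show False by blast
  qed
  then show ?thesis by (simp add: closure_subset_eq)
qed

lemma closed_jacobson_radical:
  fixes A :: "('k::{complex_normed_vector,banach} \<Rightarrow>\<^sub>L 'k) set"
  assumes "operator_algebra A" "closed A"
  shows "closed (jacobson_radical A)"
proof -
  have "jacobson_radical A = A \<inter> \<Inter>{P. primitive_ideal A P}"
    by (auto simp: jacobson_radical_def)
  then show ?thesis
    using primitive_ideal_closed[OF assms] assms(2) by (auto intro!: closed_Int closed_Inter)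
qed


section \<open>Functions vanishing at infinity\<close>

lemma C0_continuous: "f \<in> C0 \<Longrightarrow> continuous_on UNIV f"
  by (simp add: C0_def)

lemma C0_zero: "(\<lambda>_. 0) \<in> C0"
  by (auto simp: C0_def intro!: exI[of _ "{}"])

lemma C0_scale:
  assumes "f \<in> C0"
  shows "(\<lambda>x. c * f x) \<in> C0"
  by (rule C0_norm_leI[OF assms, of _ "cmod c"])
    (auto simp: norm_mult intro!: continuous_intros C0_continuous[OF assms])

lemma C0_cnj:
  assumes "f \<in> C0"
  shows "(\<lambda>x. cnj (f x)) \<in> C0"
  by (rule C0_norm_leI[OF assms, of _ 1]) (auto intro!: continuous_intros C0_continuous[OF assms])

lemma C0_mult:
  assumes "f \<in> C0" "g \<in> C0"
  shows "(\<lambda>x. f x * g x) \<in> C0"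
  by (rule C0_norm_leI[OF assms(2), of _ "sup_norm f"])
    (auto simp: norm_mult intro!: continuous_intros C0_continuous[OF assms(1)] C0_continuous[OF assms(2)]
      mult_right_mono cmod_le_sup_norm[OF assms(1)])

lemma C0_add:
  assumes "f \<in> C0" "g \<in> C0"
  shows "(\<lambda>x. f x + g x) \<in> C0"
proof -
  have "\<exists>K. compact K \<and> (\<forall>x. x \<notin> K \<longrightarrow> cmod (f x + g x) < e)" if "e > 0" for e
  proof -
    obtain K where K: "compact K" "\<And>x. x \<notin> K \<Longrightarrow> cmod (f x) < e / 2"
      using assms(1) half_gt_zero[OF \<open>e > 0\<close>] unfolding C0_def by blast
    obtain L where L: "compact L" "\<And>x. x \<notin> L \<Longrightarrow> cmod (g x) < e / 2"
      using assms(2) half_gt_zero[OF \<open>e > 0\<close>] unfolding C0_def by blast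
    have "cmod (f x + g x) < e" if "x \<notin> K \<union> L" for x
      using norm_triangle_ineq[of "f x" "g x"] K(2)[of x] L(2)[of x] that by simp
    then show ?thesis using compact_Un[OF K(1) L(1)] by blast
  qed
  then show ?thesis
    using C0_continuous[OF assms(1)] C0_continuous[OF assms(2)]
    by (auto simp: C0_def intro!: continuous_intros)
qed

lemma C0_diff:
  assumes "f \<in> C0" "g \<in> C0"
  shows "(\<lambda>x. f x - g x) \<in> C0"
  using C0_add[OF assms(1) C0_scale[OF assms(2), of "- 1"]] by simp

lemma C0_sum:
  assumes "\<And>i. i \<in> I \<Longrightarrow> f i \<in> C0"
  shows "(\<lambda>x. \<Sum>i\<in>I. f i x) \<in> C0"
  using assms by (induction I rule: infinite_finite_induct) (simp_all add: C0_zero C0_add)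

lemma C0_uniform_limit:
  assumes "\<And>n. f n \<in> C0" "uniform_limit UNIV f g sequentially"
  shows "g \<in> C0"
proof -
  have "continuous_on UNIV g"
    by (rule uniform_limit_theorem[OF _ assms(2)]) (simp_all add: C0_continuous[OF assms(1)])
  moreover have "\<exists>K. compact K \<and> (\<forall>x. x \<notin> K \<longrightarrow> cmod (g x) < e)" if "e > 0" for e
  proof -
    have "\<forall>\<^sub>F n in sequentially. \<forall>x\<in>UNIV. dist (f n x) (g x) < e / 2"
      using assms(2) half_gt_zero[OF \<open>e > 0\<close>] by (rule uniform_limitD)
    then obtain n where n: "\<And>x. dist (f n x) (g x) < e / 2"
      unfolding eventually_sequentially by blast
    obtain K where K: "compact K" "\<And>x. x \<notin> K \<Longrightarrow> cmod (f n x) < e / 2"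
      using assms(1)[of n] half_gt_zero[OF \<open>e > 0\<close>] unfolding C0_def by blast
    have "cmod (g x) < e" if "x \<notin> K" for x
      using norm_triangle_ineq2[of "g x" "f n x"] n[of x] K(2)[OF that]
      by (simp add: dist_norm norm_minus_commute)
    then show ?thesis using K(1) by blast
  qed
  ultimately show ?thesis by (simp add: C0_def)
qed

lemma compact_cball_in_open:
  assumes "locally compact (UNIV :: 'x::metric_space set)" "open V" "(y::'x) \<in> V"
  obtains e where "e > 0" "compact (cball y e)" "cball y e \<subseteq> V"
proof -
  obtain u v where uv: "open u" "compact v" "y \<in> u" "u \<subseteq> v" "v \<subseteq> V"
    using assms unfolding locally_def by (metis open_openin subtopology_UNIV)
  obtain e where e: "e > 0" "cball y e \<subseteq> u"
    using uv(1,3) open_contains_cball by blast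
  have "compact (cball y e)"
    using closed_Int_compact[OF closed_cball uv(2), of y e] e(2) uv(4) by (simp add: Int_absorb2 order_trans)
  then show ?thesis using that e uv by blast
qed

text \<open>A tent function that vanishes off a compact ball. Nonnegativity is recorded for the
  growth argument, where coefficients must not cancel.\<close>

lemma C0_bump:
  assumes "locally compact (UNIV :: 'x::metric_space set)" "open V" "(y::'x) \<in> V"
  obtains f where "f \<in> C0" "f y = 1" "\<And>x. x \<notin> V \<Longrightarrow> f x = 0" "\<And>x. f x \<in> \<real>\<^sub>\<ge>\<^sub>0"
proof -
  obtain e where e: "e > 0" "compact (cball y e)" "cball y e \<subseteq> V"
    using compact_cball_in_open[OF assms] .
  define f where "f x = complex_of_real (max 0 (1 - dist y x / e))" for x
  have z: "f x = 0" if "x \<notin> cball y e" for x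
    using that e(1) by (simp add: f_def max_def field_simps)
  have "continuous_on UNIV f"
    unfolding f_def using e(1) by (intro continuous_intros) auto
  then have "f \<in> C0"
    unfolding C0_def using e(2) z by fastforce
  moreover have "f x = 0" if "x \<notin> V" for x
    using z that e(3) by blast
  ultimately show ?thesis
    using that[of f] by (simp add: f_def)
qed


section \<open>Fourier coefficients\<close>

lemma finite_vec_le: "finite {T :: nat ^ 'd. T \<le> S}"
proof (rule finite_subset)
  show "{T. T \<le> S} \<subseteq> (\<lambda>f. \<chi> i. f i) ` (\<Pi>\<^sub>E i\<in>UNIV. {..S $ i})"
  proof
    fix T assume "T \<in> {T. T \<le> S}"
    then have "(\<lambda>i. T $ i) \<in> (\<Pi>\<^sub>E i\<in>UNIV. {..S $ i})" by (auto simp: less_eq_vec_def)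
    then show "T \<in> (\<lambda>f. \<chi> i. f i) ` (\<Pi>\<^sub>E i\<in>UNIV. {..S $ i})"
      by (intro image_eqI[of _ _ "\<lambda>i. T $ i"]) (simp_all add: vec_eq_iff)
  qed
qed (auto intro!: finite_imageI finite_PiE)

lemma vec_diff_add_cancel: "T \<le> S \<Longrightarrow> S - T + T = (S :: nat ^ 'd)"
  by (simp add: vec_eq_iff less_eq_vec_def)

lemma vec_le_add: "T \<le> S + (T :: nat ^ 'd)"
  by (simp add: less_eq_vec_def)

lemma norm_ell2_single: "norm (ell2_single k \<xi> :: ('i, 'h::complex_normed_vector) ell2) = norm \<xi>"
proof -
  have "(\<Sum>\<^sub>\<infinity>i. (norm (if i = k then \<xi> else 0))\<^sup>2) = (\<Sum>\<^sub>\<infinity>i\<in>{k}. (norm \<xi>)\<^sup>2)"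
    by (rule infsum_cong_neutral) auto
  then show ?thesis by (simp add: norm_ell2.rep_eq ell2_single.rep_eq)
qed

locale analytic_crossed_product =
  fixes \<phi> :: "nat ^ 'd \<Rightarrow> 'x::metric_space \<Rightarrow> 'x"
    and \<rho> :: "('x \<Rightarrow> complex) \<Rightarrow> 'h::chilbert_space \<Rightarrow>\<^sub>L 'h"
  assumes dyn: "dynamical_system \<phi>"
    and rep: "faithful_star_rep \<rho>"
begin

abbreviation U where "U \<equiv> monomial \<phi> \<rho>"

lemma phi_add: "\<phi> (n + m) x = \<phi> n (\<phi> m x)"
  and phi_zero: "\<phi> 0 x = x"
  and phi_continuous: "continuous_on UNIV (\<phi> n)"
  using dyn by (simp_all add: dynamical_system_def)

lemmas C0_phi = C0_compose[OF dyn]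

lemma C0_phi': "f \<in> C0 \<Longrightarrow> (\<lambda>x. f (\<phi> n x)) \<in> C0"
  using C0_phi by (simp add: comp_def)

lemma rho_add: "f \<in> C0 \<Longrightarrow> g \<in> C0 \<Longrightarrow> \<rho> (\<lambda>x. f x + g x) = \<rho> f + \<rho> g"
  and rho_scale: "f \<in> C0 \<Longrightarrow> \<rho> (\<lambda>x. c * f x) = c *\<^sub>C \<rho> f"
  and rho_mult: "f \<in> C0 \<Longrightarrow> g \<in> C0 \<Longrightarrow> \<rho> (\<lambda>x. f x * g x) = \<rho> f o\<^sub>L \<rho> g"
  and rho_clinear: "f \<in> C0 \<Longrightarrow> \<rho> f (c *\<^sub>C \<xi>) = c *\<^sub>C \<rho> f \<xi>"
  and rho_inj: "inj_on \<rho> C0"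
  using rep unfolding faithful_star_rep_def complex_linear_def by blast+

lemma rho_zero: "\<rho> (\<lambda>_. 0) = 0"
  using rho_scale[OF C0_zero, of 0] by simp

lemma rho_diff:
  assumes "f \<in> C0" "g \<in> C0"
  shows "\<rho> (\<lambda>x. f x - g x) = \<rho> f - \<rho> g"
  using rho_add[OF assms(1) C0_scale[OF assms(2)], of "- 1"] rho_scale[OF assms(2), of "- 1"]
  by simp

lemma rho_sum:
  assumes "\<And>i. i \<in> I \<Longrightarrow> f i \<in> C0"
  shows "\<rho> (\<lambda>x. \<Sum>i\<in>I. f i x) = (\<Sum>i\<in>I. \<rho> (f i))"
  using assms
proof (induction I rule: infinite_finite_induct)
  case (insert i I)
  then have "\<rho> (\<lambda>x. f i x + (\<Sum>i\<in>I. f i x)) = \<rho> (f i) + \<rho> (\<lambda>x. \<Sum>i\<in>I. f i x)"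
    by (intro rho_add C0_sum) auto
  with insert show ?case by simp
qed (simp_all add: rho_zero)

text \<open>
  Injectivity makes \<open>\<rho>\<close> isometric: on the range of \<open>\<rho> g\<close>, where \<open>g\<close> is supported on the set on
  which \<open>\<bar>f\<bar> \<ge> c\<close>, the operator \<open>\<rho> f\<close> has an inverse of norm at most \<open>1 / c\<close>.
\<close>

lemma cmod_le_norm_rho:
  assumes f: "f \<in> C0"
  shows "cmod (f x) \<le> norm (\<rho> f)"
proof (rule dense_ge)
  fix b assume "norm (\<rho> f) < b"
  show "cmod (f x) \<le> b"
  proof (rule ccontr)
    assume "\<not> cmod (f x) \<le> b"
    then have bf: "b < cmod (f x)" by simp
    have b: "b > 0" using \<open>norm (\<rho> f) < b\<close> norm_ge_zero[of "\<rho> f"] by linarith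
    define g where "g y = complex_of_real (max 0 (cmod (f y) - b))" for y
    have gC: "g \<in> C0"
      by (rule C0_norm_leI[OF f, of _ 1])
        (use b in \<open>auto simp: g_def intro!: continuous_intros C0_continuous[OF f]\<close>)
    \<comment> \<open>\<open>h\<close> is \<open>1 / f\<close> where the modulus of \<open>f\<close>
      is at least \<open>b\<close>, in particular wherever \<open>g\<close> is nonzero; the maximum
      in the denominator continues it to all of the space with modulus at most
      \<open>1 / b\<close>.\<close>
    define h where "h y = cnj (f y) / complex_of_real (max ((cmod (f y))\<^sup>2) (b\<^sup>2))" for y
    have nz: "max ((cmod (f y))\<^sup>2) (b\<^sup>2) > 0" for y using b by (simp add: less_max_iff_disj)
    have hC: "h \<in> C0"
    proof (rule C0_norm_leI[OF f, of _ "1 / b\<^sup>2"])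
      show "continuous_on UNIV h"
        unfolding h_def using nz by (intro continuous_intros C0_continuous[OF f]) (metis of_real_eq_0_iff order_less_irrefl)
      have "cmod (f y) / max ((cmod (f y))\<^sup>2) (b\<^sup>2) \<le> cmod (f y) / b\<^sup>2" for y
        using b by (intro divide_left_mono) (auto simp: less_max_iff_disj)
      then show "cmod (h y) \<le> 1 / b\<^sup>2 * cmod (f y)" for y
        using nz by (simp add: h_def norm_divide abs_of_pos)
    qed
    have h1: "cmod (h y) \<le> 1 / b" for y
    proof -
      have "b * cmod (f y) \<le> max ((cmod (f y))\<^sup>2) (b\<^sup>2)"
      proof (cases "b \<le> cmod (f y)")
        case True
        then have "b * cmod (f y) \<le> (cmod (f y))\<^sup>2"
          unfolding power2_eq_square by (intro mult_right_mono) auto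
        then show ?thesis by simp
      next
        case False
        then have "b * cmod (f y) \<le> b\<^sup>2"
          unfolding power2_eq_square using b by (intro mult_left_mono) auto
        then show ?thesis by simp
      qed
      then show ?thesis using b nz[of y] by (simp add: h_def norm_divide field_simps)
    qed
    have "h y * (f y * g y) = g y" for y
    proof (cases "b \<le> cmod (f y)")
      case True
      then have "max ((cmod (f y))\<^sup>2) (b\<^sup>2) = (cmod (f y))\<^sup>2" using b by (simp add: max_def)
      moreover have "f y \<noteq> 0" using True b by auto
      ultimately show ?thesis
        by (simp add: h_def complex_norm_square mult.commute del: of_real_power)
    qed (simp add: g_def)
    then have "(\<lambda>y. h y * (f y * g y)) = g" by (rule ext)
    then have "\<rho> g = \<rho> h o\<^sub>L (\<rho> f o\<^sub>L \<rho> g)"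
      using rho_mult[OF hC C0_mult[OF f gC]] rho_mult[OF f gC] by metis
    then have eq: "\<rho> g \<xi> = \<rho> h (\<rho> f (\<rho> g \<xi>))" for \<xi>
      by (metis blinfun_apply_blinfun_compose)
    have "g x \<noteq> 0" using bf by (simp add: g_def)
    then have "\<rho> g \<noteq> 0"
      using inj_onD[OF rho_inj _ gC C0_zero] rho_zero by metis
    then obtain \<xi> where \<xi>: "\<rho> g \<xi> \<noteq> 0" by (metis blinfun_eqI blinfun.zero_left)
    have "norm (\<rho> g \<xi>) \<le> 1 / b * norm (\<rho> f (\<rho> g \<xi>))"
      using faithful_star_rep_bound[OF rep hC h1, of "\<rho> f (\<rho> g \<xi>)"] b eq[of \<xi>] by simp
    also have "\<dots> \<le> 1 / b * (norm (\<rho> f) * norm (\<rho> g \<xi>))"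
      using b by (intro mult_left_mono norm_blinfun) auto
    also have "\<dots> < norm (\<rho> g \<xi>)"
      using b \<xi> \<open>norm (\<rho> f) < b\<close> by (simp add: field_simps)
    finally show False by simp
  qed
qed

text \<open>
  \<open>has_coeffs a F\<close> states that \<open>a\<close> is represented by the formal series with coefficients \<open>F n\<close>,
  that is, \<open>a\<close> acts as the lower triangular matrix with entries \<open>\<rho> (F n \<circ> \<phi> k)\<close> at \<open>(k + n, k)\<close>.
\<close>

definition has_coeffs :: "((nat ^ 'd, 'h) ell2 \<Rightarrow>\<^sub>L (nat ^ 'd, 'h) ell2) \<Rightarrow> (nat ^ 'd \<Rightarrow> 'x \<Rightarrow> complex) \<Rightarrow> bool"
  where "has_coeffs a F \<longleftrightarrow> (\<forall>n. F n \<in> C0) \<and>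
    (\<forall>v S. Rep_ell2 (a v) S = (\<Sum>T | T \<le> S. \<rho> (F (S - T) \<circ> \<phi> T) (Rep_ell2 v T)))"

text \<open>Vectors concentrated at index 0 see only the column at 0, whose entries are the plain
  \<open>\<rho> (F n)\<close> because \<open>\<phi> 0\<close> is the identity; the lower bound for
  the norm of \<open>\<rho> (F n)\<close> does the rest. Uniqueness and continuity of the
  coefficients rest on this estimate.\<close>

lemma has_coeffs_bound:
  assumes "has_coeffs a F"
  shows "cmod (F n x) \<le> norm a"
proof -
  have FC: "F n \<in> C0" using assms by (simp add: has_coeffs_def)
  have "Rep_ell2 (a (ell2_single 0 \<xi>)) n = \<rho> (F n) \<xi>" for \<xi>
  proof -
    have "Rep_ell2 (a (ell2_single 0 \<xi>)) n
        = (\<Sum>T | T \<le> n. \<rho> (F (n - T) \<circ> \<phi> T) (if T = 0 then \<xi> else 0))"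
      using assms by (simp add: has_coeffs_def ell2_single.rep_eq)
    also have "\<dots> = (\<Sum>T | T \<le> n. if T = 0 then \<rho> (F n) \<xi> else 0)"
      using dyn by (intro sum.cong) (auto simp: blinfun.zero_right dynamical_system_def)
    also have "\<dots> = \<rho> (F n) \<xi>"
      by (subst sum.delta[OF finite_vec_le]) (simp add: less_eq_vec_def)
    finally show ?thesis .
  qed
  then have "norm (\<rho> (F n) \<xi>) \<le> norm a * norm \<xi>" for \<xi>
    using norm_Rep_ell2_le[of "a (ell2_single 0 \<xi>)" n] norm_blinfun[of a "ell2_single 0 \<xi>"]
    by (simp add: norm_ell2_single)
  then have "norm (\<rho> (F n)) \<le> norm a"
    by (intro norm_blinfun_bound) auto
  then show ?thesis using cmod_le_norm_rho[OF FC, of x] by linarith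
qed

lemma has_coeffs_add:
  assumes "has_coeffs a F" "has_coeffs b G"
  shows "has_coeffs (a + b) (\<lambda>n x. F n x + G n x)"
proof -
  have C: "F n \<in> C0" "G n \<in> C0" for n using assms by (auto simp: has_coeffs_def)
  have "\<rho> ((\<lambda>x. F n x + G n x) \<circ> \<phi> k) = \<rho> (F n \<circ> \<phi> k) + \<rho> (G n \<circ> \<phi> k)" for n k
    using rho_add[OF C0_phi[OF C(1)] C0_phi[OF C(2)]] by (simp add: comp_def)
  then show ?thesis
    using assms unfolding has_coeffs_def
    by (auto simp: C0_add blinfun.add_left plus_ell2.rep_eq sum.distrib)
qed

lemma has_coeffs_scaleC:
  assumes "has_coeffs a F"
  shows "has_coeffs (c *\<^sub>C a) (\<lambda>n x. c * F n x)"
proof -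
  have C: "F n \<in> C0" for n using assms by (auto simp: has_coeffs_def)
  have "\<rho> ((\<lambda>x. c * F n x) \<circ> \<phi> k) = c *\<^sub>C \<rho> (F n \<circ> \<phi> k)" for n k
    using rho_scale[OF C0_phi[OF C]] by (simp add: comp_def)
  then show ?thesis
    using assms unfolding has_coeffs_def
    by (auto simp: C0_scale scaleC_blinfun.rep_eq scaleC_ell2.rep_eq cvec.scale_sum_right)
qed

lemma has_coeffs_diff:
  assumes "has_coeffs a F" "has_coeffs b G"
  shows "has_coeffs (a - b) (\<lambda>n x. F n x - G n x)"
  using has_coeffs_add[OF assms(1) has_coeffs_scaleC[OF assms(2), of "- 1"]] by simp

lemma has_coeffs_unique:
  assumes "has_coeffs a F" "has_coeffs a G"
  shows "F = G"
proof (intro ext)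
  fix n x
  show "F n x = G n x"
    using has_coeffs_bound[OF has_coeffs_diff[OF assms], of n x] by simp
qed

lemma has_coeffs_monomial:
  assumes f: "f \<in> C0"
  shows "has_coeffs (U n f) (\<lambda>m x. if m = n then f x else 0)"
  unfolding has_coeffs_def
proof (intro conjI allI)
  show "(\<lambda>x. if m = n then f x else 0) \<in> C0" for m
    using f by (cases "m = n") (simp_all add: C0_zero)
  fix v :: "(nat ^ 'd, 'h) ell2" and S
  have iff: "T \<le> S \<and> S - T = n \<longleftrightarrow> n \<le> S \<and> T = S - n" for T
  proof -
    have "(T $ i \<le> S $ i \<and> S $ i - T $ i = n $ i) \<longleftrightarrow> (n $ i \<le> S $ i \<and> T $ i = S $ i - n $ i)" for i
      by auto
    then show ?thesis
      unfolding less_eq_vec_def vec_eq_iff vector_minus_component by metis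
  qed
  have "(\<Sum>T | T \<le> S. \<rho> ((\<lambda>x. if S - T = n then f x else 0) \<circ> \<phi> T) (Rep_ell2 v T))
      = (\<Sum>T | T \<le> S. if T = S - n then (if n \<le> S then \<rho> (f \<circ> \<phi> T) (Rep_ell2 v T) else 0) else 0)"
  proof (rule sum.cong)
    fix T assume "T \<in> {T. T \<le> S}"
    then show "\<rho> ((\<lambda>x. if S - T = n then f x else 0) \<circ> \<phi> T) (Rep_ell2 v T)
        = (if T = S - n then (if n \<le> S then \<rho> (f \<circ> \<phi> T) (Rep_ell2 v T) else 0) else 0)"
      using iff[of T] by (cases "S - T = n") (auto simp: comp_def rho_zero)
  qed simp
  also have "\<dots> = (if n \<le> S then \<rho> (f \<circ> \<phi> (S - n)) (Rep_ell2 v (S - n)) else 0)"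
    by (subst sum.delta[OF finite_vec_le]) (auto simp: less_eq_vec_def)
  finally show "Rep_ell2 (U n f v) S
      = (\<Sum>T | T \<le> S. \<rho> ((\<lambda>x. if S - T = n then f x else 0) \<circ> \<phi> T) (Rep_ell2 v T))"
    by (simp add: Rep_monomial[OF dyn rep f])
qed

text \<open>Multiplication of lower triangular matrices. After the intermediate index is shifted by
  the column index \<open>R\<close>, the rule
  \<open>\<phi> (T + R) = \<phi> T \<circ> \<phi> R\<close> lets \<open>\<phi> R\<close> be pulled
  out of the whole sum, so the product is again given by coefficients.\<close>

lemma has_coeffs_compose:
  assumes F: "has_coeffs a F" and G: "has_coeffs b G"
  shows "has_coeffs (a o\<^sub>L b) (\<lambda>S x. \<Sum>T | T \<le> S. F (S - T) (\<phi> T x) * G T x)"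
proof -
  have FC: "F n \<in> C0" and GC: "G n \<in> C0" for n using assms by (auto simp: has_coeffs_def)
  have HC: "(\<lambda>x. F n (\<phi> k x) * G m x) \<in> C0" for n k m
    by (intro C0_mult C0_phi' FC GC)
  show ?thesis
    unfolding has_coeffs_def
  proof (intro conjI allI)
    show "(\<lambda>x. \<Sum>T | T \<le> S. F (S - T) (\<phi> T x) * G T x) \<in> C0" for S
      by (intro C0_sum HC)
    fix v S
    have "Rep_ell2 ((a o\<^sub>L b) v) S
        = (\<Sum>T | T \<le> S. \<rho> (F (S - T) \<circ> \<phi> T) (\<Sum>R | R \<le> T. \<rho> (G (T - R) \<circ> \<phi> R) (Rep_ell2 v R)))"
      using assms by (simp add: has_coeffs_def)
    also have "\<dots> = (\<Sum>T | T \<le> S. \<Sum>R | R \<in> {R. R \<le> S} \<and> R \<le> T.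
        \<rho> (F (S - T) \<circ> \<phi> T) (\<rho> (G (T - R) \<circ> \<phi> R) (Rep_ell2 v R)))"
      by (intro sum.cong refl) (auto simp: blinfun.sum_right intro!: sum.cong)
    also have "\<dots> = (\<Sum>R | R \<le> S. \<Sum>T | T \<in> {T. T \<le> S} \<and> R \<le> T.
        \<rho> (F (S - T) \<circ> \<phi> T) (\<rho> (G (T - R) \<circ> \<phi> R) (Rep_ell2 v R)))"
      by (rule sum.swap_restrict) (rule finite_vec_le)+
    also have "\<dots> = (\<Sum>R | R \<le> S.
        \<rho> ((\<lambda>x. \<Sum>T | T \<le> S - R. F (S - R - T) (\<phi> T x) * G T x) \<circ> \<phi> R) (Rep_ell2 v R))"
    proof (rule sum.cong)
      fix R assume "R \<in> {R. R \<le> S}"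
      then have R: "R \<le> S" by simp
      have "(\<Sum>T | T \<in> {T. T \<le> S} \<and> R \<le> T.
          \<rho> (F (S - T) \<circ> \<phi> T) (\<rho> (G (T - R) \<circ> \<phi> R) (Rep_ell2 v R)))
          = (\<Sum>T | T \<le> S - R. \<rho> (F (S - (T + R)) \<circ> \<phi> (T + R)) (\<rho> (G (T + R - R) \<circ> \<phi> R) (Rep_ell2 v R)))"
      proof (rule sum.reindex_bij_witness[of _ "\<lambda>T. T + R" "\<lambda>T. T - R"])
        fix T assume T: "T \<in> {T. T \<in> {T. T \<le> S} \<and> R \<le> T}"
        then show "T - R + R = T" by (simp add: vec_diff_add_cancel)
        from T show "T - R \<in> {T. T \<le> S - R}" by (simp add: less_eq_vec_def diff_le_mono)
        from T show "\<rho> (F (S - (T - R + R)) \<circ> \<phi> (T - R + R)) (\<rho> (G (T - R + R - R) \<circ> \<phi> R) (Rep_ell2 v R))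
            = \<rho> (F (S - T) \<circ> \<phi> T) (\<rho> (G (T - R) \<circ> \<phi> R) (Rep_ell2 v R))"
          by (simp add: vec_diff_add_cancel)
      next
        fix T assume T: "T \<in> {T. T \<le> S - R}"
        show "T + R - R = T" by simp
        from T R show "T + R \<in> {T. T \<in> {T. T \<le> S} \<and> R \<le> T}"
          unfolding less_eq_vec_def by (simp add: Nat.le_diff_conv2)
      qed
      also have "\<dots> = (\<Sum>T | T \<le> S - R. \<rho> (\<lambda>x. F (S - R - T) (\<phi> T (\<phi> R x)) * G T (\<phi> R x)) (Rep_ell2 v R))"
      proof (intro sum.cong refl)
        fix T
        have "S - (T + R) = S - R - T" by (simp add: diff_diff_add add.commute)
        moreover have "\<rho> (\<lambda>x. F (S - R - T) (\<phi> T (\<phi> R x)) * G T (\<phi> R x))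
            = \<rho> (\<lambda>x. F (S - R - T) (\<phi> T (\<phi> R x))) o\<^sub>L \<rho> (\<lambda>x. G T (\<phi> R x))"
          by (rule rho_mult) (intro C0_phi' FC GC)+
        ultimately show "\<rho> (F (S - (T + R)) \<circ> \<phi> (T + R)) (\<rho> (G (T + R - R) \<circ> \<phi> R) (Rep_ell2 v R))
            = \<rho> (\<lambda>x. F (S - R - T) (\<phi> T (\<phi> R x)) * G T (\<phi> R x)) (Rep_ell2 v R)"
          by (simp add: comp_def phi_add)
      qed
      also have "\<dots> = \<rho> ((\<lambda>x. \<Sum>T | T \<le> S - R. F (S - R - T) (\<phi> T x) * G T x) \<circ> \<phi> R) (Rep_ell2 v R)"
        using rho_sum[of "{T. T \<le> S - R}" "\<lambda>T x. F (S - R - T) (\<phi> T (\<phi> R x)) * G T (\<phi> R x)"]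
        by (simp add: comp_def C0_phi'[OF HC] blinfun.sum_left)
      finally show "(\<Sum>T | T \<in> {T. T \<le> S} \<and> R \<le> T.
          \<rho> (F (S - T) \<circ> \<phi> T) (\<rho> (G (T - R) \<circ> \<phi> R) (Rep_ell2 v R)))
          = \<rho> ((\<lambda>x. \<Sum>T | T \<le> S - R. F (S - R - T) (\<phi> T x) * G T x) \<circ> \<phi> R) (Rep_ell2 v R)" .
    qed simp
    finally show "Rep_ell2 ((a o\<^sub>L b) v) S = (\<Sum>R | R \<le> S.
        \<rho> ((\<lambda>x. \<Sum>T | T \<le> S - R. F (S - R - T) (\<phi> T x) * G T x) \<circ> \<phi> R) (Rep_ell2 v R))" .
  qed
qed

text \<open>By \<open>has_coeffs_bound\<close> the coefficients converge uniformly in each degree. A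
  component of an image vector involves only finitely many of them, so the equation defining
  \<open>has_coeffs\<close> passes to the limit.\<close>

lemma has_coeffs_limit:
  assumes a: "\<And>k. has_coeffs (a k) (F k)" and lim: "a \<longlonglongrightarrow> b"
  shows "\<exists>G. has_coeffs b G"
proof -
  have FC: "F k n \<in> C0" for k n using a by (simp add: has_coeffs_def)
  have bd: "cmod (F k n x - F l n x) \<le> norm (a k - a l)" for k l n x
    by (rule has_coeffs_bound[OF has_coeffs_diff[OF a a]])
  have "uniformly_convergent_on UNIV (\<lambda>k. F k n)" for n
  proof (rule Cauchy_uniformly_convergent, unfold uniformly_Cauchy_on_def, intro allI impI)
    fix e :: real assume "e > 0"
    then obtain M where M: "\<And>k l. k \<ge> M \<Longrightarrow> l \<ge> M \<Longrightarrow> norm (a k - a l) < e"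
      using LIMSEQ_imp_Cauchy[OF lim] unfolding Cauchy_def dist_norm by blast
    show "\<exists>M. \<forall>x\<in>UNIV. \<forall>k\<ge>M. \<forall>l\<ge>M. dist (F k n x) (F l n x) < e"
      using M bd unfolding dist_norm by (meson order_le_less_trans)
  qed
  then have "\<exists>g. uniform_limit UNIV (\<lambda>k. F k n) g sequentially" for n
    by (simp add: uniformly_convergent_on_def)
  then obtain G where G: "\<And>n. uniform_limit UNIV (\<lambda>k. F k n) (G n) sequentially" by metis
  have GC: "G n \<in> C0" for n by (rule C0_uniform_limit[OF FC G])
  have conv: "(\<lambda>k. \<rho> (F k n \<circ> \<phi> m) w) \<longlonglongrightarrow> \<rho> (G n \<circ> \<phi> m) w" for n m w
  proof (rule LIMSEQ_I)
    fix r :: real assume "r > 0"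
    define e where "e = r / (norm w + 1)"
    have e: "e > 0" using \<open>r > 0\<close> by (simp add: e_def add_nonneg_pos)
    have "\<forall>\<^sub>F k in sequentially. \<forall>x\<in>UNIV. dist (F k n x) (G n x) < e"
      by (rule uniform_limitD[OF G e])
    then obtain N where N: "\<And>k x. k \<ge> N \<Longrightarrow> dist (F k n x) (G n x) < e"
      unfolding eventually_sequentially by blast
    have "norm (\<rho> (F k n \<circ> \<phi> m) w - \<rho> (G n \<circ> \<phi> m) w) < r" if "k \<ge> N" for k
    proof -
      have "\<rho> (F k n \<circ> \<phi> m) w - \<rho> (G n \<circ> \<phi> m) w = \<rho> (\<lambda>x. F k n (\<phi> m x) - G n (\<phi> m x)) w"
        using rho_diff[OF C0_phi[OF FC] C0_phi[OF GC]] by (simp add: comp_def blinfun.diff_left)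
      moreover have "norm (\<rho> (\<lambda>x. F k n (\<phi> m x) - G n (\<phi> m x)) w) \<le> e * norm w"
        using N[OF that] e
        by (intro faithful_star_rep_bound[OF rep] C0_diff C0_phi' FC GC) (auto simp: dist_norm less_imp_le)
      moreover have "e * norm w < r"
        using \<open>r > 0\<close> mult_strict_left_mono[of "norm w / (norm w + 1)" 1 r]
        by (simp add: e_def add_nonneg_pos)
      ultimately show ?thesis by simp
    qed
    then show "\<exists>N. \<forall>k\<ge>N. norm (\<rho> (F k n \<circ> \<phi> m) w - \<rho> (G n \<circ> \<phi> m) w) < r" by blast
  qed
  have "Rep_ell2 (b v) S = (\<Sum>T | T \<le> S. \<rho> (G (S - T) \<circ> \<phi> T) (Rep_ell2 v T))" for v S
  proof (rule LIMSEQ_unique)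
    show "(\<lambda>k. \<Sum>T | T \<le> S. \<rho> (F k (S - T) \<circ> \<phi> T) (Rep_ell2 v T))
        \<longlonglongrightarrow> (\<Sum>T | T \<le> S. \<rho> (G (S - T) \<circ> \<phi> T) (Rep_ell2 v T))"
      by (intro tendsto_sum conv)
    have "(\<lambda>k. a k v) \<longlonglongrightarrow> b v" by (intro tendsto_intros lim)
    then have "(\<lambda>k. norm (a k v - b v)) \<longlonglongrightarrow> 0" by (simp add: tendsto_norm_zero_iff LIM_zero)
    then have "(\<lambda>k. Rep_ell2 (a k v) S - Rep_ell2 (b v) S) \<longlonglongrightarrow> 0"
      by (rule Lim_null_comparison[rotated])
        (use norm_Rep_ell2_le[of "a _ v - b v" S] in \<open>simp add: minus_ell2.rep_eq\<close>)
    then have "(\<lambda>k. Rep_ell2 (a k v) S) \<longlonglongrightarrow> Rep_ell2 (b v) S" by (rule LIM_zero_cancel)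
    then show "(\<lambda>k. \<Sum>T | T \<le> S. \<rho> (F k (S - T) \<circ> \<phi> T) (Rep_ell2 v T)) \<longlonglongrightarrow> Rep_ell2 (b v) S"
      using a by (simp add: has_coeffs_def)
  qed
  then have "has_coeffs b G" using GC by (simp add: has_coeffs_def)
  then show ?thesis by blast
qed

end


section \<open>The crossed product as an algebra of formal series\<close>

lemma sup_norm_nonneg: "f \<in> C0 \<Longrightarrow> 0 \<le> sup_norm f"
  using order_trans[OF norm_ge_zero cmod_le_sup_norm] .

lemma sup_norm_leI: "(\<And>x. cmod (f x) \<le> c) \<Longrightarrow> sup_norm f \<le> c"
  unfolding sup_norm_def by (rule cSUP_least) auto

lemma l1_C0_add:
  assumes "F \<in> l1_C0" "G \<in> l1_C0"
  shows "(\<lambda>n x. F n x + G n x) \<in> l1_C0"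
proof -
  have C: "F n \<in> C0" "G n \<in> C0" for n using assms by (auto simp: l1_C0_def)
  have C': "(\<lambda>x. F n x + G n x) \<in> C0" for n by (intro C0_add C)
  have "(\<lambda>n. sup_norm (F n) + sup_norm (G n)) summable_on UNIV"
    using assms by (intro summable_on_add) (auto simp: l1_C0_def)
  then have "(\<lambda>n. sup_norm (\<lambda>x. F n x + G n x)) summable_on UNIV"
  proof (rule summable_on_comparison_test)
    show "sup_norm (\<lambda>x. F n x + G n x) \<le> sup_norm (F n) + sup_norm (G n)" for n
      by (rule sup_norm_leI) (use norm_triangle_ineq add_mono cmod_le_sup_norm C order_trans in metis)
  qed (rule sup_norm_nonneg[OF C'])
  then show ?thesis using C' by (simp add: l1_C0_def)
qed

lemma l1_C0_scale:
  assumes "F \<in> l1_C0"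
  shows "(\<lambda>n x. c * F n x) \<in> l1_C0"
proof -
  have C: "F n \<in> C0" for n using assms by (auto simp: l1_C0_def)
  have C': "(\<lambda>x. c * F n x) \<in> C0" for n by (intro C0_scale C)
  have "(\<lambda>n. cmod c * sup_norm (F n)) summable_on UNIV"
    using assms by (intro summable_on_cmult_right) (auto simp: l1_C0_def)
  then have "(\<lambda>n. sup_norm (\<lambda>x. c * F n x)) summable_on UNIV"
  proof (rule summable_on_comparison_test)
    show "sup_norm (\<lambda>x. c * F n x) \<le> cmod c * sup_norm (F n)" for n
      by (rule sup_norm_leI) (simp add: norm_mult mult_left_mono cmod_le_sup_norm C)
  qed (rule sup_norm_nonneg[OF C'])
  then show ?thesis using C' by (simp add: l1_C0_def)
qed

context analytic_crossed_product
begin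

abbreviation A where "A \<equiv> crossed_product \<phi> \<rho>"

lemma has_coeffs_eqI: "has_coeffs a F \<Longrightarrow> has_coeffs b F \<Longrightarrow> a = b"
  by (intro blinfun_eqI Rep_ell2_inject[THEN iffD1] ext) (simp add: has_coeffs_def)

lemma has_coeffs_zero: "has_coeffs 0 (\<lambda>_ _. 0)"
  by (simp add: has_coeffs_def C0_zero comp_def rho_zero zero_ell2.rep_eq)

lemma monomial_add:
  assumes "f \<in> C0" "g \<in> C0"
  shows "U n (\<lambda>x. f x + g x) = U n f + U n g"
proof (rule has_coeffs_eqI)
  show "has_coeffs (U n (\<lambda>x. f x + g x)) (\<lambda>m x. if m = n then f x + g x else 0)"
    by (intro has_coeffs_monomial C0_add assms)
  have eq: "(\<lambda>m x. (if m = n then f x else 0) + (if m = n then g x else 0))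
      = (\<lambda>m x. if m = n then f x + g x else 0)"
    by (auto simp: fun_eq_iff)
  show "has_coeffs (U n f + U n g) (\<lambda>m x. if m = n then f x + g x else 0)"
    using has_coeffs_add[OF has_coeffs_monomial[OF assms(1), of n] has_coeffs_monomial[OF assms(2), of n]]
    unfolding eq .
qed

lemma monomial_scale:
  assumes "f \<in> C0"
  shows "U n (\<lambda>x. c * f x) = c *\<^sub>C U n f"
proof (rule has_coeffs_eqI)
  show "has_coeffs (U n (\<lambda>x. c * f x)) (\<lambda>m x. if m = n then c * f x else 0)"
    by (intro has_coeffs_monomial C0_scale assms)
  have eq: "(\<lambda>m x. c * (if m = n then f x else 0)) = (\<lambda>m x. if m = n then c * f x else 0)"
    by (auto simp: fun_eq_iff)
  show "has_coeffs (c *\<^sub>C U n f) (\<lambda>m x. if m = n then c * f x else 0)"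
    using has_coeffs_scaleC[OF has_coeffs_monomial[OF assms, of n], of c] unfolding eq .
qed

lemma monomial_diff:
  assumes "f \<in> C0" "g \<in> C0"
  shows "U n (\<lambda>x. f x - g x) = U n f - U n g"
  using monomial_add[OF assms(1) C0_scale[OF assms(2), of "- 1"]] monomial_scale[OF assms(2), of _ "- 1"]
  by simp

lemma monomial_zero: "U n (\<lambda>_. 0) = 0"
  using monomial_scale[OF C0_zero, of n 0] by simp

lemma monomial_compose:
  assumes "f \<in> C0" "g \<in> C0"
  shows "U n f o\<^sub>L U m g = U (n + m) (\<lambda>x. f (\<phi> m x) * g x)"
proof (rule has_coeffs_eqI)
  show "has_coeffs (U (n + m) (\<lambda>x. f (\<phi> m x) * g x)) (\<lambda>S x. if S = n + m then f (\<phi> m x) * g x else 0)"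
    by (intro has_coeffs_monomial C0_mult C0_phi' assms)
  have iff: "m \<le> S \<and> S - m = n \<longleftrightarrow> S = n + m" for S
    using vec_diff_add_cancel[of m S] vec_le_add[of m n] by auto
  have "(\<Sum>T | T \<le> S. (if S - T = n then f (\<phi> T x) else 0) * (if T = m then g x else 0))
      = (if S = n + m then f (\<phi> m x) * g x else 0)" for S x
  proof -
    have "(\<Sum>T | T \<le> S. (if S - T = n then f (\<phi> T x) else 0) * (if T = m then g x else 0))
        = (\<Sum>T | T \<le> S. if T = m then (if S - m = n then f (\<phi> m x) * g x else 0) else 0)"
      by (intro sum.cong) auto
    also have "\<dots> = (if S = n + m then f (\<phi> m x) * g x else 0)"
      using iff[of S] by (subst sum.delta[OF finite_vec_le]) auto
    finally show ?thesis .
  qed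
  then show "has_coeffs (U n f o\<^sub>L U m g) (\<lambda>S x. if S = n + m then f (\<phi> m x) * g x else 0)"
    using has_coeffs_compose[OF has_coeffs_monomial[OF assms(1), of n] has_coeffs_monomial[OF assms(2), of m]]
    by simp
qed

lemma l1_rep_has_sum:
  assumes "F \<in> l1_C0"
  shows "((\<lambda>n. U n (F n)) has_sum l1_rep \<phi> \<rho> F) UNIV"
  unfolding l1_rep_def by (intro has_sum_infsum monomials_summable[OF dyn rep assms])

lemma monomial_mem: "f \<in> C0 \<Longrightarrow> U n f \<in> A"
proof -
  assume f: "f \<in> C0"
  define F where "F m = (if m = n then f else (\<lambda>_. 0))" for m
  have FC: "F m \<in> C0" for m using f by (simp add: F_def C0_zero)
  have "(\<lambda>m. sup_norm (F m)) summable_on UNIV"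
  proof (rule finite_nonzero_values_imp_summable_on, rule finite_subset)
    show "{m \<in> UNIV. sup_norm (F m) \<noteq> 0} \<subseteq> {n}" by (auto simp: F_def sup_norm_def)
  qed simp
  then have F: "F \<in> l1_C0" using FC by (simp add: l1_C0_def)
  have "((\<lambda>m. U m (F m)) has_sum U n f) UNIV"
    by (rule has_sum_finite_neutralI[of "{n}"]) (auto simp: F_def monomial_zero)
  then have "l1_rep \<phi> \<rho> F = U n f" by (rule has_sum_unique[OF l1_rep_has_sum[OF F]])
  then have "U n f \<in> l1_rep \<phi> \<rho> ` l1_C0" by (rule image_eqI[OF sym F])
  then show ?thesis
    unfolding crossed_product_def by (rule subsetD[OF closure_subset])
qed

lemma subspace_A: "cvec.subspace A"
  unfolding crossed_product_def
proof (rule subspace_closure, rule cvec.subspaceI)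
  show "0 \<in> l1_rep \<phi> \<rho> ` l1_C0"
    unfolding image_iff
    by (rule bexI[of _ "\<lambda>_ _. 0"]) (simp_all add: l1_rep_def monomial_zero l1_C0_def C0_zero sup_norm_def)
  show "a + b \<in> l1_rep \<phi> \<rho> ` l1_C0" if ab: "a \<in> l1_rep \<phi> \<rho> ` l1_C0" "b \<in> l1_rep \<phi> \<rho> ` l1_C0" for a b
  proof -
    obtain F G where FG: "F \<in> l1_C0" "G \<in> l1_C0" "a = l1_rep \<phi> \<rho> F" "b = l1_rep \<phi> \<rho> G"
      using ab by blast
    have "((\<lambda>n. U n (F n) + U n (G n)) has_sum a + b) UNIV"
      unfolding FG(3,4) by (intro has_sum_add l1_rep_has_sum FG)
    then have "((\<lambda>n. U n (\<lambda>x. F n x + G n x)) has_sum a + b) UNIV"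
      using FG(1,2) by (simp add: monomial_add l1_C0_def)
    then have "l1_rep \<phi> \<rho> (\<lambda>n x. F n x + G n x) = a + b"
      by (rule has_sum_unique[OF l1_rep_has_sum[OF l1_C0_add[OF FG(1,2)]]])
    then show ?thesis by (rule image_eqI[OF sym l1_C0_add[OF FG(1,2)]])
  qed
  show "c *\<^sub>C a \<in> l1_rep \<phi> \<rho> ` l1_C0" if a: "a \<in> l1_rep \<phi> \<rho> ` l1_C0" for a c
  proof -
    obtain F where F: "F \<in> l1_C0" "a = l1_rep \<phi> \<rho> F" using a by blast
    have "((\<lambda>n. c *\<^sub>C U n (F n)) has_sum c *\<^sub>C a) UNIV"
      unfolding F(2) by (intro has_sum_bounded_linear[OF bounded_linear_scaleC] l1_rep_has_sum F)
    then have "((\<lambda>n. U n (\<lambda>x. c * F n x)) has_sum c *\<^sub>C a) UNIV"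
      using F(1) by (simp add: monomial_scale l1_C0_def)
    then have "l1_rep \<phi> \<rho> (\<lambda>n x. c * F n x) = c *\<^sub>C a"
      by (rule has_sum_unique[OF l1_rep_has_sum[OF l1_C0_scale[OF F(1)]]])
    then show ?thesis by (rule image_eqI[OF sym l1_C0_scale[OF F(1)]])
  qed
qed

lemma closed_A: "closed A"
  by (simp add: crossed_product_def)

text \<open>Elements of the crossed product are limits of finite sums of monomials; later extensions
  from monomials to \<open>A\<close> go through this density principle.\<close>

lemma A_subsetI:
  assumes "closed S" "cvec.subspace S" "\<And>n f. f \<in> C0 \<Longrightarrow> U n f \<in> S"
  shows "A \<subseteq> S"
  unfolding crossed_product_def
proof (rule closure_minimal[OF _ assms(1)], rule image_subsetI)
  fix F :: "nat ^ 'd \<Rightarrow> 'x \<Rightarrow> complex" assume F: "F \<in> l1_C0"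
  have "((\<lambda>I. \<Sum>n\<in>I. U n (F n)) \<longlongrightarrow> l1_rep \<phi> \<rho> F) (finite_subsets_at_top UNIV)"
    using l1_rep_has_sum[OF F] by (simp add: has_sum_def)
  moreover have "(\<Sum>n\<in>I. U n (F n)) \<in> S" for I
    by (rule cvec.subspace_sum[OF assms(2)]) (use F assms(3) in \<open>simp add: l1_C0_def\<close>)
  ultimately show "l1_rep \<phi> \<rho> F \<in> S"
    by (intro Lim_in_closed_set[OF assms(1) _ finite_subsets_at_top_neq_bot]) simp_all
qed

text \<open>Only products of two monomials are computed. Density is used for the right factor with a
  monomial on the left, then for the left factor, so the multiplication of \<open>l1_C0\<close> need
  not be constructed.\<close>

lemma A_compose_mem:
  assumes "a \<in> A" "b \<in> A"
  shows "a o\<^sub>L b \<in> A"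
proof -
  have closed: "closed (f -` A)" if "bounded_linear f" for f :: "((nat ^ 'd, 'h) ell2 \<Rightarrow>\<^sub>L (nat ^ 'd, 'h) ell2) \<Rightarrow> _"
    using closed_A linear_continuous_on[OF that] by (intro closed_vimage) (auto simp: continuous_on_eq_continuous_at)
  have 1: "U n f o\<^sub>L b \<in> A" if b: "b \<in> A" and f: "f \<in> C0" for n f b
  proof -
    have lin: "U n f o\<^sub>L (c *\<^sub>C x) = c *\<^sub>C (U n f o\<^sub>L x)" for c x
      by (rule blinfun_eqI)
        (use complex_linear_monomial[OF dyn rep f, of n] in \<open>simp add: complex_linear_def scaleC_blinfun.rep_eq\<close>)
    have "A \<subseteq> {b. U n f o\<^sub>L b \<in> A}"
    proof (rule A_subsetI)
      show "closed {b. U n f o\<^sub>L b \<in> A}" using closed[OF comp.bounded_linear_right] by (simp add: vimage_def)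
      show "cvec.subspace {b. U n f o\<^sub>L b \<in> A}"
        by (rule cvec.subspaceI) (simp_all add: comp.zero_right comp.add_right lin
            cvec.subspace_0[OF subspace_A] cvec.subspace_add[OF subspace_A] cvec.subspace_scale[OF subspace_A])
      show "U m g \<in> {b. U n f o\<^sub>L b \<in> A}" if "g \<in> C0" for m g
        by (simp add: monomial_compose[OF f that] monomial_mem C0_mult C0_phi' f that)
    qed
    then show ?thesis using b by blast
  qed
  have "A \<subseteq> {a. a o\<^sub>L b \<in> A}"
  proof (rule A_subsetI)
    show "closed {a. a o\<^sub>L b \<in> A}" using closed[OF comp.bounded_linear_left] by (simp add: vimage_def)
    show "cvec.subspace {a. a o\<^sub>L b \<in> A}"
      by (rule cvec.subspaceI) (simp_all add: comp.zero_left comp.add_left scaleC_compose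
          cvec.subspace_0[OF subspace_A] cvec.subspace_add[OF subspace_A] cvec.subspace_scale[OF subspace_A])
  qed (simp add: 1 assms(2))
  then show ?thesis using assms(1) by blast
qed

lemma A_complex_linear:
  assumes "a \<in> A"
  shows "a (c *\<^sub>C v) = c *\<^sub>C a v"
proof -
  have "A \<subseteq> {a. blinfun_apply a (c *\<^sub>C v) = c *\<^sub>C a v}"
  proof (rule A_subsetI)
    show "closed {a :: (nat ^ 'd, 'h) ell2 \<Rightarrow>\<^sub>L (nat ^ 'd, 'h) ell2. a (c *\<^sub>C v) = c *\<^sub>C a v}"
      by (intro closed_Collect_eq continuous_intros
          bounded_linear.continuous_on[OF bounded_linear_scaleC])
    show "cvec.subspace {a :: (nat ^ 'd, 'h) ell2 \<Rightarrow>\<^sub>L (nat ^ 'd, 'h) ell2. a (c *\<^sub>C v) = c *\<^sub>C a v}"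
      by (rule cvec.subspaceI)
        (simp_all add: blinfun.add_left scaleC_add_right scaleC_blinfun.rep_eq cvec.scale_left_commute)
    show "U n f \<in> {a. blinfun_apply a (c *\<^sub>C v) = c *\<^sub>C a v}" if "f \<in> C0" for n f
      using complex_linear_monomial[OF dyn rep that] by (simp add: complex_linear_def)
  qed
  then show ?thesis using assms by blast
qed

sublocale operator_algebra A
proof
  show "a o\<^sub>L (c *\<^sub>C b) = c *\<^sub>C (a o\<^sub>L b)" if "a \<in> A" for a b c
    by (rule blinfun_eqI) (simp add: scaleC_blinfun.rep_eq A_complex_linear[OF that])
qed (fact subspace_A A_compose_mem)+

definition coeff :: "((nat ^ 'd, 'h) ell2 \<Rightarrow>\<^sub>L (nat ^ 'd, 'h) ell2) \<Rightarrow> nat ^ 'd \<Rightarrow> 'x \<Rightarrow> complex" where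
  "coeff a = (THE F. has_coeffs a F)"

lemma coeff_eqI: "has_coeffs a F \<Longrightarrow> coeff a = F"
  unfolding coeff_def by (rule the_equality, assumption, rule has_coeffs_unique)

lemma has_coeffs_coeff:
  assumes "a \<in> A"
  shows "has_coeffs a (coeff a)"
proof -
  have "A \<subseteq> {a. \<exists>F. has_coeffs a F}"
  proof (rule A_subsetI)
    show "closed {a. \<exists>F. has_coeffs a F}"
      unfolding closed_sequential_limits
    proof (intro allI impI, elim conjE, rule CollectI)
      fix a l assume "\<forall>k. a k \<in> {a. \<exists>F. has_coeffs a F}" and l: "a \<longlonglongrightarrow> l"
      then have "\<forall>k. \<exists>F. has_coeffs (a k) F" by simp
      then obtain F where "\<And>k. has_coeffs (a k) (F k)" by metis
      then show "\<exists>F. has_coeffs l F" by (rule has_coeffs_limit[OF _ l])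
    qed
    show "cvec.subspace {a. \<exists>F. has_coeffs a F}"
    proof (rule cvec.subspaceI)
      show "0 \<in> {a. \<exists>F. has_coeffs a F}" using has_coeffs_zero by auto
      show "a + b \<in> {a. \<exists>F. has_coeffs a F}"
        if "a \<in> {a. \<exists>F. has_coeffs a F}" "b \<in> {a. \<exists>F. has_coeffs a F}" for a b
        using that by (auto dest: has_coeffs_add)
      show "c *\<^sub>C a \<in> {a. \<exists>F. has_coeffs a F}" if "a \<in> {a. \<exists>F. has_coeffs a F}" for c a
        using that by (auto dest: has_coeffs_scaleC)
    qed
    show "U n f \<in> {a. \<exists>F. has_coeffs a F}" if "f \<in> C0" for n f
      using has_coeffs_monomial[OF that] by auto
  qed
  then obtain F where "has_coeffs a F" using assms by auto
  then show ?thesis using coeff_eqI by simp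
qed

lemma coeff_C0: "a \<in> A \<Longrightarrow> coeff a n \<in> C0"
  using has_coeffs_coeff by (simp add: has_coeffs_def)

lemma coeff_bound: "a \<in> A \<Longrightarrow> cmod (coeff a n x) \<le> norm a"
  by (rule has_coeffs_bound[OF has_coeffs_coeff])

lemma coeff_monomial: "f \<in> C0 \<Longrightarrow> coeff (U n f) m x = (if m = n then f x else 0)"
  by (simp add: coeff_eqI[OF has_coeffs_monomial])

lemma coeff_zero: "coeff 0 n x = 0"
  by (simp add: coeff_eqI[OF has_coeffs_zero])

lemma coeff_add: "a \<in> A \<Longrightarrow> b \<in> A \<Longrightarrow> coeff (a + b) n x = coeff a n x + coeff b n x"
  by (simp add: coeff_eqI[OF has_coeffs_add[OF has_coeffs_coeff has_coeffs_coeff]])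

lemma coeff_diff: "a \<in> A \<Longrightarrow> b \<in> A \<Longrightarrow> coeff (a - b) n x = coeff a n x - coeff b n x"
  by (simp add: coeff_eqI[OF has_coeffs_diff[OF has_coeffs_coeff has_coeffs_coeff]])

lemma coeff_scaleC: "a \<in> A \<Longrightarrow> coeff (c *\<^sub>C a) n x = c * coeff a n x"
  by (simp add: coeff_eqI[OF has_coeffs_scaleC[OF has_coeffs_coeff]])

lemma coeff_compose: "a \<in> A \<Longrightarrow> b \<in> A \<Longrightarrow>
    coeff (a o\<^sub>L b) S x = (\<Sum>T | T \<le> S. coeff a (S - T) (\<phi> T x) * coeff b T x)"
  by (simp add: coeff_eqI[OF has_coeffs_compose[OF has_coeffs_coeff has_coeffs_coeff]])

lemma norm_monomial_leI:
  assumes "f \<in> C0" "\<And>x. cmod (f x) \<le> c"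
  shows "norm (U n f) \<le> c"
  by (rule order_trans[OF norm_monomial_le[OF dyn rep assms(1)] sup_norm_leI[OF assms(2)]])

end


section \<open>Recurrence\<close>

text \<open>Uniform approximation from an ideal depends only on its common zeros. A finite sum
  \<open>r\<close> of squared moduli of elements of \<open>I\<close> is positive on the compact set
  where the modulus of \<open>f\<close> is at least \<open>e\<close>; then
  \<open>f r / (r + t)\<close> lies in \<open>I\<close> and is close to \<open>f\<close> for small
  \<open>t\<close>.\<close>

lemma C0_ideal_hull:
  fixes f :: "'x::metric_space \<Rightarrow> complex"
  assumes I0: "(\<lambda>_. 0) \<in> I" and Iadd: "\<And>g h. g \<in> I \<Longrightarrow> h \<in> I \<Longrightarrow> (\<lambda>x. g x + h x) \<in> I"
    and Imul: "\<And>g h. g \<in> I \<Longrightarrow> h \<in> C0 \<Longrightarrow> (\<lambda>x. g x * h x) \<in> I"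
    and IC: "I \<subseteq> C0"
    and f: "f \<in> C0" and hull: "\<And>x. f x \<noteq> 0 \<Longrightarrow> \<exists>g\<in>I. g x \<noteq> 0"
    and e: "e > 0"
  shows "\<exists>g\<in>I. \<forall>x. cmod (f x - g x) \<le> e"
proof -
  obtain K0 where K0: "compact K0" "\<And>x. x \<notin> K0 \<Longrightarrow> cmod (f x) < e"
    using f e unfolding C0_def by blast
  define K where "K = K0 \<inter> {x. e \<le> cmod (f x)}"
  have "closed {x. e \<le> cmod (f x)}"
    by (intro closed_Collect_le continuous_intros C0_continuous[OF f])
  then have K: "compact K" unfolding K_def using K0(1) by (rule compact_Int_closed[rotated])
  have nK: "cmod (f x) < e" if "x \<notin> K" for x
    using that K0(2)[of x] by (auto simp: K_def)
  have "K \<subseteq> (\<Union>g\<in>I. {x. g x \<noteq> 0})"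
  proof
    fix x assume "x \<in> K"
    then have "f x \<noteq> 0" using e by (auto simp: K_def)
    then show "x \<in> (\<Union>g\<in>I. {x. g x \<noteq> 0})" using hull by blast
  qed
  moreover have "open {x. g x \<noteq> 0}" if "g \<in> I" for g
    using that IC by (intro open_Collect_neq continuous_intros C0_continuous) auto
  ultimately obtain D where D: "D \<subseteq> I" "finite D" "K \<subseteq> (\<Union>g\<in>D. {x. g x \<noteq> 0})"
    using compactE_image[OF K, of I "\<lambda>g. {x. g x \<noteq> 0}"] by metis
  define r where "r x = (\<Sum>g\<in>D. (cmod (g x))\<^sup>2)" for x
  have r0: "r x \<ge> 0" for x by (simp add: r_def sum_nonneg)
  have rc: "continuous_on S r" for S
    unfolding r_def using D(1) IC
    by (intro continuous_intros continuous_on_subset[OF C0_continuous]) auto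
  have "(\<lambda>x. \<Sum>g\<in>E. g x * cnj (g x)) \<in> I" if "finite E" "E \<subseteq> I" for E
    using that
  proof (induction E rule: finite_induct)
    case (insert g E)
    then have "(\<lambda>x. g x * cnj (g x) + (\<Sum>g\<in>E. g x * cnj (g x))) \<in> I"
      using IC by (intro Iadd Imul C0_cnj) auto
    with insert(1,2) show ?case by simp
  qed (simp add: I0)
  then have rI: "(\<lambda>x. complex_of_real (r x)) \<in> I"
    using D(1,2) by (simp add: r_def complex_norm_square del: of_real_power)
  obtain \<eta> where \<eta>: "\<eta> > 0" "\<And>x. x \<in> K \<Longrightarrow> \<eta> \<le> r x"
  proof (cases "K = {}")
    case False
    obtain x0 where x0: "x0 \<in> K" "\<And>x. x \<in> K \<Longrightarrow> r x0 \<le> r x"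
      using continuous_attains_inf[OF K False rc] by blast
    obtain g where g: "g \<in> D" "g x0 \<noteq> 0" using D(3) x0(1) by blast
    have "(cmod (g x0))\<^sup>2 \<le> r x0"
      unfolding r_def by (rule member_le_sum[OF g(1)]) (use D(2) in auto)
    then have "r x0 > 0" using g(2) by (smt (verit) zero_less_norm_iff zero_less_power)
    then show ?thesis using that x0(2) by blast
  qed (use that[of 1] in auto)
  \<comment> \<open>The error is the modulus of \<open>f\<close> times \<open>t / (r + t)\<close>.
    On \<open>K\<close>, where \<open>\<eta> \<le> r\<close>, this choice makes it at most
    \<open>e\<close>; off \<open>K\<close> the modulus of \<open>f\<close> is already below
    \<open>e\<close>. Adding 1 keeps the denominator positive when \<open>f\<close> is zero.\<close>
  define t where "t = e * \<eta> / (sup_norm f + 1)"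
  have s: "sup_norm f \<ge> 0" using order_trans[OF norm_ge_zero cmod_le_sup_norm[OF f]] .
  have t: "t > 0" using e \<eta>(1) s by (simp add: t_def)
  define l where "l x = f x / complex_of_real (r x + t)" for x
  have rt: "r x + t > 0" for x using r0[of x] t by simp
  have "l \<in> C0"
  proof (rule C0_norm_leI[OF f, of _ "1 / t"])
    show "continuous_on UNIV l"
      unfolding l_def using rt by (intro continuous_intros C0_continuous[OF f] rc) (metis of_real_eq_0_iff order_less_irrefl)
    have "cmod (f x) / (r x + t) \<le> cmod (f x) / t" for x
      using r0[of x] t by (intro divide_left_mono) (auto intro: add_nonneg_pos)
    then show "cmod (l x) \<le> 1 / t * cmod (f x)" for x
      using rt[of x] by (simp add: l_def norm_divide del: of_real_add)
  qed
  then have "(\<lambda>x. complex_of_real (r x) * l x) \<in> I" by (rule Imul[OF rI])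
  moreover have "cmod (f x - complex_of_real (r x) * l x) \<le> e" for x
  proof -
    have "f x - complex_of_real (r x) * l x = f x * complex_of_real (t / (r x + t))"
      using rt[of x] unfolding l_def of_real_divide
      by (simp add: divide_simps del: of_real_add) (simp add: algebra_simps)
    then have eq: "cmod (f x - complex_of_real (r x) * l x) = cmod (f x) * (t / (r x + t))"
      using rt[of x] t by (simp add: norm_mult del: of_real_divide of_real_add)
    show ?thesis
    proof (cases "x \<in> K")
      case True
      have "cmod (f x) * (t / (r x + t)) \<le> (sup_norm f + 1) * (t / \<eta>)"
        using cmod_le_sup_norm[OF f, of x] \<eta>(1) \<eta>(2)[OF True] t s
        by (intro mult_mono divide_left_mono) auto
      also have "\<dots> = e" using \<eta>(1) s by (simp add: t_def)
      finally show ?thesis by (simp add: eq)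
    next
      case False
      have "t / (r x + t) \<le> 1" using r0[of x] t by simp
      then have "cmod (f x) * (t / (r x + t)) \<le> cmod (f x)"
        by (intro mult_left_le) auto
      then show ?thesis using nK[OF False] by (simp add: eq)
    qed
  qed
  ultimately show ?thesis by (intro bexI[of _ "\<lambda>x. complex_of_real (r x) * l x"]) auto
qed

section \<open>Return times, density of recurrent points, and semiprime ideals\<close>

context analytic_crossed_product
begin

lemma phi_near:
  assumes "e > 0"
  obtains d where "d > 0" "\<And>y. dist y x < d \<Longrightarrow> dist (\<phi> p y) (\<phi> p x) < e"
  using phi_continuous[of p] assms unfolding continuous_on_iff by blast

text \<open>
  Near \<open>x\<close> one may return first at time \<open>q\<close> and then at time \<open>p\<close>, so return times can be added and
  nonzero coordinates can be made arbitrarily large.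
\<close>

lemma return_times_unbounded:
  assumes ret: "\<And>e. e > 0 \<Longrightarrow> \<exists>p. (\<forall>j\<in>J. p $ j \<noteq> 0) \<and> (\<forall>j\<in>Z. p $ j = 0) \<and> dist (\<phi> p x) x < e"
    and "e > 0"
  shows "\<exists>p. (\<forall>j\<in>J. M < p $ j) \<and> (\<forall>j\<in>Z. p $ j = 0) \<and> dist (\<phi> p x) x < e"
  using \<open>e > 0\<close>
proof (induction M arbitrary: e)
  case 0
  then show ?case using ret[of e] by auto
next
  case (Suc M)
  obtain p where p: "\<And>j. j \<in> J \<Longrightarrow> M < p $ j" "\<And>j. j \<in> Z \<Longrightarrow> p $ j = 0" "dist (\<phi> p x) x < e"
    using Suc.IH[OF Suc.prems] by blast
  then have "e - dist (\<phi> p x) x > 0" by simp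
  then obtain d where d: "d > 0" "\<And>y. dist y x < d \<Longrightarrow> dist (\<phi> p y) (\<phi> p x) < e - dist (\<phi> p x) x"
    by (rule phi_near[where p = p]) blast
  obtain q where q: "\<And>j. j \<in> J \<Longrightarrow> q $ j \<noteq> 0" "\<And>j. j \<in> Z \<Longrightarrow> q $ j = 0" "dist (\<phi> q x) x < d"
    using ret[OF d(1)] by blast
  have "dist (\<phi> (p + q) x) x < e"
    using d(2)[OF q(3)] dist_triangle[of "\<phi> p (\<phi> q x)" x "\<phi> p x"] by (simp add: phi_add)
  moreover have "Suc M < (p + q) $ j" if "j \<in> J" for j
    using p(1)[OF that] q(1)[OF that] by simp
  ultimately show ?case using p(2) q(2) by (intro exI[of _ "p + q"]) simp
qed

lemma recurrentI:
  assumes "\<And>e. e > 0 \<Longrightarrow> \<exists>p. (\<forall>j\<in>J. p $ j \<noteq> 0) \<and> dist (\<phi> p x) x < e"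
  shows "x \<in> recurrent \<phi> J"
proof -
  have ret: "\<exists>p. (\<forall>j\<in>J. M < p $ j) \<and> dist (\<phi> p x) x < e" if "e > 0" for M e
    using return_times_unbounded[of J "{}" x e M] assms that by simp
  have "\<exists>s. \<forall>k. dist (\<phi> (s k) x) x < inverse (real (Suc k)) \<and> (\<forall>j\<in>J. s k $ j < s (Suc k) $ j)"
  proof (rule dependent_nat_choice)
    show "\<exists>p. dist (\<phi> p x) x < inverse (real (Suc 0))" using ret[of "inverse (real (Suc 0))" 0] by auto
    fix p :: "nat ^ 'd" and k
    \<comment> \<open>Exceeding the sum of all coordinates of \<open>p\<close> means exceeding each
      of them.\<close>
    obtain q where q: "\<forall>j\<in>J. (\<Sum>i\<in>UNIV. p $ i) < q $ j" "dist (\<phi> q x) x < inverse (real (Suc (Suc k)))"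
      using ret[of "inverse (real (Suc (Suc k)))" "\<Sum>i\<in>UNIV. p $ i"] by auto
    moreover have "p $ j \<le> (\<Sum>i\<in>UNIV. p $ i)" for j
      by (rule member_le_sum) auto
    ultimately show "\<exists>q. dist (\<phi> q x) x < inverse (real (Suc (Suc k))) \<and> (\<forall>j\<in>J. p $ j < q $ j)"
      by (intro exI[of _ q]) (auto intro: order_le_less_trans)
  qed
  then obtain s where s: "\<And>k. dist (\<phi> (s k) x) x < inverse (real (Suc k))"
    "\<And>k j. j \<in> J \<Longrightarrow> s k $ j < s (Suc k) $ j"
    by blast
  have "(\<lambda>k. \<phi> (s k) x) \<longlonglongrightarrow> x"
    by (rule tendsto_dist_iff[THEN iffD2], rule tendsto_sandwich[OF _ _ tendsto_const LIMSEQ_inverse_real_of_nat])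
      (use less_imp_le[OF s(1)] in simp_all)
  then show ?thesis unfolding recurrent_def using s(2) by blast
qed

text \<open>Pigeonhole on the supports of the return times.\<close>

lemma recurrentE:
  assumes "x \<in> recurrent \<phi> J"
  obtains S where "J \<subseteq> S"
    "\<And>e. e > 0 \<Longrightarrow> \<exists>p. (\<forall>j\<in>S. p $ j \<noteq> 0) \<and> (\<forall>j\<in>- S. p $ j = 0) \<and> dist (\<phi> p x) x < e"
proof -
  obtain s where s: "\<And>k j. j \<in> J \<Longrightarrow> s k $ j < s (Suc k) $ j" "(\<lambda>k. \<phi> (s k) x) \<longlonglongrightarrow> x"
    using assms unfolding recurrent_def by blast
  \<comment> \<open>The successor matters: for \<open>j \<in> J\<close> the entry
    \<open>s (Suc k) $ j\<close> exceeds \<open>s k $ j\<close> and is therefore nonzero, whereas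
    \<open>s 0 $ j\<close> may be 0.\<close>
  define T where "T k = {j. s (Suc k) $ j \<noteq> 0}" for k
  have "finite (range T)" by (rule finite_subset[OF subset_UNIV]) simp
  then obtain k0 where k0: "infinite {k. T k = T k0}"
    using pigeonhole_infinite[of UNIV T] by auto
  show ?thesis
  proof (rule that[of "T k0"])
    show "J \<subseteq> T k0"
    proof
      fix j assume "j \<in> J"
      then show "j \<in> T k0" using s(1)[of j k0] by (simp add: T_def)
    qed
    fix e :: real assume "e > 0"
    then obtain N where N: "\<And>k. k \<ge> N \<Longrightarrow> dist (\<phi> (s k) x) x < e"
      using s(2) unfolding lim_sequentially by blast
    obtain k where k: "k \<ge> N" "T k = T k0"
      using k0 unfolding infinite_nat_iff_unbounded_le by auto
    show "\<exists>p. (\<forall>j\<in>T k0. p $ j \<noteq> 0) \<and> (\<forall>j\<in>- T k0. p $ j = 0) \<and> dist (\<phi> p x) x < e"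
      using N[of "Suc k"] k(1) unfolding k(2)[symmetric] by (intro exI[of _ "s (Suc k)"]) (auto simp: T_def)
  qed
qed

text \<open>Nested shrinking balls, as in the Baire category theorem, with compactness of an initial
  ball in place of completeness. Each ball is centred in \<open>Y\<close>, so \<open>ret\<close>
  yields a smaller ball that some \<open>\<phi> p\<close> maps back into it; the common point of all
  balls returns arbitrarily close to itself.\<close>

lemma recurrent_dense:
  assumes lc: "locally compact (UNIV :: 'x set)"
    and ret: "\<And>V y. open V \<Longrightarrow> y \<in> Y \<Longrightarrow> y \<in> V \<Longrightarrow> \<exists>z p. z \<in> Y \<and> z \<in> V \<and> \<phi> p z \<in> V \<and> (\<forall>j\<in>J. p $ j \<noteq> 0)"
    and V: "open V" "y \<in> Y" "y \<in> V"
  shows "V \<inter> recurrent \<phi> J \<noteq> {}"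
proof -
  obtain r0 where r0: "r0 > 0" "compact (cball y r0)" "cball y r0 \<subseteq> V"
    using compact_cball_in_open[OF lc V(1,3)] .
  define P where "P k c \<longleftrightarrow> fst c \<in> Y \<and> 0 < snd c \<and> snd c \<le> inverse (real (Suc k)) \<and>
      (k = 0 \<longrightarrow> cball (fst c) (snd c) \<subseteq> cball y r0)" for k and c :: "'x \<times> real"
  define Q where "Q c c' \<longleftrightarrow> cball (fst c') (snd c') \<subseteq> ball (fst c) (snd c) \<and>
      (\<exists>p. (\<forall>j\<in>J. p $ j \<noteq> 0) \<and> \<phi> p ` cball (fst c') (snd c') \<subseteq> ball (fst c) (snd c))" for c c' :: "'x \<times> real"
  have "\<exists>c. \<forall>k. P k (c k) \<and> Q (c k) (c (Suc k))"
  proof (rule dependent_nat_choice)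
    show "\<exists>c. P 0 c"
      using V(2) r0(1) by (intro exI[of _ "(y, min r0 1)"]) (auto simp: P_def)
    fix c k assume c: "P k c"
    define B where "B = ball (fst c) (snd c)"
    have "fst c \<in> B" "open B" using c by (auto simp: B_def P_def)
    then obtain z p where z: "z \<in> Y" "z \<in> B" "\<phi> p z \<in> B" "\<forall>j\<in>J. p $ j \<noteq> 0"
      using ret[of B "fst c"] c by (auto simp: P_def)
    have "open (B \<inter> \<phi> p -` B)" "z \<in> B \<inter> \<phi> p -` B"
      using open_vimage[OF \<open>open B\<close> phi_continuous] \<open>open B\<close> z(2,3) by blast+
    then obtain e where e: "e > 0" "cball z e \<subseteq> B \<inter> \<phi> p -` B"
      using open_contains_cball_eq by metis
    define e' where "e' = min e (inverse (real (Suc (Suc k))))"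
    have "cball z e' \<subseteq> cball z e" by (auto simp: e'_def)
    then have sub: "cball z e' \<subseteq> B" "\<phi> p ` cball z e' \<subseteq> B" using e(2) by auto
    have "P (Suc k) (z, e')" unfolding P_def using z(1) e(1) by (simp add: e'_def)
    moreover have "Q c (z, e')" unfolding Q_def B_def[symmetric] using sub z(4) by auto
    ultimately show "\<exists>c'. P (Suc k) c' \<and> Q c c'" by blast
  qed
  then obtain c where c: "\<And>k. P k (c k)" "\<And>k. Q (c k) (c (Suc k))" by blast
  define F where "F k = cball (fst (c k)) (snd (c k))" for k
  have F_Suc: "F (Suc k) \<subseteq> ball (fst (c k)) (snd (c k))" for k using c(2)[of k] by (simp add: Q_def F_def)
  have "F (Suc k) \<subseteq> F k" for k using F_Suc[of k] ball_subset_cball unfolding F_def by blast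
  then have dec: "F l \<subseteq> F k" if "k \<le> l" for k l
    using lift_Suc_antimono_le[of F k l] that by auto
  have cF: "fst (c k) \<in> F k" for k using c(1)[of k] by (simp add: F_def P_def)
  have F0: "F 0 \<subseteq> cball y r0" using c(1)[of 0] by (simp add: F_def P_def)
  have "\<forall>k. fst (c k) \<in> cball y r0" using cF dec[of 0] F0 by blast
  then obtain x \<sigma> where x: "strict_mono \<sigma>" "((\<lambda>k. fst (c k)) \<circ> \<sigma>) \<longlonglongrightarrow> x"
    using r0(2) unfolding compact_def by metis
  have xF: "x \<in> F k" for k
  proof (rule Lim_in_closed_set[OF _ _ sequentially_bot x(2)])
    show "closed (F k)" by (simp add: F_def)
    have "((\<lambda>k. fst (c k)) \<circ> \<sigma>) l \<in> F k" if "l \<ge> k" for l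
      using cF[of "\<sigma> l"] dec[of k "\<sigma> l"] seq_suble[OF x(1), of l] that by auto
    then show "\<forall>\<^sub>F l in sequentially. ((\<lambda>k. fst (c k)) \<circ> \<sigma>) l \<in> F k"
      unfolding eventually_sequentially by blast
  qed
  have "x \<in> recurrent \<phi> J"
  proof (rule recurrentI)
    fix e :: real assume "e > 0"
    then obtain k where k: "inverse (real (Suc k)) < e / 2" using reals_Archimedean half_gt_zero by blast
    obtain p where p: "\<forall>j\<in>J. p $ j \<noteq> 0" "\<phi> p ` F (Suc k) \<subseteq> ball (fst (c k)) (snd (c k))"
      using c(2)[of k] by (auto simp: Q_def F_def)
    \<comment> \<open>The \<open>k\<close>-th ball contains \<open>x\<close> by nesting, and
      \<open>\<phi> p x\<close> because \<open>x\<close> lies in the next ball.\<close>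
    have "dist (fst (c k)) (\<phi> p x) < e / 2" "dist (fst (c k)) x < e / 2"
      using p(2) xF[of "Suc k"] F_Suc[of k] k c(1)[of k] by (auto simp: P_def subset_iff)
    then have "dist (\<phi> p x) x < e" using dist_triangle_half_r by metis
    then show "\<exists>p. (\<forall>j\<in>J. p $ j \<noteq> 0) \<and> dist (\<phi> p x) x < e" using p(1) by blast
  qed
  moreover have "x \<in> V" using xF[of 0] F0 r0(3) by blast
  ultimately show ?thesis by blast
qed

text \<open>For fixed \<open>n\<close> the functions \<open>g\<close> with
  \<open>U n g \<in> I\<close> form an ideal of \<open>C0\<close>, since right multiplication by
  \<open>U 0 h\<close> multiplies \<open>g\<close> by \<open>h\<close>. Membership of
  \<open>U n f\<close> is thus a question about common zeros, and the monomial norm is controlled by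
  the supremum norm.\<close>

lemma monomial_hull:
  assumes I: "ideal A I" "closed I" and f: "f \<in> C0"
    and hull: "\<And>x. f x \<noteq> 0 \<Longrightarrow> \<exists>g\<in>C0. U n g \<in> I \<and> g x \<noteq> 0"
  shows "U n f \<in> I"
proof -
  note sI = ideal_subspace[OF I(1)]
  define G where "G = {g\<in>C0. U n g \<in> I}"
  have "U n f \<in> closure I"
    unfolding closure_approachable
  proof (intro allI impI)
    fix e :: real assume e: "e > 0"
    have "\<exists>g\<in>G. \<forall>x. cmod (f x - g x) \<le> e / 2"
    proof (rule C0_ideal_hull[OF _ _ _ _ f])
      show "(\<lambda>_. 0) \<in> G" by (simp add: G_def C0_zero monomial_zero cvec.subspace_0[OF sI])
      show "(\<lambda>x. g x + h x) \<in> G" if "g \<in> G" "h \<in> G" for g h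
        using that by (simp add: G_def C0_add monomial_add cvec.subspace_add[OF sI])
      show "(\<lambda>x. g x * h x) \<in> G" if "g \<in> G" "h \<in> C0" for g h
      proof -
        have "U n (\<lambda>x. g x * h x) = U n g o\<^sub>L U 0 h"
          using that by (simp add: G_def monomial_compose phi_zero)
        then show ?thesis
          using that ideal_right[OF I(1) monomial_mem[OF that(2), of 0]] by (simp add: G_def C0_mult)
      qed
      show "\<exists>g\<in>G. g x \<noteq> 0" if "f x \<noteq> 0" for x using hull[OF that] by (auto simp: G_def)
    qed (use e in \<open>auto simp: G_def\<close>)
    then obtain g where g: "g \<in> C0" "U n g \<in> I" "\<And>x. cmod (f x - g x) \<le> e / 2"
      by (auto simp: G_def)
    have "norm (U n f - U n g) \<le> e / 2"
      unfolding monomial_diff[OF f g(1), symmetric] by (rule norm_monomial_leI[OF C0_diff[OF f g(1)] g(3)])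
    then show "\<exists>b\<in>I. dist b (U n f) < e"
      using g(2) e by (intro bexI[of _ "U n g"]) (simp_all add: dist_norm norm_minus_commute)
  qed
  then show ?thesis using I(2) by simp
qed

text \<open>
  Let \<open>Y\<close> be the common zero set of the functions \<open>g\<close> with \<open>U n g \<in> R\<close>.  If no point of \<open>Y \<inter> V\<close>
  returned to \<open>V\<close> in the directions of \<open>J\<close>, then \<open>b A b \<subseteq> R\<close> for every monomial \<open>b = U n f\<close> with
  \<open>f\<close> supported in \<open>V\<close>, and \<open>V\<close> would be disjoint from \<open>Y\<close>.  Hence recurrent points are dense in \<open>Y\<close>.
\<close>

lemma semiprime_ideal_monomial:
  assumes lc: "locally compact (UNIV :: 'x set)"
    and R: "ideal A R" "closed R"
    and semiprime: "\<And>a. a \<in> A \<Longrightarrow> (\<And>b. b \<in> A \<Longrightarrow> a o\<^sub>L (b o\<^sub>L a) \<in> R) \<Longrightarrow> a \<in> R"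
    and f: "f \<in> C0" "\<And>x. x \<in> recurrent \<phi> {j. n $ j \<noteq> 0} \<Longrightarrow> f x = 0"
  shows "U n f \<in> R"
proof -
  define J where "J = {j. n $ j \<noteq> 0}"
  define Y where "Y = {x. \<forall>g\<in>C0. U n g \<in> R \<longrightarrow> g x = 0}"
  note sR = ideal_subspace[OF R(1)]
  have ret: "\<exists>z p. z \<in> Y \<and> z \<in> V \<and> \<phi> p z \<in> V \<and> (\<forall>j\<in>J. p $ j \<noteq> 0)" if V: "open V" "y \<in> Y" "y \<in> V" for V y
  proof (rule ccontr)
    assume "\<not> ?thesis"
    then have wander: "\<And>z p. z \<in> Y \<Longrightarrow> z \<in> V \<Longrightarrow> (\<And>j. j \<in> J \<Longrightarrow> p $ j \<noteq> 0) \<Longrightarrow> \<phi> p z \<notin> V"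
      by blast
    obtain h where h: "h \<in> C0" "h y = 1" "\<And>x. x \<notin> V \<Longrightarrow> h x = 0"
      using C0_bump[OF lc V(1,3)] by metis
    have "U n h \<in> R"
    proof (rule semiprime[OF monomial_mem[OF h(1)]])
      fix b assume b: "b \<in> A"
      have "A \<subseteq> {b. U n h o\<^sub>L (b o\<^sub>L U n h) \<in> R}"
      proof (rule A_subsetI)
        have "bounded_linear (\<lambda>b. U n h o\<^sub>L (b o\<^sub>L U n h))"
          by (rule bounded_linear_compose[OF comp.bounded_linear_right comp.bounded_linear_left])
        then have "closed ((\<lambda>b. U n h o\<^sub>L (b o\<^sub>L U n h)) -` R)"
          by (intro closed_vimage R(2) linear_continuous_on)
        then show "closed {b. U n h o\<^sub>L (b o\<^sub>L U n h) \<in> R}" by (simp add: vimage_def)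
        show "cvec.subspace {b. U n h o\<^sub>L (b o\<^sub>L U n h) \<in> R}"
          by (rule cvec.subspaceI)
            (simp_all add: comp.zero_left comp.zero_right comp.add_left comp.add_right scaleC_compose
              compose_scaleC[OF monomial_mem[OF h(1)]]
              cvec.subspace_0[OF sR] cvec.subspace_add[OF sR] cvec.subspace_scale[OF sR])
        fix m and g :: "'x \<Rightarrow> complex" assume g: "g \<in> C0"
        have C: "(\<lambda>x. g (\<phi> n x) * h x) \<in> C0" "(\<lambda>x. h (\<phi> (m + n) x) * (g (\<phi> n x) * h x)) \<in> C0"
          by (intro C0_mult C0_phi' g h)+
        \<comment> \<open>This monomial is the product of \<open>U n h\<close>, \<open>U m g\<close>
          and \<open>U n h\<close>. Where its function is nonzero, both \<open>x\<close> and
          \<open>\<phi> (m + n) x\<close> lie in \<open>V\<close>; as \<open>n\<close> alone makes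
          \<open>m + n\<close> nonzero in the directions of \<open>J\<close>, the point
          \<open>x\<close> cannot be in \<open>Y\<close>.\<close>
        have "U (n + (m + n)) (\<lambda>x. h (\<phi> (m + n) x) * (g (\<phi> n x) * h x)) \<in> R"
        proof (rule monomial_hull[OF R C(2)])
          fix x assume nz: "h (\<phi> (m + n) x) * (g (\<phi> n x) * h x) \<noteq> 0"
          then have "\<phi> (m + n) x \<in> V" "x \<in> V" using h(3) by auto
          moreover have "(m + n) $ j \<noteq> 0" if "j \<in> J" for j using that by (simp add: J_def)
          ultimately have "x \<notin> Y" using wander by blast
          then obtain k where k: "k \<in> C0" "U n k \<in> R" "k x \<noteq> 0" by (auto simp: Y_def)
          \<comment> \<open>Multiplying \<open>U n k\<close> from the left by
            \<open>U (n + m) l\<close> reaches the required degree, with a function that is still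
            nonzero at \<open>x\<close>.\<close>
          define l where "l z = h (\<phi> m z) * g z" for z
          have l: "l \<in> C0" unfolding l_def by (intro C0_mult C0_phi' g h)
          have "U (n + m) l o\<^sub>L U n k \<in> R"
            by (rule ideal_left[OF R(1) monomial_mem[OF l] k(2)])
          then have "U (n + (m + n)) (\<lambda>z. l (\<phi> n z) * k z) \<in> R"
            by (simp add: monomial_compose[OF l k(1)] add.assoc)
          moreover have "l (\<phi> n x) * k x \<noteq> 0" using nz k(3) by (simp add: l_def phi_add)
          moreover have "(\<lambda>z. l (\<phi> n z) * k z) \<in> C0" by (intro C0_mult C0_phi' l k)
          ultimately show "\<exists>g\<in>C0. U (n + (m + n)) g \<in> R \<and> g x \<noteq> 0" by (intro bexI) auto
        qed
        then show "U m g \<in> {b. U n h o\<^sub>L (b o\<^sub>L U n h) \<in> R}"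
          by (simp add: monomial_compose[OF g h(1)] monomial_compose[OF h(1) C(1)])
      qed
      then show "U n h o\<^sub>L (b o\<^sub>L U n h) \<in> R" using b by blast
    qed
    then have "h y = 0" using V(2) h(1) by (simp add: Y_def)
    then show False using h(2) by simp
  qed
  show ?thesis
  proof (rule monomial_hull[OF R f(1)])
    fix x assume x: "f x \<noteq> 0"
    show "\<exists>g\<in>C0. U n g \<in> R \<and> g x \<noteq> 0"
    proof (rule ccontr)
      assume "\<not> ?thesis"
      then have "x \<in> Y" by (auto simp: Y_def)
      moreover have "open {x. f x \<noteq> 0}"
        by (intro open_Collect_neq C0_continuous[OF f(1)] continuous_intros)
      ultimately have "{x. f x \<noteq> 0} \<inter> recurrent \<phi> J \<noteq> {}"
        by (intro recurrent_dense[OF lc ret]) (use x in auto)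
      then show False using f(2) by (auto simp: J_def)
    qed
  qed
qed

end


section \<open>Monomials in the Jacobson radical\<close>

lemma nonneg_Reals_sum: "(\<And>i. i \<in> I \<Longrightarrow> f i \<in> \<real>\<^sub>\<ge>\<^sub>0) \<Longrightarrow> sum f I \<in> (\<real>\<^sub>\<ge>\<^sub>0 :: complex set)"
  by (induction I rule: infinite_finite_induct) auto

context analytic_crossed_product
begin

lemma coeff_sum: "(\<And>i. i \<in> I \<Longrightarrow> a i \<in> A) \<Longrightarrow> coeff (\<Sum>i\<in>I. a i) n x = (\<Sum>i\<in>I. coeff (a i) n x)"
proof (induction I rule: infinite_finite_induct)
  case (insert i I)
  then have "(\<Sum>i\<in>I. a i) \<in> A" by (intro cvec.subspace_sum[OF subspace_A]) auto
  with insert show ?case by (simp add: coeff_add)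
qed (simp_all add: coeff_zero)

lemma coeff_tendsto:
  assumes "\<And>k. a k \<in> A" "b \<in> A" "a \<longlonglongrightarrow> b"
  shows "(\<lambda>k. coeff (a k) n x) \<longlonglongrightarrow> coeff b n x"
proof (rule LIM_zero_cancel, rule Lim_null_comparison)
  show "(\<lambda>k. norm (a k - b)) \<longlonglongrightarrow> 0"
    using assms(3) by (simp add: tendsto_norm_zero_iff LIM_zero)
  have "cmod (coeff (a k) n x - coeff b n x) \<le> norm (a k - b)" for k
    using coeff_bound[OF cvec.subspace_diff[OF subspace_A assms(1,2)], of k n x]
    by (simp add: coeff_diff assms(1,2))
  then show "\<forall>\<^sub>F k in sequentially. cmod (coeff (a k) n x - coeff b n x) \<le> norm (a k - b)" by simp
qed

text \<open>In degree 0 there is no dynamics: after scaling to a function with value 1 at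
  \<open>x\<close>, the coefficient \<open>c\<close> of a quasi-inverse in degree 0 at
  \<open>x\<close> would satisfy \<open>c = 1 + c\<close>.\<close>

lemma jacobson_radical_monomial_zero:
  assumes f: "f \<in> C0" and rad: "U 0 f \<in> jacobson_radical A"
  shows "f x = 0"
proof (rule ccontr)
  assume nz: "f x \<noteq> 0"
  define g where "g z = inverse (f x) * inverse (cnj (f x)) * cnj (f z)" for z
  have g: "g \<in> C0" unfolding g_def by (intro C0_scale C0_cnj f)
  define u where "u z = f z * g z" for z
  have u: "u \<in> C0" unfolding u_def by (intro C0_mult f g)
  have "U 0 f o\<^sub>L U 0 g \<in> jacobson_radical A"
    by (rule ideal_right[OF ideal_jacobson_radical monomial_mem[OF g] rad])
  moreover have "U 0 f o\<^sub>L U 0 g = U 0 u"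
    by (simp add: monomial_compose[OF f g] phi_zero u_def[abs_def])
  ultimately have "U 0 u \<in> jacobson_radical A" by simp
  then obtain y where y: "y \<in> A" "y = U 0 u + (y o\<^sub>L U 0 u)" by (rule quasi_regular)
  have T0: "{T :: nat ^ 'd. T \<le> 0} = {0}" by (auto simp: less_eq_vec_def vec_eq_iff)
  have "coeff y 0 x = coeff (U 0 u + (y o\<^sub>L U 0 u)) 0 x"
    by (rule arg_cong[OF y(2), of "\<lambda>y. coeff y 0 x"])
  also have "\<dots> = u x + coeff y 0 x * u x"
    using y(1) u by (simp add: coeff_add coeff_compose coeff_monomial monomial_mem mult_closed T0 phi_zero)
  also have "u x = 1" using nz by (simp add: u_def g_def field_simps)
  finally show False by simp
qed

text \<open>
  The quasi-inverse \<open>y\<close> of an element \<open>z\<close> of the radical with nonnegative coefficients, none in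
  degree \<open>0\<close>, is the formal series \<open>z + z\<^sup>2 + z\<^sup>3 + \<dots>\<close>.
\<close>

lemma quasi_inverse_coeff:
  assumes z: "z \<in> A" "\<And>n x. coeff z n x \<in> \<real>\<^sub>\<ge>\<^sub>0" "\<And>x. coeff z 0 x = 0"
    and y: "y \<in> A" "y = z + (y o\<^sub>L z)"
  shows "coeff y n x \<in> \<real>\<^sub>\<ge>\<^sub>0"
    and "Re (coeff z n x) \<le> Re (coeff y n x)"
    and "Re (coeff y m (\<phi> n x)) * Re (coeff z n x) \<le> Re (coeff y (m + n) x)"
proof -
  have rec: "coeff y n x = coeff z n x + (\<Sum>T | T \<le> n. coeff y (n - T) (\<phi> T x) * coeff z T x)" for n x
    using arg_cong[OF y(2), of "\<lambda>y. coeff y n x"]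
    by (simp add: coeff_add coeff_compose mult_closed z(1) y(1))
  \<comment> \<open>Induction on the total degree of \<open>n\<close>: the term \<open>T = 0\<close>
    vanishes because \<open>z\<close> has no part in degree 0, and every other term involves
    \<open>y\<close> only in smaller total degree.\<close>
  have nn: "coeff y n x \<in> \<real>\<^sub>\<ge>\<^sub>0" for n x
  proof (induction "\<Sum>i\<in>UNIV. n $ i" arbitrary: n x rule: less_induct)
    case less
    have "coeff y (n - T) (\<phi> T x) * coeff z T x \<in> \<real>\<^sub>\<ge>\<^sub>0" if T: "T \<le> n" for T
    proof (cases "T = 0")
      case False
      then obtain i where "T $ i \<noteq> 0" by (auto simp: vec_eq_iff)
      then have "(n - T) $ i < n $ i" using T by (simp add: less_eq_vec_def) (metis diff_less gr_zeroI le_zero_eq)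
      then have "(\<Sum>i\<in>UNIV. (n - T) $ i) < (\<Sum>i\<in>UNIV. n $ i)"
        by (intro sum_strict_mono_ex1) auto
      from less[OF this] show ?thesis using z(2) by (intro nonneg_Reals_mult_I) auto
    qed (simp add: z(3))
    then show ?case
      unfolding rec[of n x] using z(2) by (intro nonneg_Reals_add_I nonneg_Reals_sum) auto
  qed
  then show "coeff y n x \<in> \<real>\<^sub>\<ge>\<^sub>0" .
  have re0: "0 \<le> Re w" if "w \<in> \<real>\<^sub>\<ge>\<^sub>0" for w using that by (simp add: complex_nonneg_Reals_iff)
  have nnt: "coeff y (n - T) (\<phi> T x) * coeff z T x \<in> \<real>\<^sub>\<ge>\<^sub>0" for n T x
    using nn z(2) by (intro nonneg_Reals_mult_I)
  have term0: "0 \<le> Re (coeff y (n - T) (\<phi> T x) * coeff z T x)" for n T x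
    by (rule re0[OF nnt])
  have Re_rec: "Re (coeff y n x)
      = Re (coeff z n x) + (\<Sum>T | T \<le> n. Re (coeff y (n - T) (\<phi> T x) * coeff z T x))" for n x
    by (subst rec) (simp only: plus_complex.sel Re_sum)
  show "Re (coeff z n x) \<le> Re (coeff y n x)"
    unfolding Re_rec by (simp add: sum_nonneg term0 del: times_complex.sel)
  \<comment> \<open>All terms of the recursion in degree \<open>m + n\<close> are nonnegative, so
    the term \<open>T = n\<close> alone is a lower bound.\<close>
  have "Re (coeff y m (\<phi> n x)) * Re (coeff z n x) = Re (coeff y m (\<phi> n x) * coeff z n x)"
    using z(2)[of n x] by (simp add: complex_nonneg_Reals_iff)
  also have "\<dots> = Re (coeff y (m + n - n) (\<phi> n x) * coeff z n x)" by simp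
  also have "\<dots> \<le> (\<Sum>T | T \<le> m + n. Re (coeff y (m + n - T) (\<phi> T x) * coeff z T x))"
    using term0 by (intro member_le_sum[of n "{T. T \<le> m + n}" "\<lambda>T. Re (coeff y (m + n - T) (\<phi> T x) * coeff z T x)"])
      (auto simp: vec_le_add finite_vec_le simp del: times_complex.sel)
  also have "\<dots> \<le> Re (coeff y (m + n) x)"
    unfolding Re_rec[of "m + n"] using re0[OF z(2)] by simp
  finally show "Re (coeff y m (\<phi> n x)) * Re (coeff z n x) \<le> Re (coeff y (m + n) x)" .
qed

text \<open>
  Near a recurrent point there is a sequence of words \<open>W\<^sub>k\<^sub>+\<^sub>1 = W\<^sub>k N\<^sub>k W\<^sub>k\<close>, of total degree \<open>s k\<close>, along
  which orbits starting in \<open>G k\<close> stay in the given neighbourhood \<open>V\<close>.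
\<close>

lemma return_words:
  assumes x: "x \<in> recurrent \<phi> {j. n $ j \<noteq> 0}" and V: "open V" "x \<in> V"
  obtains s m G where "s 0 = (0 :: nat ^ 'd)" "\<And>k. s (Suc k) = s k + (m k + n) + s k"
    "\<And>k. x \<in> G k" "\<And>k. G (Suc k) \<subseteq> G k"
    "\<And>k q. q \<in> G k \<Longrightarrow> \<phi> (s k) q \<in> V" "\<And>k q. q \<in> G (Suc k) \<Longrightarrow> \<phi> (m k + n + s k) q \<in> G k"
proof -
  obtain S where S: "{j. n $ j \<noteq> 0} \<subseteq> S"
    "\<And>e. e > 0 \<Longrightarrow> \<exists>p. (\<forall>j\<in>S. p $ j \<noteq> 0) \<and> (\<forall>j\<in>- S. p $ j = 0) \<and> dist (\<phi> p x) x < e"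
    using recurrentE[OF x] by metis
  \<comment> \<open>The last clause keeps the degrees supported in \<open>S\<close>, the only
    coordinates in which return times can be made large.\<close>
  define P where "P k c \<longleftrightarrow> (k = (0::nat) \<longrightarrow> fst c = 0) \<and> open (snd c) \<and> x \<in> snd c \<and>
      (\<forall>q\<in>snd c. \<phi> (fst c) q \<in> V) \<and> (\<forall>j\<in>- S. fst c $ j = 0)" for k and c :: "(nat ^ 'd) \<times> 'x set"
  define Q where "Q c c' m \<longleftrightarrow> fst c' = fst c + (m + n) + fst c \<and> snd c' \<subseteq> snd c \<and>
      (\<forall>q\<in>snd c'. \<phi> (m + n + fst c) q \<in> snd c)" for c c' :: "(nat ^ 'd) \<times> 'x set" and m
  have "\<exists>c. \<forall>k. P k (c k) \<and> (\<exists>m. Q (c k) (c (Suc k)) m)"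
  proof (rule dependent_nat_choice)
    show "\<exists>c. P 0 c" using V by (intro exI[of _ "(0, V)"]) (simp add: P_def phi_zero)
    fix c k assume c: "P k c"
    obtain s G where sG: "c = (s, G)" by fastforce
    have G: "open G" "x \<in> G" "\<And>q. q \<in> G \<Longrightarrow> \<phi> s q \<in> V" "\<And>j. j \<notin> S \<Longrightarrow> s $ j = 0"
      using c by (auto simp: P_def sG)
    obtain e where e: "e > 0" "ball x e \<subseteq> G" using G(1,2) open_contains_ball by blast
    \<comment> \<open>On \<open>S\<close> the time \<open>r\<close> exceeds the total degree of
      \<open>s + n\<close>, and off \<open>S\<close> both vanish, so \<open>s + n \<le> r\<close>.
      The surplus \<open>r - (s + n)\<close> becomes the padding \<open>m\<close>.\<close>
    obtain r where r: "\<And>j. j \<in> S \<Longrightarrow> (\<Sum>i\<in>UNIV. (s + n) $ i) < r $ j" "\<And>j. j \<notin> S \<Longrightarrow> r $ j = 0"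
      "dist (\<phi> r x) x < e"
      using return_times_unbounded[where J = S and Z = "- S" and M = "\<Sum>i\<in>UNIV. (s + n) $ i", OF S(2) e(1)]
      by auto
    have rx: "\<phi> r x \<in> G" using r(3) e(2) by (auto simp: dist_commute)
    have le: "s $ j + n $ j \<le> r $ j" for j
    proof (cases "j \<in> S")
      case True
      have "(s + n) $ j \<le> (\<Sum>i\<in>UNIV. (s + n) $ i)" by (rule member_le_sum) auto
      with r(1)[OF True] show ?thesis by simp
    next
      case False
      then have "n $ j = 0" using S(1) by blast
      then show ?thesis using G(4)[OF False] by simp
    qed
    have "s + n \<le> r" by (simp add: less_eq_vec_def le)
    then have rm: "r - (s + n) + n + s = r"
      using vec_diff_add_cancel[of "s + n" r] by (simp only: ac_simps)
    \<comment> \<open>Points of \<open>G\<close> that return to \<open>G\<close> after time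
      \<open>r\<close>: from there a further time \<open>s\<close> leads into \<open>V\<close>, as
      is required for the new degree \<open>r + s\<close>.\<close>
    have "open (G \<inter> \<phi> r -` G)"
      using open_vimage[OF G(1) phi_continuous] G(1) by blast
    moreover have "\<phi> (r + s) q \<in> V" if "q \<in> G \<inter> \<phi> r -` G" for q
      using that G(3) by (simp add: add.commute[of r] phi_add)
    ultimately have "P (Suc k) (r + s, G \<inter> \<phi> r -` G)"
      using G(2,4) r(2) rx by (simp add: P_def)
    moreover have "Q c (r + s, G \<inter> \<phi> r -` G) (r - (s + n))"
      unfolding Q_def sG fst_conv snd_conv rm using rm by (auto simp: ac_simps)
    ultimately show "\<exists>c'. P (Suc k) c' \<and> (\<exists>m. Q c c' m)" by blast
  qed
  then obtain c where c: "\<And>k. P k (c k)" "\<And>k. \<exists>m. Q (c k) (c (Suc k)) m" by blast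
  then obtain m where m: "\<And>k. Q (c k) (c (Suc k)) (m k)" by metis
  show ?thesis
    by (rule that[of "\<lambda>k. fst (c k)" m "\<lambda>k. snd (c k)"])
      (use c(1) m in \<open>auto simp: P_def Q_def\<close>)
qed

lemma jacobson_radical_monomial:
  assumes lc: "locally compact (UNIV :: 'x set)"
    and f: "f \<in> C0" and rad: "U n f \<in> jacobson_radical A" and x: "x \<in> recurrent \<phi> {j. n $ j \<noteq> 0}"
  shows "f x = 0"
proof (cases "n = 0")
  case True
  then show ?thesis using jacobson_radical_monomial_zero[OF f] rad by simp
next
  case n: False
  show ?thesis
  proof (rule ccontr)
    assume nz: "f x \<noteq> 0"
    \<comment> \<open>\<open>g\<close> is a local unit at \<open>\<phi> n x\<close>, and replacing
      \<open>f\<close> by its squared modulus gives a nonnegative function. The product of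
      \<open>U (m k) g\<close> and \<open>U n ff\<close> is then \<open>U (m k + n) h\<close> with
      the same \<open>h\<close> for every \<open>k\<close>.\<close>
    obtain g where g: "g \<in> C0" "g (\<phi> n x) = 1" "\<And>z. g z \<in> \<real>\<^sub>\<ge>\<^sub>0"
      using C0_bump[OF lc open_UNIV UNIV_I, of "\<phi> n x"] by metis
    define ff where "ff z = f z * cnj (f z)" for z
    have ff: "ff \<in> C0" unfolding ff_def by (intro C0_mult C0_cnj f)
    define h where "h z = g (\<phi> n z) * ff z" for z
    have h: "h \<in> C0" unfolding h_def by (intro C0_mult C0_phi' g ff)
    have "ff z \<in> \<real>\<^sub>\<ge>\<^sub>0" for z by (simp add: ff_def complex_norm_square[symmetric] del: of_real_power)
    then have h0: "h z \<in> \<real>\<^sub>\<ge>\<^sub>0" for z unfolding h_def by (intro nonneg_Reals_mult_I g)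
    have "h x \<noteq> 0" using nz g(2) by (simp add: h_def ff_def)
    then have hx: "Re (h x) > 0"
      using h0[of x] by (auto simp: complex_nonneg_Reals_iff complex_eq_iff)
    define \<delta> where "\<delta> = Re (h x) / 2"
    have \<delta>: "\<delta> > 0" using hx by (simp add: \<delta>_def)
    define V where "V = {z. \<delta> < Re (h z)}"
    have V: "open V" "x \<in> V"
      unfolding V_def using hx
      by (auto simp: \<delta>_def intro!: open_Collect_less continuous_intros C0_continuous[OF h])
    obtain s m G where s: "s 0 = 0" "\<And>k. s (Suc k) = s k + (m k + n) + s k"
      and G: "\<And>k. x \<in> G k" "\<And>k. G (Suc k) \<subseteq> G k" "\<And>k q. q \<in> G k \<Longrightarrow> \<phi> (s k) q \<in> V"
        "\<And>k q. q \<in> G (Suc k) \<Longrightarrow> \<phi> (m k + n + s k) q \<in> G k"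
      using return_words[OF x V] by metis
    define b where "b k = (1/2)^k *\<^sub>R U (m k) g" for k
    have bA: "b k \<in> A" for k
      unfolding b_def scaleR_scaleC by (intro scaleC_closed monomial_mem g)
    have sumb: "summable b"
    proof (rule summable_comparison_test)
      have "norm (b k) \<le> (1/2)^k * sup_norm g" for k
        using norm_monomial_le[OF dyn rep g(1), of "m k"] by (simp add: b_def mult_left_mono)
      then show "\<exists>N. \<forall>k\<ge>N. norm (b k) \<le> (1/2)^k * sup_norm g" by blast
      show "summable (\<lambda>k. (1/2)^k * sup_norm g)" by (intro summable_mult2 summable_geometric) simp
    qed
    have partA: "(\<Sum>k<K. b k) \<in> A" for K by (intro cvec.subspace_sum[OF subspace_A] bA)
    have BA: "suminf b \<in> A"
      by (rule closed_sequentially[OF closed_A partA summable_LIMSEQ[OF sumb]])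
    define w where "w = suminf b o\<^sub>L U n ff"
    define wK where "wK K = (\<Sum>k<K. b k) o\<^sub>L U n ff" for K
    have wA: "w \<in> A" "wK K \<in> A" for K unfolding w_def wK_def by (intro mult_closed BA partA monomial_mem ff)+
    have wlim: "wK \<longlonglongrightarrow> w"
      unfolding wK_def w_def by (intro bounded_linear.tendsto[OF comp.bounded_linear_left] summable_LIMSEQ sumb)
    have wKc: "coeff (wK K) p q = (\<Sum>k<K. complex_of_real ((1/2)^k) * (if p = m k + n then h q else 0))" for K p q
    proof -
      have "wK K = (\<Sum>k<K. complex_of_real ((1/2)^k) *\<^sub>C U (m k + n) h)"
        unfolding wK_def comp.sum_left b_def h_def
        by (intro sum.cong refl) (simp add: scaleR_scaleC scaleC_compose monomial_compose[OF g(1) ff])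
      then show ?thesis
        by (simp add: coeff_sum coeff_scaleC scaleC_closed monomial_mem[OF h] coeff_monomial[OF h] del: of_real_power)
    qed
    have w0: "coeff w p q \<in> \<real>\<^sub>\<ge>\<^sub>0" for p q
    proof (rule Lim_in_closed_set[OF closed_nonneg_Reals_complex _ sequentially_bot coeff_tendsto[OF wA(2,1) wlim]])
      have "coeff (wK K) p q \<in> \<real>\<^sub>\<ge>\<^sub>0" for K
        unfolding wKc using h0 by (intro nonneg_Reals_sum nonneg_Reals_mult_I) auto
      then show "\<forall>\<^sub>F K in sequentially. coeff (wK K) p q \<in> \<real>\<^sub>\<ge>\<^sub>0" by simp
    qed
    \<comment> \<open>Several indices may share the degree \<open>m k + n\<close>; nonnegativity
      allows the other terms to be dropped.\<close>
    have wN: "(1/2)^k * Re (h q) \<le> Re (coeff w (m k + n) q)" for k q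
    proof (rule tendsto_lowerbound)
      show "(\<lambda>K. Re (coeff (wK K) (m k + n) q)) \<longlonglongrightarrow> Re (coeff w (m k + n) q)"
        by (intro tendsto_Re coeff_tendsto wA wlim)
      have "(1/2)^k * Re (h q) \<le> Re (coeff (wK K) (m k + n) q)" if "Suc k \<le> K" for K
      proof -
        define t where "t i = Re (complex_of_real ((1/2)^i) * (if m k + n = m i + n then h q else 0))" for i
        have "0 \<le> t i" for i
          unfolding t_def using h0[of q] by (auto simp: complex_nonneg_Reals_iff simp del: of_real_power)
        then have "t k \<le> (\<Sum>i<K. t i)"
          using that by (intro member_le_sum) auto
        moreover have "t k = (1/2)^k * Re (h q)" by (simp add: t_def del: of_real_power)
        ultimately show ?thesis unfolding wKc Re_sum t_def by simp
      qed
      then show "\<forall>\<^sub>F K in sequentially. (1/2)^k * Re (h q) \<le> Re (coeff (wK K) (m k + n) q)"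
        unfolding eventually_sequentially by blast
    qed simp
    have wz: "coeff w 0 q = 0" for q
    proof -
      have "{T :: nat ^ 'd. T \<le> 0} = {0}" by (auto simp: less_eq_vec_def vec_eq_iff)
      then show ?thesis
        using n by (simp add: w_def coeff_compose BA monomial_mem ff coeff_monomial)
    qed
    \<comment> \<open>The factor makes the coefficient in degree \<open>m k + n\<close> at least
      \<open>2 * (1/2)^k\<close> on \<open>V\<close>, which is what the induction for
      \<open>grow\<close> consumes.\<close>
    define z where "z = complex_of_real (2 / \<delta>) *\<^sub>C w"
    have zA: "z \<in> A" unfolding z_def by (intro scaleC_closed wA)
    have zc: "coeff z p q = complex_of_real (2 / \<delta>) * coeff w p q" for p q
      unfolding z_def by (rule coeff_scaleC[OF wA(1)])
    have z0: "coeff z p q \<in> \<real>\<^sub>\<ge>\<^sub>0" for p q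
      unfolding zc using w0 \<delta> by (intro nonneg_Reals_mult_I) auto
    have zz: "coeff z 0 q = 0" for q by (simp add: zc wz)
    have zN: "2 * (1/2)^k \<le> Re (coeff z (m k + n) q)" if "q \<in> V" for k q
    proof -
      have "(1/2)^k * \<delta> \<le> (1/2)^k * Re (h q)"
        using that by (intro mult_left_mono) (auto simp: V_def)
      also have "\<dots> \<le> Re (coeff w (m k + n) q)" by (rule wN)
      finally have "2 / \<delta> * ((1/2)^k * \<delta>) \<le> 2 / \<delta> * Re (coeff w (m k + n) q)"
        using \<delta> by (intro mult_left_mono) auto
      then show ?thesis using \<delta> by (simp add: zc del: of_real_divide)
    qed
    have "U n f o\<^sub>L U 0 (\<lambda>z. cnj (f z)) \<in> jacobson_radical A"
      by (rule ideal_right[OF ideal_jacobson_radical monomial_mem[OF C0_cnj[OF f]] rad])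
    then have "U n ff \<in> jacobson_radical A"
      by (simp add: monomial_compose[OF f C0_cnj[OF f]] phi_zero ff_def[abs_def])
    then have "w \<in> jacobson_radical A"
      unfolding w_def by (rule ideal_left[OF ideal_jacobson_radical BA])
    then have "z \<in> jacobson_radical A"
      unfolding z_def by (rule cvec.subspace_scale[OF ideal_subspace[OF ideal_jacobson_radical]])
    then obtain y where y: "y \<in> A" "y = z + (y o\<^sub>L z)" by (rule quasi_regular)
    note yc = quasi_inverse_coeff[OF zA z0 zz y]
    have y0: "0 \<le> Re (coeff y p q)" for p q using yc(1)[of p q] by (simp add: complex_nonneg_Reals_iff)
    \<comment> \<open>Each of the two copies of \<open>s k\<close> in \<open>s (Suc k)\<close>
      contributes \<open>2 ^ k\<close> and the middle factor \<open>2 * (1/2)^k\<close>, which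
      multiply to \<open>2 ^ Suc k\<close>. Doubling the word thus beats the decay of the weights
      that summability imposes.\<close>
    have grow: "2 ^ k * Re (coeff y T (\<phi> (s k) q)) \<le> Re (coeff y (T + s k) q)" if "q \<in> G k" for k T q
      using that
    proof (induction k arbitrary: T q)
      case 0
      then show ?case by (simp add: s(1) phi_zero)
    next
      case (Suc k)
      define q1 where "q1 = \<phi> (s k) q"
      define q2 where "q2 = \<phi> (m k + n) q1"
      have q: "q \<in> G k" "q1 \<in> V" "q2 \<in> G k"
        using Suc.prems G(2)[of k] G(3)[of q k] G(4)[of q k] by (auto simp: q1_def q2_def phi_add)
      have "2 ^ Suc k * Re (coeff y T (\<phi> (s (Suc k)) q))
          = 2 ^ k * ((2 ^ k * Re (coeff y T (\<phi> (s k) q2))) * (2 * (1/2)^k))"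
        by (simp add: s(2) phi_add q1_def q2_def power_divide add.assoc)
      also have "\<dots> \<le> 2 ^ k * (Re (coeff y (T + s k) q2) * Re (coeff z (m k + n) q1))"
        by (intro mult_left_mono mult_mono Suc.IH[OF q(3)] zN q(2) y0) (auto intro: y0)
      also have "\<dots> \<le> 2 ^ k * Re (coeff y (T + s k + (m k + n)) q1)"
        using yc(3)[of "T + s k" "m k + n" q1] by (simp add: q2_def)
      also have "\<dots> \<le> Re (coeff y (T + s k + (m k + n) + s k) q)"
        unfolding q1_def by (rule Suc.IH[OF q(1)])
      finally show ?case by (simp add: s(2) add.assoc)
    qed
    have "2 ^ k \<le> norm y" for k
    proof -
      \<comment> \<open>The starting coefficient is bounded below independently of \<open>k\<close>,
        because \<open>\<phi> (s k) x\<close> stays in \<open>V\<close>.\<close>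
      have "2 * (1/2)^0 \<le> Re (coeff y (m 0 + n) (\<phi> (s k) x))"
        by (rule order_trans[OF zN yc(2)]) (rule G(3)[OF G(1)])
      then have "2 ^ k * 2 \<le> 2 ^ k * Re (coeff y (m 0 + n) (\<phi> (s k) x))" by simp
      also have "\<dots> \<le> Re (coeff y (m 0 + n + s k) x)" by (rule grow[OF G(1)])
      also have "\<dots> \<le> norm y"
        by (rule order_trans[OF complex_Re_le_cmod coeff_bound[OF y(1)]])
      finally show ?thesis using zero_le_power[of "2::real" k] by linarith
    qed
    then show False using real_arch_pow[of 2 "norm y"] by (auto simp: not_less[symmetric])
  qed
qed

end


section \<open>The gauge action and Fejer means\<close>

definition torus_char :: "('d::finite \<Rightarrow> complex) \<Rightarrow> nat ^ 'd \<Rightarrow> complex" where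
  "torus_char \<omega> n = (\<Prod>j\<in>UNIV. \<omega> j ^ (n $ j))"

text \<open>The order \<open>Suc M\<close> is never 0, so the set is finite, and it suffices to
  separate exponents up to \<open>M\<close>.\<close>

definition roots_torus :: "nat \<Rightarrow> ('d::finite \<Rightarrow> complex) set" where
  "roots_torus M = {\<omega>. \<forall>j. \<omega> j ^ Suc M = 1}"

lemma torus_char_add: "torus_char \<omega> (n + m) = torus_char \<omega> n * torus_char \<omega> m"
  by (simp add: torus_char_def power_add prod.distrib)

lemma torus_char_zero: "torus_char \<omega> 0 = 1"
  by (simp add: torus_char_def)

lemma torus_char_cnj: "torus_char (\<lambda>j. cnj (\<omega> j)) n = cnj (torus_char \<omega> n)"
  by (simp add: torus_char_def)

definition unimodular :: "('d \<Rightarrow> complex) \<Rightarrow> bool" where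
  "unimodular \<omega> \<longleftrightarrow> (\<forall>j. cmod (\<omega> j) = 1)"

lemma unimodular_cnj: "unimodular \<omega> \<Longrightarrow> unimodular (\<lambda>j. cnj (\<omega> j))"
  by (simp add: unimodular_def)

lemma norm_torus_char: "unimodular \<omega> \<Longrightarrow> cmod (torus_char \<omega> n) = 1"
  by (simp add: unimodular_def torus_char_def norm_power flip: prod_norm)

lemma torus_char_mult_cnj: "unimodular \<omega> \<Longrightarrow> torus_char \<omega> n * cnj (torus_char \<omega> n) = 1"
  by (simp add: norm_torus_char flip: complex_norm_square)

lemma unimodular_roots_torus:
  assumes "\<omega> \<in> roots_torus M"
  shows "unimodular \<omega>"
  unfolding unimodular_def
proof
  fix j
  have "\<omega> j ^ Suc M = 1" using assms by (simp add: roots_torus_def)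
  then have "cmod (\<omega> j) ^ Suc M = 1 ^ Suc M" by (metis norm_one norm_power power_one)
  then show "cmod (\<omega> j) = 1" by (rule power_inject_base) auto
qed

lemma finite_roots_torus: "finite (roots_torus M :: ('d::finite \<Rightarrow> complex) set)"
proof -
  have "roots_torus M = (\<Pi>\<^sub>E j\<in>(UNIV :: 'd set). {z :: complex. z ^ Suc M = 1})"
    by (auto simp: roots_torus_def PiE_def Pi_def)
  moreover have "finite {z :: complex. z ^ Suc M = 1}"
    using bij_betw_finite[OF Complex.bij_betw_roots_unity[of "Suc M"]] by simp
  ultimately show ?thesis by (simp add: finite_PiE del: power_Suc)
qed

lemma card_roots_torus: "card (roots_torus M :: ('d::finite \<Rightarrow> complex) set) > 0"
proof -
  have "(\<lambda>_. 1) \<in> (roots_torus M :: ('d \<Rightarrow> complex) set)" by (simp add: roots_torus_def)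
  then show ?thesis using finite_roots_torus by (metis card_gt_0_iff empty_iff)
qed

text \<open>Multiplying one coordinate by a primitive root of unity permutes \<^const>\<open>roots_torus\<close>.\<close>

lemma torus_char_orthogonal:
  fixes p q :: "nat ^ 'd"
  assumes "\<And>j. p $ j < Suc M" "\<And>j. q $ j < Suc M"
  shows "(\<Sum>\<omega>\<in>roots_torus M. torus_char \<omega> p * cnj (torus_char \<omega> q))
    = (if p = q then of_nat (card (roots_torus M :: ('d \<Rightarrow> complex) set)) else 0)"
proof (cases "p = q")
  case True
  have "torus_char \<omega> q * cnj (torus_char \<omega> q) = 1" if "\<omega> \<in> roots_torus M" for \<omega> :: "'d \<Rightarrow> complex"
    by (rule torus_char_mult_cnj[OF unimodular_roots_torus[OF that]])
  then show ?thesis using True by simp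
next
  case False
  then obtain i where i: "p $ i \<noteq> q $ i" by (auto simp: vec_eq_iff)
  define \<zeta> where "\<zeta> = cis (2 * pi * real 1 / real (Suc M))"
  have bij: "bij_betw (\<lambda>k. cis (2 * pi * real k / real (Suc M))) {..<Suc M} {z. z ^ Suc M = 1}"
    by (rule Complex.bij_betw_roots_unity) simp
  have \<zeta>k: "\<zeta> ^ k = cis (2 * pi * real k / real (Suc M))" for k
  proof -
    have "\<zeta> ^ k = cis (real k * (2 * pi * real 1 / real (Suc M)))"
      unfolding \<zeta>_def by (rule Complex.DeMoivre)
    also have "real k * (2 * pi * real 1 / real (Suc M)) = 2 * pi * real k / real (Suc M)" by simp
    finally show ?thesis .
  qed
  have \<zeta>: "\<zeta> ^ Suc M = 1" "cmod \<zeta> = 1"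
    unfolding \<zeta>k by (simp_all add: \<zeta>_def)
  have "\<zeta> ^ p $ i \<noteq> \<zeta> ^ q $ i"
    unfolding \<zeta>k using inj_onD[OF bij_betw_imp_inj_on[OF bij], of "p $ i" "q $ i"] assms[of i] i by auto
  moreover have "cmod (\<zeta> ^ q $ i) = 1" by (simp add: norm_power \<zeta>(2))
  then have "\<zeta> ^ q $ i * cnj (\<zeta> ^ q $ i) = 1" by (metis complex_norm_square of_real_1 power_one)
  ultimately have ne: "\<zeta> ^ p $ i * cnj (\<zeta> ^ q $ i) \<noteq> 1"
    by (metis mult_cancel_right mult_zero_right zero_neq_one)
  define \<tau> where "\<tau> \<omega> = fun_upd \<omega> i (\<zeta> * \<omega> i)" for \<omega> :: "'d \<Rightarrow> complex"
  have char: "torus_char (\<tau> \<omega>) n = \<zeta> ^ n $ i * torus_char \<omega> n" for \<omega> n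
  proof -
    have "torus_char (\<tau> \<omega>) n = (\<Prod>j\<in>UNIV. (if j = i then \<zeta> ^ n $ i else 1) * \<omega> j ^ (n $ j))"
      unfolding torus_char_def by (rule prod.cong) (auto simp: \<tau>_def power_mult_distrib)
    then show ?thesis by (simp add: prod.distrib torus_char_def)
  qed
  have \<tau>: "bij_betw \<tau> (roots_torus M) (roots_torus M)"
  proof (rule bij_betw_byWitness[of _ "\<lambda>\<omega>. fun_upd \<omega> i (inverse \<zeta> * \<omega> i)"])
    have z: "\<zeta> \<noteq> 0" using \<zeta>(2) by auto
    show "\<forall>\<omega>\<in>roots_torus M. fun_upd (\<tau> \<omega>) i (inverse \<zeta> * \<tau> \<omega> i) = \<omega>"
      "\<forall>\<omega>\<in>roots_torus M. \<tau> (fun_upd \<omega> i (inverse \<zeta> * \<omega> i)) = \<omega>"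
      using z by (auto simp: \<tau>_def fun_eq_iff)
    show "\<tau> ` roots_torus M \<subseteq> roots_torus M"
      "(\<lambda>\<omega>. fun_upd \<omega> i (inverse \<zeta> * \<omega> i)) ` roots_torus M \<subseteq> roots_torus M"
      using \<zeta>(1) by (auto simp: \<tau>_def roots_torus_def power_mult_distrib power_inverse simp del: power_Suc)
  qed
  define X where "X = (\<Sum>\<omega>\<in>roots_torus M. torus_char \<omega> p * cnj (torus_char \<omega> q))"
  have "X = (\<Sum>\<omega>\<in>roots_torus M. torus_char (\<tau> \<omega>) p * cnj (torus_char (\<tau> \<omega>) q))"
    unfolding X_def by (rule sum.reindex_bij_betw[OF \<tau>, symmetric])
  also have "\<dots> = (\<zeta> ^ p $ i * cnj (\<zeta> ^ q $ i)) * X"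
    unfolding X_def sum_distrib_left by (rule sum.cong) (simp_all add: char mult_ac)
  finally have "X = 0" using ne by (metis mult_cancel_right1 mult.commute)
  then show ?thesis using False by (simp add: X_def)
qed

section \<open>Diagonal unitaries and gauge automorphisms\<close>

lemma
  fixes v :: "(nat ^ 'd, 'h::complex_normed_vector) ell2"
  assumes \<omega>: "unimodular \<omega>"
  defines "W \<equiv> \<lambda>v :: (nat ^ 'd, 'h) ell2. Abs_ell2 (\<lambda>k. torus_char \<omega> k *\<^sub>C Rep_ell2 v k)"
  shows Rep_torus_diagonal: "Rep_ell2 (W v) k = torus_char \<omega> k *\<^sub>C Rep_ell2 v k"
    and norm_torus_diagonal: "norm (W v) = norm v"
    and bounded_linear_torus_diagonal: "bounded_linear W"
proof -
  have n: "norm (torus_char \<omega> k *\<^sub>C x) = norm x" for k and x :: 'h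
    by (simp add: norm_scaleC norm_torus_char[OF \<omega>])
  have R: "Rep_ell2 (W v) = (\<lambda>k. torus_char \<omega> k *\<^sub>C Rep_ell2 v k)" for v
    unfolding W_def using Rep_ell2[of v] by (subst Abs_ell2_inverse) (simp_all add: n)
  show "Rep_ell2 (W v) k = torus_char \<omega> k *\<^sub>C Rep_ell2 v k" by (simp add: R)
  have N: "norm (W v) = norm v" for v by (simp add: norm_ell2.rep_eq R n)
  then show "norm (W v) = norm v" .
  show "bounded_linear W"
  proof (rule bounded_linear_intro[of _ 1])
    show "W (x + y) = W x + W y" for x y
      by (rule Rep_ell2_inject[THEN iffD1]) (simp add: R plus_ell2.rep_eq scaleC_add_right)
    show "W (r *\<^sub>R x) = r *\<^sub>R W x" for r x
      by (rule Rep_ell2_inject[THEN iffD1])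
        (simp add: R scaleR_ell2.rep_eq fun_eq_iff, simp add: scaleR_scaleC scaleC_scaleC mult.commute)
  qed (simp add: N)
qed

definition torus_op :: "('d::finite \<Rightarrow> complex) \<Rightarrow>
    (nat ^ 'd, 'h::complex_normed_vector) ell2 \<Rightarrow>\<^sub>L (nat ^ 'd, 'h) ell2" where
  "torus_op \<omega> = Blinfun (\<lambda>v. Abs_ell2 (\<lambda>k. torus_char \<omega> k *\<^sub>C Rep_ell2 v k))"

text \<open>Conjugation by a diagonal unitary: for unimodular \<open>\<omega>\<close> the operator
  on the right is the inverse of the one on the left.\<close>

definition gauge_aut :: "('d::finite \<Rightarrow> complex) \<Rightarrow> ((nat ^ 'd, 'h::complex_normed_vector) ell2 \<Rightarrow>\<^sub>L (nat ^ 'd, 'h) ell2) \<Rightarrow>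
    (nat ^ 'd, 'h) ell2 \<Rightarrow>\<^sub>L (nat ^ 'd, 'h) ell2" where
  "gauge_aut \<omega> a = torus_op \<omega> o\<^sub>L (a o\<^sub>L torus_op (\<lambda>j. cnj (\<omega> j)))"

lemma
  fixes v :: "(nat ^ 'd, 'h::complex_normed_vector) ell2"
  assumes "unimodular \<omega>"
  shows Rep_torus_op: "Rep_ell2 (torus_op \<omega> v) k = torus_char \<omega> k *\<^sub>C Rep_ell2 v k"
    and norm_torus_op: "norm (torus_op \<omega> v) = norm v"
  unfolding torus_op_def bounded_linear_Blinfun_apply[OF bounded_linear_torus_diagonal[OF assms]]
  by (rule Rep_torus_diagonal[OF assms], rule norm_torus_diagonal[OF assms])

lemma torus_op_cnj:
  assumes "unimodular \<omega>"
  shows "torus_op (\<lambda>j. cnj (\<omega> j)) (torus_op \<omega> v) = v"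
    and "torus_op \<omega> (torus_op (\<lambda>j. cnj (\<omega> j)) v) = v"
proof -
  note c = unimodular_cnj[OF assms] and 1 = torus_char_mult_cnj[OF assms]
  show "torus_op (\<lambda>j. cnj (\<omega> j)) (torus_op \<omega> v) = v" "torus_op \<omega> (torus_op (\<lambda>j. cnj (\<omega> j)) v) = v"
    by (rule Rep_ell2_inject[THEN iffD1],
      simp add: Rep_torus_op[OF assms] Rep_torus_op[OF c] fun_eq_iff scaleC_scaleC torus_char_cnj 1 mult.commute[of "cnj _"] scaleC_one)+
qed

lemma gauge_aut_compose:
  assumes "unimodular \<omega>"
  shows "gauge_aut \<omega> (a o\<^sub>L b) = gauge_aut \<omega> a o\<^sub>L gauge_aut \<omega> b"
  by (rule blinfun_eqI) (simp add: gauge_aut_def torus_op_cnj[OF assms])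

lemma gauge_aut_inverse:
  assumes "unimodular \<omega>"
  shows "gauge_aut \<omega> (gauge_aut (\<lambda>j. cnj (\<omega> j)) a) = a"
  by (rule blinfun_eqI) (simp add: gauge_aut_def torus_op_cnj[OF assms])

lemma gauge_aut_add: "gauge_aut \<omega> (a + b) = gauge_aut \<omega> a + gauge_aut \<omega> b"
  by (simp add: gauge_aut_def comp.add_left comp.add_right)

lemma gauge_aut_scaleC:
  assumes "unimodular \<omega>"
  shows "gauge_aut \<omega> (c *\<^sub>C a) = c *\<^sub>C gauge_aut \<omega> a"
proof (rule blinfun_eqI)
  fix v
  have "torus_op \<omega> (c *\<^sub>C w) = c *\<^sub>C torus_op \<omega> w" for w
    by (rule Rep_ell2_inject[THEN iffD1])
      (simp add: fun_eq_iff Rep_torus_op[OF assms] scaleC_ell2.rep_eq scaleC_scaleC mult.commute)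
  then show "gauge_aut \<omega> (c *\<^sub>C a) v = (c *\<^sub>C gauge_aut \<omega> a) v"
    by (simp add: gauge_aut_def scaleC_blinfun.rep_eq)
qed

lemma norm_gauge_le:
  assumes "unimodular \<omega>"
  shows "norm (gauge_aut \<omega> a) \<le> norm a"
proof (rule norm_blinfun_bound)
  show "norm (gauge_aut \<omega> a v) \<le> norm a * norm v" for v
    using norm_blinfun[of a "torus_op (\<lambda>j. cnj (\<omega> j)) v"]
    by (simp add: gauge_aut_def norm_torus_op[OF assms] norm_torus_op[OF unimodular_cnj[OF assms]])
qed simp

lemma bounded_linear_gauge: "bounded_linear (gauge_aut \<omega>)"
  unfolding gauge_aut_def by (rule bounded_linear_compose[OF comp.bounded_linear_right comp.bounded_linear_left])

section \<open>The Fejer kernel\<close>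

definition cube :: "nat \<Rightarrow> (nat ^ 'd) set" where
  "cube N = {k. \<forall>j. k $ j < N}"

lemma card_vec_less: "finite {k :: nat ^ 'd. \<forall>j. k $ j < u j}" "card {k :: nat ^ 'd. \<forall>j. k $ j < u j} = (\<Prod>j\<in>UNIV. u j)"
proof -
  have bij: "bij_betw (\<lambda>f. \<chi> j. f j) (\<Pi>\<^sub>E j\<in>UNIV. {..<u j}) {k :: nat ^ 'd. \<forall>j. k $ j < u j}"
    by (rule bij_betw_byWitness[of _ "\<lambda>k j. k $ j"]) (auto simp: vec_eq_iff fun_eq_iff PiE_def Pi_def)
  show "finite {k :: nat ^ 'd. \<forall>j. k $ j < u j}"
    using bij_betw_finite[OF bij] by (auto intro: finite_PiE)
  show "card {k :: nat ^ 'd. \<forall>j. k $ j < u j} = (\<Prod>j\<in>UNIV. u j)"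
    using bij_betw_same_card[OF bij] by (simp add: card_PiE)
qed

text \<open>
  The multiplicity of \<open>n\<close> is the \<open>n\<close>-th Fourier coefficient of the trigonometric polynomial
  \<open>\<Sum>(k, l)\<in>E. cnj \<chi>\<^sub>k \<cdot> \<chi>\<^sub>l\<close>; the Fejer kernel is the case \<open>E = cube N \<times> cube N\<close>.
\<close>

definition multiplicity_of :: "((nat ^ 'd) \<times> (nat ^ 'd)) set \<Rightarrow> nat ^ 'd \<Rightarrow> nat" where
  "multiplicity_of E n = card {e \<in> E. fst e + n = snd e}"

text \<open>As soon as \<open>N\<close> is at least every coordinate of \<open>n\<close>, the
  quotient is the Fejer weight, the product over \<open>j\<close> of
  \<open>1 - n $ j / Suc N\<close>.\<close>

lemma multiplicity_cube_tendsto: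
  fixes n :: "nat ^ 'd"
  shows "(\<lambda>N. real (multiplicity_of (cube (Suc N) \<times> cube (Suc N)) n) / real (card (cube (Suc N) :: (nat ^ 'd) set))) \<longlonglongrightarrow> 1"
proof -
  have m: "multiplicity_of (cube N \<times> cube N) n = (\<Prod>j\<in>UNIV. N - n $ j)" for N
  proof -
    have "bij_betw fst {e \<in> cube N \<times> cube N. fst e + n = snd e} {k. \<forall>j. k $ j < N - n $ j}"
      by (rule bij_betw_byWitness[of _ "\<lambda>k. (k, k + n)"]) (auto simp: cube_def less_diff_conv intro: add_lessD1)
    then show ?thesis
      unfolding multiplicity_of_def by (simp add: bij_betw_same_card card_vec_less)
  qed
  have "(\<lambda>N. real (multiplicity_of (cube (Suc N) \<times> cube (Suc N)) n) / real (card (cube (Suc N) :: (nat ^ 'd) set)))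
      = (\<lambda>N. \<Prod>j\<in>UNIV. real (Suc N - n $ j) / real (Suc N))"
    unfolding m by (simp add: cube_def card_vec_less prod_dividef)
  also have "\<dots> \<longlonglongrightarrow> (\<Prod>j\<in>(UNIV :: 'd set). 1)"
  proof (rule tendsto_prod)
    fix j :: 'd
    have "(\<lambda>N. 1 - real (n $ j) / real (Suc N)) \<longlonglongrightarrow> 1 - 0"
      by (intro tendsto_diff tendsto_const LIMSEQ_Suc lim_const_over_n)
    moreover have "\<forall>\<^sub>F N in sequentially. 1 - real (n $ j) / real (Suc N) = real (Suc N - n $ j) / real (Suc N)"
      using eventually_ge_at_top[of "n $ j"] by eventually_elim (simp add: of_nat_diff field_simps)
    ultimately show "(\<lambda>N. real (Suc N - n $ j) / real (Suc N)) \<longlonglongrightarrow> 1"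
      by (simp add: tendsto_cong)
  qed
  finally show ?thesis by simp
qed

section \<open>Gauge invariance of the radical and recovery from coefficients\<close>

context analytic_crossed_product
begin

text \<open>The matrix entry in row \<open>S\<close> and column \<open>T\<close> is multiplied by
  the character at \<open>S\<close> and the conjugate character at \<open>T\<close>, which for
  \<open>T \<le> S\<close> combine to the character at \<open>S - T\<close>.\<close>

lemma has_coeffs_gauge:
  assumes "unimodular \<omega>" and a: "has_coeffs a F"
  shows "has_coeffs (gauge_aut \<omega> a) (\<lambda>n x. torus_char \<omega> n * F n x)"
proof -
  note c = unimodular_cnj[OF assms(1)]
  have FC: "F n \<in> C0" for n using a by (simp add: has_coeffs_def)
  have "torus_char \<omega> S *\<^sub>C \<rho> (F (S - T) \<circ> \<phi> T) (torus_char (\<lambda>j. cnj (\<omega> j)) T *\<^sub>C w)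
      = \<rho> ((\<lambda>x. torus_char \<omega> (S - T) * F (S - T) x) \<circ> \<phi> T) w" if "T \<le> S" for S T w
  proof -
    have "torus_char \<omega> S = torus_char \<omega> (S - T) * torus_char \<omega> T"
      using torus_char_add[of \<omega> "S - T" T] that by (simp add: vec_diff_add_cancel)
    then have "torus_char \<omega> S * cnj (torus_char \<omega> T) = torus_char \<omega> (S - T)"
      by (simp add: torus_char_mult_cnj[OF assms(1)] mult.assoc)
    then show ?thesis
      using rho_scale[OF C0_phi'[OF FC]]
      by (simp add: rho_clinear[OF C0_phi'[OF FC]] scaleC_scaleC torus_char_cnj comp_def scaleC_blinfun.rep_eq)
  qed
  then have "Rep_ell2 (gauge_aut \<omega> a v) S
      = (\<Sum>T | T \<le> S. \<rho> ((\<lambda>x. torus_char \<omega> (S - T) * F (S - T) x) \<circ> \<phi> T) (Rep_ell2 v T))" for v S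
    using a by (simp add: gauge_aut_def Rep_torus_op[OF assms(1)] Rep_torus_op[OF c] has_coeffs_def
        cvec.scale_sum_right)
  then show ?thesis using FC by (simp add: has_coeffs_def C0_scale)
qed

lemma gauge_aut_monomial:
  assumes "unimodular \<omega>" "f \<in> C0"
  shows "gauge_aut \<omega> (U n f) = torus_char \<omega> n *\<^sub>C U n f"
proof (rule has_coeffs_eqI)
  show "has_coeffs (gauge_aut \<omega> (U n f)) (\<lambda>m x. torus_char \<omega> m * (if m = n then f x else 0))"
    by (rule has_coeffs_gauge[OF assms(1) has_coeffs_monomial[OF assms(2)]])
  have "(\<lambda>m x. torus_char \<omega> m * (if m = n then f x else 0)) = (\<lambda>m x. torus_char \<omega> n * (if m = n then f x else 0))"
    by (auto simp: fun_eq_iff)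
  then show "has_coeffs (torus_char \<omega> n *\<^sub>C U n f) (\<lambda>m x. torus_char \<omega> m * (if m = n then f x else 0))"
    using has_coeffs_scaleC[OF has_coeffs_monomial[OF assms(2)]] by simp
qed

lemma gauge_aut_mem:
  assumes "unimodular \<omega>" "a \<in> A"
  shows "gauge_aut \<omega> a \<in> A"
proof -
  have "A \<subseteq> gauge_aut \<omega> -` A"
  proof (rule A_subsetI)
    show "closed (gauge_aut \<omega> -` A)"
      by (intro closed_vimage closed_A linear_continuous_on bounded_linear_gauge)
    show "cvec.subspace (gauge_aut \<omega> -` A)"
    proof (rule cvec.subspaceI)
      show "0 \<in> gauge_aut \<omega> -` A" by (simp add: gauge_aut_def zero_mem comp.zero_left comp.zero_right)
    qed (simp_all add: gauge_aut_add gauge_aut_scaleC[OF assms(1)] add_closed scaleC_closed)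
  qed (simp add: gauge_aut_monomial[OF assms(1)] scaleC_closed monomial_mem)
  then show ?thesis using assms(2) by blast
qed

text \<open>Precomposition with a gauge automorphism, which maps \<open>A\<close> onto itself, turns
  an irreducible representation into another one on the same space. Applied to \<open>a\<close>, the
  twisted representation is the original one applied to \<open>gauge_aut \<omega> a\<close>.\<close>

lemma gauge_aut_jacobson_radical:
  assumes \<omega>: "unimodular \<omega>" and a: "a \<in> jacobson_radical A"
  shows "gauge_aut \<omega> a \<in> jacobson_radical A"
proof -
  have aA: "a \<in> A" using a by (simp add: jacobson_radical_def)
  note c = unimodular_cnj[OF \<omega>]
  have "gauge_aut \<omega> a \<in> P" if "primitive_ideal A P" for P
  proof -
    obtain V :: "((nat ^ 'd, 'h) ell2 \<Rightarrow>\<^sub>L (nat ^ 'd, 'h) ell2) set" and \<sigma>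
      where irr: "irreducible_rep A V \<sigma>" and P: "P = rep_kernel A V \<sigma>"
      using \<open>primitive_ideal A P\<close> unfolding primitive_ideal_def by blast
    define \<sigma>' where "\<sigma>' b = \<sigma> (gauge_aut \<omega> b)" for b
    have gA: "gauge_aut \<omega> b \<in> A" if "b \<in> A" for b by (rule gauge_aut_mem[OF \<omega> that])
    have surj: "\<exists>b'\<in>A. b = gauge_aut \<omega> b'" if "b \<in> A" for b
      using gauge_aut_mem[OF c that] gauge_aut_inverse[OF \<omega>, of b] by metis
    note rep = irr[unfolded irreducible_rep_def]
    have alg: "algebra_rep A V \<sigma>" using rep by blast
    have "algebra_rep A V \<sigma>'"
      unfolding algebra_rep_def \<sigma>'_def
    proof (intro conjI ballI allI)
      note alg' = alg[unfolded algebra_rep_def]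
      show "cvec.subspace V" using alg' by blast
      fix a v assume a: "a \<in> A" and v: "v \<in> V"
      show "\<sigma> (gauge_aut \<omega> a) v \<in> V" using alg' gA[OF a] v by blast
      show "\<sigma> (gauge_aut \<omega> a) (v + w) = \<sigma> (gauge_aut \<omega> a) v + \<sigma> (gauge_aut \<omega> a) w" if "w \<in> V" for w
        using alg' gA[OF a] v that by blast
      show "\<sigma> (gauge_aut \<omega> a) (c *\<^sub>C v) = c *\<^sub>C \<sigma> (gauge_aut \<omega> a) v" for c
        using alg' gA[OF a] v by blast
      show "\<sigma> (gauge_aut \<omega> (c *\<^sub>C a)) v = c *\<^sub>C \<sigma> (gauge_aut \<omega> a) v" for c
        unfolding gauge_aut_scaleC[OF \<omega>] using alg' gA[OF a] v by blast
      show "\<sigma> (gauge_aut \<omega> (a + b)) v = \<sigma> (gauge_aut \<omega> a) v + \<sigma> (gauge_aut \<omega> b) v" if "b \<in> A" for b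
        unfolding gauge_aut_add using alg' gA[OF a] gA[OF that] v by blast
      show "\<sigma> (gauge_aut \<omega> (a o\<^sub>L b)) v = \<sigma> (gauge_aut \<omega> a) (\<sigma> (gauge_aut \<omega> b) v)" if "b \<in> A" for b
        unfolding gauge_aut_compose[OF \<omega>] using alg' gA[OF a] gA[OF that] v by blast
    qed
    moreover have "\<exists>b\<in>A. \<exists>v\<in>V. \<sigma>' b v \<noteq> 0"
    proof -
      obtain b v where b: "b \<in> A" "v \<in> V" "\<sigma> b v \<noteq> 0" using rep by blast
      obtain b' where "b' \<in> A" "b = gauge_aut \<omega> b'" using surj[OF b(1)] by blast
      then show ?thesis using b by (auto simp: \<sigma>'_def)
    qed
    moreover have "W = {0} \<or> W = V"
      if W: "cvec.subspace W" "W \<subseteq> V" "\<forall>b\<in>A. \<forall>w\<in>W. \<sigma>' b w \<in> W" for W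
    proof -
      have "\<forall>b\<in>A. \<forall>w\<in>W. \<sigma> b w \<in> W"
      proof (intro ballI)
        fix b w assume b: "b \<in> A" and w: "w \<in> W"
        obtain b' where "b' \<in> A" "b = gauge_aut \<omega> b'" using surj[OF b] by blast
        then show "\<sigma> b w \<in> W" using W(3) w by (simp add: \<sigma>'_def)
      qed
      then show ?thesis using conjunct2[OF conjunct2[OF rep]] W(1,2) by simp
    qed
    ultimately have "irreducible_rep A V \<sigma>'"
      unfolding irreducible_rep_def by simp
    then have "a \<in> rep_kernel A V \<sigma>'"
      using a unfolding jacobson_radical_def primitive_ideal_def by blast
    then show ?thesis using gA[OF aA] by (simp add: P rep_kernel_def \<sigma>'_def)
  qed
  then show ?thesis using gauge_aut_mem[OF \<omega> aA] by (simp add: jacobson_radical_def)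
qed

text \<open>The uniform bound makes the set of convergence a closed subspace. The lemma serves two
  limits, that of the averages over roots of unity and that of the Fejer means.\<close>

lemma A_tendsto_zeroI:
  fixes \<Delta> :: "nat \<Rightarrow> ((nat ^ 'd, 'h) ell2 \<Rightarrow>\<^sub>L (nat ^ 'd, 'h) ell2) \<Rightarrow> (nat ^ 'd, 'h) ell2 \<Rightarrow>\<^sub>L (nat ^ 'd, 'h) ell2"
  assumes add: "\<And>M a b. a \<in> A \<Longrightarrow> b \<in> A \<Longrightarrow> \<Delta> M (a + b) = \<Delta> M a + \<Delta> M b"
    and scale: "\<And>M a c. a \<in> A \<Longrightarrow> \<Delta> M (c *\<^sub>C a) = c *\<^sub>C \<Delta> M a"
    and bound: "\<And>M a. a \<in> A \<Longrightarrow> norm (\<Delta> M a) \<le> C * norm a"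
    and mono: "\<And>n f. f \<in> C0 \<Longrightarrow> (\<lambda>M. \<Delta> M (U n f)) \<longlonglongrightarrow> 0"
    and a: "a \<in> A"
  shows "(\<lambda>M. \<Delta> M a) \<longlonglongrightarrow> 0"
proof -
  define S where "S = {a\<in>A. (\<lambda>M. \<Delta> M a) \<longlonglongrightarrow> 0}"
  have "A \<subseteq> S"
  proof (rule A_subsetI)
    show "closed S"
      unfolding closed_sequential_limits
    proof (intro allI impI, elim conjE)
      fix u l assume u: "\<forall>i. u i \<in> S" and lim: "u \<longlonglongrightarrow> l"
      have uA: "u i \<in> A" and u0: "(\<lambda>M. \<Delta> M (u i)) \<longlonglongrightarrow> 0" for i using u by (auto simp: S_def)
      have lA: "l \<in> A" by (rule closed_sequentially[OF closed_A uA lim])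
      have "(\<lambda>M. \<Delta> M l) \<longlonglongrightarrow> 0"
      proof (rule LIMSEQ_I)
        fix e :: real assume e: "e > 0"
        define K where "K = \<bar>C\<bar> + 1"
        have K: "K > 0" by (simp add: K_def add_nonneg_pos)
        define d where "d = e / 2 / K"
        have d: "d > 0" using e K by (simp add: d_def)
        obtain i where i: "norm (u i - l) < d" using LIMSEQ_D[OF lim d] by blast
        obtain M0 where M0: "\<And>M. M \<ge> M0 \<Longrightarrow> norm (\<Delta> M (u i)) < e / 2"
          using LIMSEQ_D[OF u0 half_gt_zero[OF e]] by force
        have "norm (\<Delta> M l) < e" if "M \<ge> M0" for M
        proof -
          have dA: "l - u i \<in> A" by (rule cvec.subspace_diff[OF subspace_A lA uA])
          have "norm (\<Delta> M (l - u i)) \<le> C * norm (l - u i)" by (rule bound[OF dA])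
          also have "\<dots> \<le> K * norm (l - u i)" by (intro mult_right_mono) (auto simp: K_def)
          also have "\<dots> \<le> K * d"
            using i K by (intro mult_left_mono) (auto simp: norm_minus_commute)
          also have "\<dots> = e / 2" using K by (simp add: d_def)
          finally have "norm (\<Delta> M (l - u i)) \<le> e / 2" .
          moreover have "\<Delta> M l = \<Delta> M (l - u i) + \<Delta> M (u i)"
            using add[OF dA uA, of M i] by simp
          ultimately show ?thesis
            using norm_triangle_ineq[of "\<Delta> M (l - u i)" "\<Delta> M (u i)"] M0[OF that] by simp
        qed
        then show "\<exists>M0. \<forall>M\<ge>M0. norm (\<Delta> M l - 0) < e" by auto
      qed
      then show "l \<in> S" using lA by (simp add: S_def)
    qed
    show "cvec.subspace S"
    proof (rule cvec.subspaceI)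
      have "\<Delta> M 0 = 0" for M using scale[OF zero_mem, of M 0] by simp
      then show "0 \<in> S" by (simp add: S_def zero_mem)
      show "b + b' \<in> S" if "b \<in> S" "b' \<in> S" for b b'
        using that tendsto_add[of "\<lambda>M. \<Delta> M b" 0 _ "\<lambda>M. \<Delta> M b'" 0] by (simp add: S_def add_closed add)
      show "c *\<^sub>C b \<in> S" if "b \<in> S" for c b
        using that bounded_linear.tendsto[OF bounded_linear_scaleC, of "\<lambda>M. \<Delta> M b" 0 _ c]
        by (simp add: S_def scaleC_closed scale)
    qed
  qed (simp add: S_def monomial_mem mono)
  then show ?thesis using a by (auto simp: S_def)
qed

text \<open>The kernel is the conjugate of the trigonometric polynomial attached to
  \<open>E\<close>, so that its average against the character of degree \<open>n\<close> is
  \<open>multiplicity_of E n\<close> for large \<open>M\<close>.\<close>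

definition gauge_mean :: "((nat ^ 'd) \<times> (nat ^ 'd)) set \<Rightarrow> nat \<Rightarrow>
    ((nat ^ 'd, 'h) ell2 \<Rightarrow>\<^sub>L (nat ^ 'd, 'h) ell2) \<Rightarrow> (nat ^ 'd, 'h) ell2 \<Rightarrow>\<^sub>L (nat ^ 'd, 'h) ell2" where
  "gauge_mean E M a = (1 / of_nat (card (roots_torus M :: ('d \<Rightarrow> complex) set))) *\<^sub>C
     (\<Sum>\<omega>\<in>roots_torus M. (\<Sum>(k, l)\<in>E. torus_char \<omega> k * cnj (torus_char \<omega> l)) *\<^sub>C gauge_aut \<omega> a)"

text \<open>The limit of \<open>gauge_mean E M\<close> for large \<open>M\<close>. The index set is
  finite when \<open>E\<close> is, and contains every degree of nonzero multiplicity, since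
  \<open>k + n = l\<close> forces \<open>n \<le> l\<close>.\<close>

definition fourier_sum :: "((nat ^ 'd) \<times> (nat ^ 'd)) set \<Rightarrow>
    ((nat ^ 'd, 'h) ell2 \<Rightarrow>\<^sub>L (nat ^ 'd, 'h) ell2) \<Rightarrow> (nat ^ 'd, 'h) ell2 \<Rightarrow>\<^sub>L (nat ^ 'd, 'h) ell2" where
  "fourier_sum E a = (\<Sum>n\<in>(\<Union>(k, l)\<in>E. {n. n \<le> l}). of_nat (multiplicity_of E n) *\<^sub>C U n (coeff a n))"

lemma gauge_mean_add: "gauge_mean E M (a + b) = gauge_mean E M a + gauge_mean E M b"
  by (simp add: gauge_mean_def gauge_aut_add scaleC_add_right sum.distrib)

lemma gauge_mean_scaleC: "gauge_mean E M (c *\<^sub>C a) = c *\<^sub>C gauge_mean E M a"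
proof -
  have "(\<Sum>\<omega>\<in>roots_torus M. (\<Sum>(k, l)\<in>E. torus_char \<omega> k * cnj (torus_char \<omega> l)) *\<^sub>C gauge_aut \<omega> (c *\<^sub>C a))
      = c *\<^sub>C (\<Sum>\<omega>\<in>roots_torus M. (\<Sum>(k, l)\<in>E. torus_char \<omega> k * cnj (torus_char \<omega> l)) *\<^sub>C gauge_aut \<omega> a)"
    unfolding cvec.scale_sum_right
    by (rule sum.cong) (simp_all add: gauge_aut_scaleC[OF unimodular_roots_torus] scaleC_scaleC mult.commute)
  then show ?thesis by (simp add: gauge_mean_def scaleC_scaleC mult.commute)
qed

lemma norm_gauge_mean_le:
  "norm (gauge_mean E M a) \<le> (\<Sum>\<omega>\<in>roots_torus M. cmod (\<Sum>(k, l)\<in>E. torus_char \<omega> k * cnj (torus_char \<omega> l)))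
    / card (roots_torus M :: ('d \<Rightarrow> complex) set) * norm a"
proof -
  have "norm (\<Sum>\<omega>\<in>roots_torus M. (\<Sum>(k, l)\<in>E. torus_char \<omega> k * cnj (torus_char \<omega> l)) *\<^sub>C gauge_aut \<omega> a)
      \<le> (\<Sum>\<omega>\<in>roots_torus M. cmod (\<Sum>(k, l)\<in>E. torus_char \<omega> k * cnj (torus_char \<omega> l)) * norm a)"
    by (intro sum_norm_le) (simp add: norm_scaleC mult_left_mono norm_gauge_le[OF unimodular_roots_torus])
  then show ?thesis
    unfolding gauge_mean_def norm_scaleC by (simp add: norm_divide divide_right_mono flip: sum_distrib_right)
qed

lemma norm_gauge_mean_le_card: "norm (gauge_mean E M a) \<le> card E * norm a"
proof -
  define \<kappa> where "\<kappa> \<omega> = (\<Sum>(k, l)\<in>E. torus_char \<omega> k * cnj (torus_char \<omega> l))" for \<omega> :: "'d \<Rightarrow> complex"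
  have "cmod (\<kappa> \<omega>) \<le> card E" if "\<omega> \<in> roots_torus M" for \<omega> :: "'d \<Rightarrow> complex"
  proof -
    have "cmod (\<kappa> \<omega>) \<le> (\<Sum>e\<in>E. 1)"
      unfolding \<kappa>_def
      by (rule sum_norm_le) (auto simp: norm_mult norm_torus_char[OF unimodular_roots_torus[OF that]])
    then show ?thesis by simp
  qed
  then have "(\<Sum>\<omega>\<in>roots_torus M. cmod (\<kappa> \<omega>)) \<le> card (roots_torus M :: ('d \<Rightarrow> complex) set) * real (card E)"
    by (rule sum_bounded_above)
  then have "(\<Sum>\<omega>\<in>roots_torus M. cmod (\<kappa> \<omega>)) / card (roots_torus M :: ('d \<Rightarrow> complex) set) \<le> card E"
    using card_roots_torus[where 'd = 'd, of M] by (simp add: divide_le_eq mult.commute)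
  then show ?thesis
    using norm_gauge_mean_le[of E M a] unfolding \<kappa>_def by (meson mult_right_mono norm_ge_zero order_trans)
qed

text \<open>The bounds on the coordinates exclude aliasing, so by orthogonality only the pairs with
  \<open>k + m = l\<close> survive.\<close>

lemma sum_kernel:
  fixes m :: "nat ^ 'd"
  assumes "finite E" "\<And>k l j. (k, l) \<in> E \<Longrightarrow> k $ j + m $ j < Suc M \<and> l $ j < Suc M"
  shows "(\<Sum>\<omega>\<in>roots_torus M. (\<Sum>(k, l)\<in>E. torus_char \<omega> k * cnj (torus_char \<omega> l)) * torus_char \<omega> m)
    = of_nat (card (roots_torus M :: ('d \<Rightarrow> complex) set)) * of_nat (multiplicity_of E m)"
proof -
  have "(\<Sum>\<omega>\<in>roots_torus M. (\<Sum>(k, l)\<in>E. torus_char \<omega> k * cnj (torus_char \<omega> l)) * torus_char \<omega> m)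
      = (\<Sum>e\<in>E. \<Sum>\<omega>\<in>roots_torus M. torus_char \<omega> (fst e + m) * cnj (torus_char \<omega> (snd e)))"
    unfolding sum_distrib_right case_prod_unfold torus_char_add by (subst sum.swap) (simp add: mult_ac)
  also have "\<dots> = (\<Sum>e\<in>E. if fst e + m = snd e then of_nat (card (roots_torus M :: ('d \<Rightarrow> complex) set)) else 0)"
    using assms(2) by (intro sum.cong refl torus_char_orthogonal) auto
  also have "\<dots> = of_nat (card (roots_torus M :: ('d \<Rightarrow> complex) set)) * of_nat (multiplicity_of E m)"
    using assms(1) by (simp add: multiplicity_of_def sum.If_cases Int_def mult.commute conj_commute)
  finally show ?thesis .
qed

lemma gauge_mean_monomial:
  assumes "finite E" "\<And>k l j. (k, l) \<in> E \<Longrightarrow> k $ j + m $ j < Suc M \<and> l $ j < Suc M" "f \<in> C0"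
  shows "gauge_mean E M (U m f) = of_nat (multiplicity_of E m) *\<^sub>C U m f"
proof -
  have "(\<Sum>\<omega>\<in>roots_torus M. (\<Sum>(k, l)\<in>E. torus_char \<omega> k * cnj (torus_char \<omega> l)) *\<^sub>C gauge_aut \<omega> (U m f))
      = (\<Sum>\<omega>\<in>roots_torus M. ((\<Sum>(k, l)\<in>E. torus_char \<omega> k * cnj (torus_char \<omega> l)) * torus_char \<omega> m) *\<^sub>C U m f)"
    by (rule sum.cong) (simp_all add: gauge_aut_monomial[OF unimodular_roots_torus assms(3)] scaleC_scaleC)
  also have "\<dots> = (of_nat (card (roots_torus M :: ('d \<Rightarrow> complex) set)) * of_nat (multiplicity_of E m)) *\<^sub>C U m f"
    by (rule trans[OF cvec.scale_sum_left[symmetric]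
          arg_cong[OF sum_kernel[OF assms(1,2)], of "\<lambda>c. c *\<^sub>C U m f"]])
  finally show ?thesis
    using card_roots_torus[where 'd = 'd, of M] by (simp add: gauge_mean_def scaleC_scaleC)
qed

lemma finite_fourier_index: "finite E \<Longrightarrow> finite (\<Union>(k, l)\<in>E. {n :: nat ^ 'd. n \<le> l})"
  by (auto simp: finite_vec_le)

lemma fourier_sum_monomial:
  assumes E: "finite E" and f: "f \<in> C0"
  shows "fourier_sum E (U m f) = of_nat (multiplicity_of E m) *\<^sub>C U m f"
proof -
  let ?D = "\<Union>(k, l)\<in>E. {n. n \<le> l}"
  have "coeff (U m f) n = (if n = m then f else (\<lambda>_. 0))" for n
    by (auto simp: fun_eq_iff coeff_monomial[OF f])
  then have "fourier_sum E (U m f) = (\<Sum>n\<in>?D. if n = m then of_nat (multiplicity_of E m) *\<^sub>C U m f else 0)"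
    unfolding fourier_sum_def by (intro sum.cong) (auto simp: monomial_zero)
  also have "\<dots> = (if m \<in> ?D then of_nat (multiplicity_of E m) *\<^sub>C U m f else 0)"
    by (rule sum.delta[OF finite_fourier_index[OF E]])
  also have "\<dots> = of_nat (multiplicity_of E m) *\<^sub>C U m f"
  proof (cases "m \<in> ?D")
    case False
    have "{e \<in> E. fst e + m = snd e} = {}"
    proof (rule ccontr)
      assume "{e \<in> E. fst e + m = snd e} \<noteq> {}"
      then obtain k where "(k, k + m) \<in> E" by force
      moreover have "m \<le> k + m" by (rule vec_le_add)
      ultimately show False using False by blast
    qed
    then have "multiplicity_of E m = 0" unfolding multiplicity_of_def by (simp only: card.empty)
    then show ?thesis by simp
  qed simp
  finally show ?thesis .
qed

lemma monomial_coeff_add: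
  assumes "a \<in> A" "b \<in> A"
  shows "U n (coeff (a + b) n) = U n (coeff a n) + U n (coeff b n)"
proof -
  have "coeff (a + b) n = (\<lambda>x. coeff a n x + coeff b n x)"
    by (rule ext) (rule coeff_add[OF assms])
  then show ?thesis by (simp add: monomial_add coeff_C0 assms)
qed

lemma monomial_coeff_scaleC:
  assumes "a \<in> A"
  shows "U n (coeff (c *\<^sub>C a) n) = c *\<^sub>C U n (coeff a n)"
proof -
  have "coeff (c *\<^sub>C a) n = (\<lambda>x. c * coeff a n x)"
    by (rule ext) (rule coeff_scaleC[OF assms])
  then show ?thesis by (simp add: monomial_scale coeff_C0 assms)
qed

lemma norm_monomial_coeff: "a \<in> A \<Longrightarrow> norm (U n (coeff a n)) \<le> norm a"
  by (rule norm_monomial_leI[OF coeff_C0 coeff_bound])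

lemma fourier_sum_add: "a \<in> A \<Longrightarrow> b \<in> A \<Longrightarrow> fourier_sum E (a + b) = fourier_sum E a + fourier_sum E b"
  by (simp add: fourier_sum_def monomial_coeff_add scaleC_add_right sum.distrib)

lemma fourier_sum_scaleC: "a \<in> A \<Longrightarrow> fourier_sum E (c *\<^sub>C a) = c *\<^sub>C fourier_sum E a"
  by (simp add: fourier_sum_def monomial_coeff_scaleC cvec.scale_sum_right scaleC_scaleC mult.commute)

lemma norm_fourier_sum_le:
  assumes "a \<in> A"
  shows "norm (fourier_sum E a) \<le> (\<Sum>n\<in>(\<Union>(k, l)\<in>E. {n. n \<le> l}). real (multiplicity_of E n)) * norm a"
  unfolding fourier_sum_def sum_distrib_right
  by (rule sum_norm_le) (simp add: norm_scaleC mult_left_mono norm_monomial_coeff[OF assms])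

text \<open>On a fixed monomial the discrete average is exact once \<open>M\<close> is beyond all
  degrees involved; bounds that are crude but independent of \<open>M\<close> extend the convergence
  to \<open>A\<close>.\<close>

lemma gauge_mean_tendsto:
  assumes E: "finite E" and a: "a \<in> A"
  shows "(\<lambda>M. gauge_mean E M a) \<longlonglongrightarrow> fourier_sum E a"
proof -
  define C where "C = card E + (\<Sum>n\<in>(\<Union>(k, l)\<in>E. {n. n \<le> l}). real (multiplicity_of E n))"
  have "(\<lambda>M. gauge_mean E M a - fourier_sum E a) \<longlonglongrightarrow> 0"
  proof (rule A_tendsto_zeroI[where C = C, OF _ _ _ _ a])
    show "norm (gauge_mean E M b - fourier_sum E b) \<le> C * norm b" if "b \<in> A" for M b
      using norm_triangle_ineq4[of "gauge_mean E M b" "fourier_sum E b"]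
        norm_gauge_mean_le_card[of E M b] norm_fourier_sum_le[OF that, of E]
      by (simp add: C_def distrib_right)
    show "(\<lambda>M. gauge_mean E M (U m f) - fourier_sum E (U m f)) \<longlonglongrightarrow> 0" if f: "f \<in> C0" for m f
    proof -
      define M0 where "M0 = (\<Sum>(k, l)\<in>E. \<Sum>j\<in>UNIV. k $ j + m $ j + l $ j)"
      have "gauge_mean E M (U m f) = fourier_sum E (U m f)" if M: "M \<ge> M0" for M
        unfolding fourier_sum_monomial[OF E f]
      proof (rule gauge_mean_monomial[OF E _ f])
        fix k l j assume kl: "(k, l) \<in> E"
        have "k $ j + m $ j + l $ j \<le> (\<Sum>j\<in>UNIV. k $ j + m $ j + l $ j)"
          by (rule member_le_sum[of j UNIV "\<lambda>j. k $ j + m $ j + l $ j"]) auto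
        also have "\<dots> \<le> M0"
          unfolding M0_def using member_le_sum[of "(k, l)" E "\<lambda>(k, l). \<Sum>j\<in>UNIV. k $ j + m $ j + l $ j"] kl E by auto
        finally show "k $ j + m $ j < Suc M \<and> l $ j < Suc M" using M by simp
      qed
      then show ?thesis
        by (intro tendsto_eventually) (auto simp: eventually_sequentially)
    qed
  qed (simp_all add: gauge_mean_add gauge_mean_scaleC fourier_sum_add fourier_sum_scaleC
      cvec.scale_right_diff_distrib add_diff_add)
  then show ?thesis by (rule LIM_zero_cancel)
qed

text \<open>For the single pair \<open>(0, n)\<close> the limit is the component of degree
  \<open>n\<close>. The averages are combinations of gauge translates of \<open>a\<close>, hence in
  the radical, which is closed.\<close>

lemma monomial_coeff_jacobson_radical:
  assumes a: "a \<in> jacobson_radical A"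
  shows "U n (coeff a n) \<in> jacobson_radical A"
proof -
  define E where "E = {(0 :: nat ^ 'd, n)}"
  note sub = ideal_subspace[OF ideal_jacobson_radical]
  have aA: "a \<in> A" using a by (simp add: jacobson_radical_def)
  have mult: "multiplicity_of E m = (if m = n then 1 else 0)" for m
  proof -
    have "{e \<in> E. fst e + m = snd e} = (if m = n then {(0, n)} else {})" by (auto simp: E_def)
    then show ?thesis by (simp add: multiplicity_of_def)
  qed
  have "fourier_sum E a = (\<Sum>m | m \<le> n. if m = n then U n (coeff a n) else 0)"
    unfolding fourier_sum_def by (intro sum.cong) (auto simp: E_def mult[unfolded E_def] scaleC_one)
  also have "\<dots> = U n (coeff a n)" by (simp add: sum.delta[OF finite_vec_le])
  finally have lim: "(\<lambda>M. gauge_mean E M a) \<longlonglongrightarrow> U n (coeff a n)"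
    using gauge_mean_tendsto[OF _ aA, of E] by (simp add: E_def)
  have "gauge_mean E M a \<in> jacobson_radical A" for M
    unfolding gauge_mean_def
    by (intro cvec.subspace_scale[OF sub] cvec.subspace_sum[OF sub] gauge_aut_jacobson_radical[OF unimodular_roots_torus a])
  then show ?thesis
    by (rule closed_sequentially[OF closed_jacobson_radical[OF operator_algebra_axioms closed_A] _ lim])
qed

text \<open>The Fejer kernel is the squared modulus of a sum of characters, so its mean absolute
  value equals its mean, the multiplicity of degree 0. The bound by \<open>card E\<close> would give
  the square of this number, too much to survive the normalisation.\<close>

lemma norm_fejer_sum_le:
  assumes a: "a \<in> A"
  shows "norm (fourier_sum (cube N \<times> cube N) a) \<le> card (cube N :: (nat ^ 'd) set) * norm a"
proof (rule tendsto_upperbound)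
  let ?B = "cube N :: (nat ^ 'd) set"
  have fin: "finite ?B" by (simp add: cube_def card_vec_less)
  show "(\<lambda>M. norm (gauge_mean (?B \<times> ?B) M a)) \<longlonglongrightarrow> norm (fourier_sum (?B \<times> ?B) a)"
    by (intro tendsto_norm gauge_mean_tendsto a) (simp add: fin)
  have "norm (gauge_mean (?B \<times> ?B) M a) \<le> card ?B * norm a" if M: "M \<ge> N" for M
  proof -
    define \<kappa> where "\<kappa> \<omega> = (\<Sum>(k, l)\<in>?B \<times> ?B. torus_char \<omega> k * cnj (torus_char \<omega> l))" for \<omega>
    have "\<kappa> \<omega> = complex_of_real ((cmod (\<Sum>k\<in>?B. torus_char \<omega> k))\<^sup>2)" for \<omega>
      unfolding complex_norm_square \<kappa>_def by (simp add: sum_product sum.cartesian_product)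
    then have "complex_of_real (cmod (\<kappa> \<omega>)) = \<kappa> \<omega>" for \<omega>
      by (simp del: of_real_power)
    then have "complex_of_real (\<Sum>\<omega>\<in>roots_torus M. cmod (\<kappa> \<omega>)) = (\<Sum>\<omega>\<in>roots_torus M. \<kappa> \<omega> * torus_char \<omega> 0)"
      by (simp add: torus_char_zero)
    also have "\<dots> = of_nat (card (roots_torus M :: ('d \<Rightarrow> complex) set)) * of_nat (multiplicity_of (?B \<times> ?B) 0)"
      unfolding \<kappa>_def using M fin by (intro sum_kernel) (auto simp: cube_def intro: less_le_trans)
    also have "multiplicity_of (?B \<times> ?B) 0 = card ?B"
    proof -
      have "bij_betw fst {e \<in> ?B \<times> ?B. fst e + 0 = snd e} ?B"
        by (rule bij_betw_byWitness[of _ "\<lambda>k. (k, k)"]) auto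
      then show ?thesis unfolding multiplicity_of_def by (rule bij_betw_same_card)
    qed
    finally have "(\<Sum>\<omega>\<in>roots_torus M. cmod (\<kappa> \<omega>)) = card (roots_torus M :: ('d \<Rightarrow> complex) set) * real (card ?B)"
      by (metis (mono_tags, lifting) of_nat_mult of_real_eq_iff of_real_of_nat_eq)
    then have "(\<Sum>\<omega>\<in>roots_torus M. cmod (\<kappa> \<omega>)) / card (roots_torus M :: ('d \<Rightarrow> complex) set) = card ?B"
      using card_roots_torus[where 'd = 'd, of M] by simp
    then show ?thesis using norm_gauge_mean_le[of "?B \<times> ?B" M a] unfolding \<kappa>_def by simp
  qed
  then show "\<forall>\<^sub>F M in sequentially. norm (gauge_mean (?B \<times> ?B) M a) \<le> card ?B * norm a"
    unfolding eventually_sequentially by blast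
qed simp

text \<open>The normalised Fejer means are contractions that converge to the identity on monomials,
  hence on all of \<open>A\<close>, and each mean of \<open>a\<close> is a finite combination of the
  given monomials.\<close>

lemma closed_subspace_memI:
  assumes I: "cvec.subspace I" "closed I" and a: "a \<in> A" and mem: "\<And>n. U n (coeff a n) \<in> I"
  shows "a \<in> I"
proof -
  define B where "B N = (cube (Suc N) :: (nat ^ 'd) set)" for N
  define c where "c N = complex_of_real (1 / real (card (B N)))" for N
  define F where "F N b = c N *\<^sub>C fourier_sum (B N \<times> B N) b" for N b
  have fin: "finite (B N)" for N by (simp add: B_def cube_def card_vec_less)
  have card: "card (B N) > 0" for N by (simp add: B_def cube_def card_vec_less)
  have cn: "cmod (c N) = 1 / real (card (B N))" for N by (simp add: c_def norm_divide)
  have Fn: "norm (F N b) \<le> norm b" if "b \<in> A" for N b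
  proof -
    have "norm (F N b) \<le> cmod (c N) * (card (B N) * norm b)"
      unfolding F_def norm_scaleC using norm_fejer_sum_le[OF that, of "Suc N"]
      by (intro mult_left_mono) (auto simp: B_def)
    then show ?thesis using card[of N] by (simp add: cn)
  qed
  have "(\<lambda>N. F N a - a) \<longlonglongrightarrow> 0"
  proof (rule A_tendsto_zeroI[where C = 2, OF _ _ _ _ a])
    show "norm (F N b - b) \<le> 2 * norm b" if "b \<in> A" for N b
      using norm_triangle_ineq4[of "F N b" b] Fn[OF that, of N] by simp
    show "(\<lambda>N. F N (U n f) - U n f) \<longlonglongrightarrow> 0" if f: "f \<in> C0" for n f
    proof -
      have "F N (U n f) = (real (multiplicity_of (B N \<times> B N) n) / real (card (B N))) *\<^sub>R U n f" for N
        unfolding F_def using fin[of N]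
        by (simp add: fourier_sum_monomial[OF _ f] scaleC_scaleC scaleR_scaleC c_def mult.commute)
      moreover have "(\<lambda>N. (real (multiplicity_of (B N \<times> B N) n) / real (card (B N))) *\<^sub>R U n f) \<longlonglongrightarrow> 1 *\<^sub>R U n f"
        unfolding B_def by (intro tendsto_scaleR multiplicity_cube_tendsto tendsto_const)
      ultimately show ?thesis by (simp add: LIM_zero)
    qed
  qed (simp_all add: F_def fourier_sum_add fourier_sum_scaleC scaleC_add_right scaleC_scaleC
      mult.commute cvec.scale_right_diff_distrib add_diff_add)
  then have lim: "(\<lambda>N. F N a) \<longlonglongrightarrow> a" by (rule LIM_zero_cancel)
  have "F N a \<in> I" for N
    unfolding F_def fourier_sum_def by (intro cvec.subspace_scale[OF I(1)] cvec.subspace_sum[OF I(1)] mem)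
  then show ?thesis by (rule closed_sequentially[OF I(2) _ lim])
qed

end

theorem theorem18:
  fixes \<phi> :: "nat ^ 'd \<Rightarrow> 'x::metric_space \<Rightarrow> 'x"
    and \<rho> :: "('x \<Rightarrow> complex) \<Rightarrow> 'h::chilbert_space \<Rightarrow>\<^sub>L 'h"
    and A :: "((nat ^ 'd, 'h) ell2 \<Rightarrow>\<^sub>L (nat ^ 'd, 'h) ell2) set"
  assumes "locally compact (UNIV :: 'x set)"
    and "dynamical_system \<phi>"
    and "faithful_star_rep \<rho>"
    and "A = crossed_product \<phi> \<rho>"
  shows "jacobson_radical A = closed_ideal_generated A
      {monomial \<phi> \<rho> n f | n f. n \<noteq> 0 \<and> f \<in> C0 \<and> (\<forall>x\<in>recurrent \<phi> {j. n $ j \<noteq> 0}. f x = 0)}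
    \<and> (prime_radical A = jacobson_radical A \<longleftrightarrow> closed (prime_radical A))"
proof -
  interpret X: analytic_crossed_product \<phi> \<rho>
    using assms(2,3) by unfold_locales
  let ?G = "{monomial \<phi> \<rho> n f | n f. n \<noteq> 0 \<and> f \<in> C0 \<and> (\<forall>x\<in>recurrent \<phi> {j. n $ j \<noteq> 0}. f x = 0)}"
  have alg: "operator_algebra A" "closed A"
    unfolding assms(4) by (rule X.operator_algebra_axioms, rule X.closed_A)
  have closed: "closed (jacobson_radical A)" by (rule closed_jacobson_radical[OF alg])
  have ideals: "ideal A (jacobson_radical A)" "ideal A (prime_radical A)"
    unfolding assms(4) by (rule X.ideal_jacobson_radical, rule X.ideal_prime_radical)
  have le: "prime_radical A \<subseteq> jacobson_radical A"
    unfolding assms(4) by (rule X.prime_radical_subset_jacobson_radical)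
  have rad_le: "jacobson_radical A \<subseteq> I" if I: "ideal A I" "closed I" "?G \<subseteq> I" for I
  proof
    fix a assume a: "a \<in> jacobson_radical A"
    then have aA: "a \<in> crossed_product \<phi> \<rho>" by (simp add: jacobson_radical_def assms(4))
    have "monomial \<phi> \<rho> n (X.coeff a n) \<in> I" for n
    proof -
      have vanish: "X.coeff a n x = 0" if "x \<in> recurrent \<phi> {j. n $ j \<noteq> 0}" for x
        by (rule X.jacobson_radical_monomial[OF assms(1) X.coeff_C0[OF aA] _ that])
          (use X.monomial_coeff_jacobson_radical a in \<open>simp add: assms(4)\<close>)
      show ?thesis
      proof (cases "n = 0")
        case True
        \<comment> \<open>The generators omit degree 0, but there the coefficient vanishes
          everywhere.\<close>
        have "X.coeff a 0 x = 0" for x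
          by (rule X.jacobson_radical_monomial_zero[OF X.coeff_C0[OF aA]])
            (use X.monomial_coeff_jacobson_radical a in \<open>simp add: assms(4)\<close>)
        then have "X.coeff a n = (\<lambda>_. 0)" using True by auto
        then show ?thesis
          using cvec.subspace_0[OF ideal_subspace[OF I(1)]] by (simp add: X.monomial_zero)
      next
        case False
        then show ?thesis using I(3) X.coeff_C0[OF aA] vanish by blast
      qed
    qed
    then show "a \<in> I" by (rule X.closed_subspace_memI[OF ideal_subspace[OF I(1)] I(2) aA])
  qed
  \<comment> \<open>Both radicals are semiprime, so this applies to
    \<open>jacobson_radical A\<close> and, once closed, to \<open>prime_radical A\<close>.\<close>
  have G_le: "?G \<subseteq> R"
    if R: "ideal A R" "closed R"
      and semiprime: "\<And>a. a \<in> A \<Longrightarrow> (\<And>b. b \<in> A \<Longrightarrow> a o\<^sub>L (b o\<^sub>L a) \<in> R) \<Longrightarrow> a \<in> R" for R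
    using X.semiprime_ideal_monomial[OF assms(1) R[unfolded assms(4)] semiprime[unfolded assms(4)]] by blast
  have "jacobson_radical A = closed_ideal_generated A ?G"
  proof (rule antisym)
    show "jacobson_radical A \<subseteq> closed_ideal_generated A ?G"
      unfolding closed_ideal_generated_def hull_def using rad_le by blast
    show "closed_ideal_generated A ?G \<subseteq> jacobson_radical A"
      unfolding closed_ideal_generated_def
      using ideals(1) closed G_le[OF ideals(1) closed] X.jacobson_radical_semiprime
      by (intro hull_minimal) (auto simp: assms(4))
  qed
  moreover have "prime_radical A = jacobson_radical A" if c: "closed (prime_radical A)"
  proof (rule antisym[OF le])
    have "?G \<subseteq> prime_radical A"
      by (rule G_le[OF ideals(2) c]) (use X.prime_radical_semiprime in \<open>simp add: assms(4)\<close>)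
    then show "jacobson_radical A \<subseteq> prime_radical A" by (rule rad_le[OF ideals(2) c])
  qed
  \<comment> \<open>If the two radicals agree, the prime radical inherits closedness from the
    Jacobson radical.\<close>
  ultimately show ?thesis using closed by metis
qed

end
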